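(* Let $a,b,c,d,e,f$ be nonzero complex numbers and $s=\dfrac{a^3q^3}{bcdef}$. With $W_2',W_{2+}',S_2',T_2',L_2',W_3,W_{3+},S_3,T_3,L_3'$ as in the context, $$L_2'L_3'(1-q)\bigl[(S_2'-S_3)W_2'W_3-T_2'W_{2+}'W_3+T_3W_2'W_{3+}\bigr]$$ $$=-\frac{aq^2}{s}\,\frac{(\frac{q^2}{a},\frac qc,\frac qd,\frac qe,\frac qf,\frac{cdef}{a^2},\frac{a^2q}{cdef},\frac{s}{bq},\frac{bq^2}{s})_\infty}{(b,\frac ba,\frac{bq}{a},\frac{cq}{a},\frac{dq}{a},\frac{eq}{a},\frac{fq}{a},\frac{aq}{b},\frac{aq^2}{s})_\infty}.$$
   Context: Throughout $q\in\mathbb C$, $0<|q|<1$; $(x)_0=1$, $(x)_k=\prod_{j=0}^{k-1}(1-xq^j)$, $(x)_\infty=\prod_{j\ge 0}(1-xq^j)$, $(x_1,\dots,x_r)_k=\prod_i (x_i)_k$. The very-well-poised series is $${}_8W_7(a;p_1,\dots,p_5;z)=\sum_{k=0}^\infty \frac{1-aq^{2k}}{1-a}\,\frac{(a,p_1,\dots,p_5)_k}{(q,aq/p_1,\dots,aq/p_5)_k}\,z^k,\qquad z=\frac{a^2q^2}{p_1\cdots p_5},$$ for $|z|<1$, and its analytic continuation in the parameters otherwise. Put $$W_2'={}_8W_7\bigl(\tfrac{cde}{a^2};\tfrac{ce}{a},\tfrac{cd}{a},\tfrac{de}{a},\tfrac qf,\tfrac qb;\tfrac{bf}{a}\bigr),\qquad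 W_{2+}'={}_8W_7\bigl(\tfrac{cdeq^2}{a^2};\tfrac{ceq}{a},\tfrac{cdq}{a},\tfrac{deq}{a},\tfrac{q^2}{f},\tfrac{q^2}{b};\tfrac{bf}{aq}\bigr),$$ $$S_2'=\frac1{1-q}\Bigl(q+\frac{cs}{aq}+\frac{ds}{aq}+\frac{es}{aq}+\frac{a^2q}{cde}+\frac{aq}{f}+\frac{aq}{b}-\frac{aq^2}{bf}\Bigr),$$ $$T_2'=\frac{\frac{bfs}{aq^2}(1-\frac{bf}{aq})(1-\frac{cdeq}{a^2})(1-\frac{cdeq^2}{a^2})(1-\frac{cd}{a})(1-\frac{ce}{a})(1-\frac{de}{a})(1-\frac qf)(1-\frac qb)}{(1-q)(1-\frac{cq}{a})(1-\frac{dq}{a})(1-\frac{eq}{a})(1-\frac{cdef}{a^2})(1-\frac{bcde}{a^2})},$$ $$L_2'=\frac{(\frac{q^2}{a},\frac{cdef}{a^2},\frac{bcde}{a^2},\frac{bf}{a})_\infty}{(\frac{cdeq}{a^2},\frac{fq}{a},\frac{bq}{a},\frac{aq^2}{s})_\infty},$$ $$W_3={}_8W_7\bigl(\tfrac{b^2}{a};b,\tfrac{bc}{a},\tfrac{bd}{a},\tfrac{be}{a},\tfrac{bf}{a};\tfrac{s}{aq}\bigr),\qquad W_{3+}={}_8W_7\bigl(\tfrac{b^2q^2}{a};bq,\tfrac{bcq}{a},\tfrac{bdq}{a},\tfrac{beq}{a},\tfrac{bfq}{a};\tfrac{s}{aq^2}\bigr),$$ $$S_3=\frac1{1-q}\Bigl(\frac{aq}{c}+\frac{aq}{d}+\frac{aq}{e}+\frac{aq}{f}+\frac{bs}{aq}+q+\frac{s}{bq}-bq\Bigr),$$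 $$T_3=\frac{\frac{s}{bq}(1-\frac{s}{aq^2})(1-\frac{b^2q}{a})(1-\frac{b^2q^2}{a})(1-\frac{bc}{a})(1-\frac{bd}{a})(1-\frac{be}{a})(1-\frac{bf}{a})(1-b)}{(1-q)(1-\frac{bq}{c})(1-\frac{bq}{d})(1-\frac{bq}{e})(1-\frac{bq}{f})(1-\frac{bq}{a})},$$ $$L_3'=\frac{(\frac{s}{aq},\frac{bq}{c},\frac{bq}{d},\frac{bq}{e},\frac{bq}{f},\frac{bq}{a},\frac{bq}{s},\frac sb)_\infty}{(\frac{b^2q}{a},\frac{bc}{a},\frac{bd}{a},\frac{be}{a},\frac{bf}{a},b,\frac ba,\frac{aq}{b})_\infty}.$$ Standing assumption: parameters are such that no zero denominators (singularities) occur. *)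

theory Defs
  imports "HOL-Analysis.Analysis"
begin

definition qpoch :: "complex \<Rightarrow> complex \<Rightarrow> nat \<Rightarrow> complex" where
  "qpoch q x k = (\<Prod>j<k. 1 - x * q ^ j)"

definition qpochs :: "complex \<Rightarrow> complex list \<Rightarrow> nat \<Rightarrow> complex" where
  "qpochs q xs k = (\<Prod>x\<leftarrow>xs. qpoch q x k)"

definition qinf :: "complex \<Rightarrow> complex \<Rightarrow> complex" where
  "qinf q x = (\<Prod>j. 1 - x * q ^ j)"

definition qinfs :: "complex \<Rightarrow> complex list \<Rightarrow> complex" where
  "qinfs q xs = (\<Prod>x\<leftarrow>xs. qinf q x)"

definition W87_arg :: "complex \<Rightarrow> complex \<Rightarrow> complex list \<Rightarrow> complex" where
  "W87_arg q a ps = a^2 * q^2 / prod_list ps"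

definition W87_series :: "complex \<Rightarrow> complex \<Rightarrow> complex list \<Rightarrow> complex" where
  "W87_series q a ps =
     (\<Sum>k. (1 - a * q ^ (2 * k)) / (1 - a)
          * (qpochs q (a # ps) k / qpochs q (q # map (\<lambda>p. a * q / p) ps) k)
          * W87_arg q a ps ^ k)"

type_synonym params = "complex \<times> complex \<times> complex \<times> complex \<times> complex \<times> complex"

text \<open>Holomorphy in six complex variables: at each point there is a complex-linear
  (Frechet) derivative.  It is only used on open sets.\<close>

definition holomorphic6_on :: "(params \<Rightarrow> complex) \<Rightarrow> params set \<Rightarrow> bool" where
  "holomorphic6_on F S \<longleftrightarrow>
     (\<forall>x\<in>S. \<exists>g g1 g2 g3 g4 g5.
        (F has_derivative
           (\<lambda>(h, h1, h2, h3, h4, h5). g * h + g1 * h1 + g2 * h2 + g3 * h3 + g4 * h4 + g5 * h5))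
        (at x))"

text \<open>The parameter points without singularities.  The first conditions say that no denominator
  of the series vanishes; the last one, with \<open>z\<close> the argument of the series, removes
  the poles \<open>z = 1, 1/q, 1/q^2, \<dots>\<close> of the continuation, which all lie outside
  \<open>|z| < 1\<close>.  The domain is open and connected, so a continuation to it is unique.\<close>

definition W87_domain :: "complex \<Rightarrow> params set" where
  "W87_domain q =
     {(a, p1, p2, p3, p4, p5).
        a \<noteq> 0 \<and> a \<noteq> 1 \<and>
        (\<forall>p \<in> {p1, p2, p3, p4, p5}. p \<noteq> 0 \<and> qinf q (a * q / p) \<noteq> 0) \<and>
        qinf q (W87_arg q a [p1, p2, p3, p4, p5]) \<noteq> 0}"

definition W87_continuation :: "complex \<Rightarrow> (params \<Rightarrow> complex) \<Rightarrow> bool" where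
  "W87_continuation q F \<longleftrightarrow>
     holomorphic6_on F (W87_domain q) \<and>
     (\<forall>a p1 p2 p3 p4 p5.
        (a, p1, p2, p3, p4, p5) \<in> W87_domain q \<and> norm (W87_arg q a [p1, p2, p3, p4, p5]) < 1
        \<longrightarrow> F (a, p1, p2, p3, p4, p5) = W87_series q a [p1, p2, p3, p4, p5])"

text \<open>The argument of the very-well-poised series is not a separate parameter of \<open>W87\<close>,
  since it is determined by the others.\<close>

definition W87 ::
    "complex \<Rightarrow> complex \<Rightarrow> complex \<Rightarrow> complex \<Rightarrow> complex \<Rightarrow> complex \<Rightarrow> complex \<Rightarrow> complex" where
  "W87 q a p1 p2 p3 p4 p5 =
     (if norm (W87_arg q a [p1, p2, p3, p4, p5]) < 1
      then W87_series q a [p1, p2, p3, p4, p5]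
      else (THE w. \<exists>F. W87_continuation q F \<and> w = F (a, p1, p2, p3, p4, p5)))"

end

theory Submission
  imports Defs "HOL-Complex_Analysis.Complex_Analysis"
begin

text \<open>
  Write \<open>X\<close> and \<open>Y\<close> for the series \<open>W2\<close> and \<open>W3\<close>. A contiguous relation, proved by summing a
  telescoping certificate, turns the bracket into a Casoratian of \<open>X\<close> and \<open>Y\<close> with respect to the
  shift \<open>(b, f) \<mapsto> (bq, f/q)\<close>: both series satisfy the same three-term recurrence in that
  direction, so the Casoratian satisfies a first-order recurrence and is determined by its limit
  under iteration. In the limit \<open>X\<close> degenerates to a \<open>\<^sub>6W\<^sub>5\<close> series, summed by iterating its
  own contiguous relation, and \<open>Y\<close> to a \<open>q\<close>-binomial series.

  This argument needs both series to converge and the parameters to be generic. In general the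
  continuation of the series exists because the recurrence of its coefficients gives a
  \<open>q\<close>-difference equation in the argument \<open>z\<close> with the single leading factor \<open>1 - z\<close>. The identity
  then extends by the identity theorem along the curve \<open>(at, bt\<^sup>3, c/t, d/t, e/t, ft)\<close>, which enters
  the region of convergence as \<open>t \<rightarrow> 0\<close>.
\<close>

text \<open>The shift (b, f) -> (bq, f/q) fixes cde/a^2 and bf, hence both arguments bf/a and
  s/(aq), so the iteration never leaves the region of convergence. Meanwhile q/b tends to infinity
  and q/f and b^2/a tend to 0, which is why the limits can be summed in closed form. The three-term
  recurrence is never written down: the Casoratian at (b, f) and the one at (bq, f/q) contain the
  same two auxiliary series \<open>Xm\<close> and \<open>Yp\<close>, and two contiguous relations
  exchange the others. The link to the theorem is that S3, built from the parameters of W3, is up to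
  the factor q/(bf/a)/(1 - q) the coefficient that the relation lowering q/b assigns to W2. The
  continuation cannot be built from the terms as they stand: their ratio has the denominator 1 - a
  q^(2k), while \<open>W87_domain\<close> excludes only a = 1. It is therefore assembled from the
  series without the factor 1 - a q^(2k), taken at the arguments z and q^2 z.\<close>

section \<open>Contiguous relations\<close>

text \<open>Telescoping certificate for \<open>contiguous_moments\<close>, with \<open>x = q^k\<close>, \<open>w = a q/p5\<close> and
  \<open>f3, f2, f1, f4\<close> the elementary symmetric functions of degree 1, 2, 3, 4 of \<open>1/p1, \<dots>, 1/p4\<close>.\<close>

lemma contiguous_cert_poly:
  fixes a q x w f1 f2 f3 f4 :: complex
  shows "(w - a*x)*(1-w*x)*(1-a*x^2) * ((f3 + w*f4 - 1 - w*f1)*w*a*x - a*x + w^3*f4*a*x)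
   - (w - a*x)*(1-w*x)*(1-a*x^2) * ((1-a*w*f4)*w*(1+a*x^2-x-a*x))
   - (a-w)*(1-w*f3+w^2*f2-w^3*f1+w^4*f4)*a*x^2*(1-a*x^2)
   = a*w^2*(1-a*x)*(f4-f1*x+f2*x^2-f3*x^3+x^4)*(w-a*x)
     - (1-x)*w^2*(1-a*x*f3+a^2*x^2*f2-a^3*x^3*f1+a^4*x^4*f4)*(1-w*x)"
    by (simp add: algebra_simps power2_eq_square power3_eq_cube power4_eq_xxxx)

text \<open>Clearing \<open>D\<close> from the five fractions one at a time keeps every
  simplification small; the polynomial identity then joins the cleared numerators.\<close>

lemma cancel_common:
  fixes D :: complex
  assumes "A1*D = q*X1" "A2*D = q*X2" "A3*D = q*X3" "B*C1*D = q*Y1" "B*C2*D = q*Y2"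
    and "X1 - X2 - X3 = Y1 - Y2" "D \<noteq> 0"
  shows "A1 - A2 - A3 = B*(C1 - C2)"
proof -
  have "(A1 - A2 - A3)*D = A1*D - A2*D - A3*D" by (simp only: left_diff_distrib)
  also have "\<dots> = q*(X1 - X2 - X3)" by (simp only: assms(1-3) right_diff_distrib)
  also have "\<dots> = q*Y1 - q*Y2" by (simp only: assms(6) right_diff_distrib)
  also have "\<dots> = B*(C1 - C2)*D" by (simp only: assms(4,5)[symmetric] left_diff_distrib right_diff_distrib)
  finally show ?thesis using assms(7) by simp
qed

text \<open>With x = q^k the left side is the weight of \<open>t k\<close> in the relation to be
  proved: a constant, a multiple of 1/x + a x - 1 - a, which produces the series with all parameters
  raised, and a multiple of \<open>kern\<close>, which produces the series with \<open>p5\<close>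
  lowered. The right side is the difference of two consecutive values of the telescoping sequence,
  divided by \<open>t k\<close>.\<close>

lemma contiguous_cert:
  fixes a q x w f1 f2 f3 f4 :: complex
  assumes nz: "a\<noteq>0" "x\<noteq>0" "w\<noteq>0" "1-a*x^2\<noteq>0" "1-a*x/w\<noteq>0" "1-w*x\<noteq>0"
  shows "q*(f3 + w*f4 - 1 - w*f1 - 1/w + w^2*f4)
    - q*(1-a*w*f4)/a*(1/x+a*x-1-a)
    - a*q/w^2*(1-w/a)*(1-w*f3+w^2*f2-w^3*f1+w^4*f4) * (x/((1-a*x/w)*(1-w*x)))
   = q/(a*x*(1-a*x^2))*(a*w*(1-a*x)*(f4-f1*x+f2*x^2-f3*x^3+x^4)/(1-w*x)
      - (1-x)*(1-(a*x)*f3+(a*x)^2*f2-(a*x)^3*f1+(a*x)^4*f4)/(1-a*x/w))"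
  (is "?A1 - ?A2 - ?A3 = ?B * (?C1 - ?C2)")
proof -
  define D where "D = a*x*w*((1-a*x^2)*(1-w*x)*(w-a*x))"
  have e: "1-a*x/w = (w-a*x)/w" using nz by (simp add: field_simps)
  have nz2: "w-a*x\<noteq>0" using nz by (auto simp: field_simps)
  have D: "D \<noteq> 0" using nz nz2 by (simp add: D_def)
  have a1: "?A1 * D = q * ((w - a*x)*(1-w*x)*(1-a*x^2) * ((f3 + w*f4 - 1 - w*f1)*w*a*x - a*x + w^3*f4*a*x))"
    unfolding D_def using nz by (simp add: field_simps power2_eq_square power3_eq_cube)
  have a2: "?A2 * D = q * ((w - a*x)*(1-w*x)*(1-a*x^2) * ((1-a*w*f4)*w*(1+a*x^2-x-a*x)))"
    unfolding D_def using nz by (simp add: divide_simps) (simp add: algebra_simps power2_eq_square)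
  have a3: "?A3 * D = q * ((a-w)*(1-w*f3+w^2*f2-w^3*f1+w^4*f4)*a*x^2*(1-a*x^2))"
  proof -
    have "a*q/w^2*(1-w/a) * (x/(((w-a*x)/w)*(1-w*x))) * D = q * (a-w)*a*x^2*(1-a*x^2)"
      unfolding D_def using nz nz2 by (simp add: divide_simps) (simp add: algebra_simps power2_eq_square)
    from arg_cong[OF this, of "\<lambda>y. (1-w*f3+w^2*f2-w^3*f1+w^4*f4)*y"] show ?thesis unfolding e
      by (simp only: mult_ac times_divide_eq_left times_divide_eq_right)
  qed
  have c1: "?B * ?C1 * D = q * (a*w^2*(1-a*x)*(f4-f1*x+f2*x^2-f3*x^3+x^4)*(w-a*x))"
  proof -
    have "q/(a*x*(1-a*x^2)) * (a*w*(1-a*x)/(1-w*x)) * D = q * (a*w^2*(1-a*x)*(w-a*x))"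
      unfolding D_def using nz nz2 by (simp add: divide_simps) (simp add: algebra_simps power2_eq_square)
    from arg_cong[OF this, of "\<lambda>y. (f4-f1*x+f2*x^2-f3*x^3+x^4)*y"] show ?thesis
      by (simp only: mult_ac times_divide_eq_left times_divide_eq_right)
  qed
  have c2: "?B * ?C2 * D = q * ((1-x)*w^2*(1-a*x*f3+a^2*x^2*f2-a^3*x^3*f1+a^4*x^4*f4)*(1-w*x))"
  proof -
    have "q/(a*x*(1-a*x^2)) * ((1-x)*y/((w-a*x)/w)) * D = q * ((1-x)*w^2*y*(1-w*x))" for y
      unfolding D_def using nz nz2 by (simp add: divide_simps) (simp add: algebra_simps power2_eq_square)
    from this[of "1-a*x*f3+a^2*x^2*f2-a^3*x^3*f1+a^4*x^4*f4"] show ?thesis unfolding e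
      by (simp only: power_mult_distrib)
  qed
  show ?thesis
    by (rule cancel_common[OF a1 a2 a3 c1 c2 contiguous_cert_poly D])
qed

section \<open>Shifted factorials and generic parameters\<close>

lemma qpoch_0 [simp]: "qpoch q x 0 = 1"
  by (simp add: qpoch_def)

lemma qpoch_Suc: "qpoch q x (Suc k) = qpoch q x k * (1 - x * q ^ k)"
  by (simp add: qpoch_def)

lemma qpoch_Suc_shift: "qpoch q x (Suc k) = (1 - x) * qpoch q (x * q) k"
  by (simp only: qpoch_def prod.lessThan_Suc_shift) (simp add: mult_ac)

lemma qpoch_shift: "(1 - x) * qpoch q (x * q) k = qpoch q x k * (1 - x * q ^ k)"
  using qpoch_Suc qpoch_Suc_shift by metis

text \<open>Off the powers of \<open>q\<close>, no factor of any shifted factorial vanishes.\<close>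

definition generic :: "complex \<Rightarrow> complex \<Rightarrow> bool" where
  "generic q x \<longleftrightarrow> x \<noteq> 0 \<and> (\<forall>k::int. x \<noteq> q powi k)"

lemma generic_shift:
  assumes "generic q x" "q \<noteq> 0"
  shows "generic q (x * q powi m)"
  unfolding generic_def
proof (intro conjI allI notI)
  show "x * q powi m = 0 \<Longrightarrow> False" using assms by (auto simp: generic_def)
  fix k assume "x * q powi m = q powi k"
  then have "x = q powi (k - m)"
    using assms(2) by (simp add: power_int_diff field_simps)
  then show False using assms(1) by (auto simp: generic_def)
qed

lemma generic_mult_q: "generic q x \<Longrightarrow> q \<noteq> 0 \<Longrightarrow> generic q (x * q)"
  using generic_shift[of q x 1] by simp

lemma generic_div_q: "generic q x \<Longrightarrow> q \<noteq> 0 \<Longrightarrow> generic q (x / q)"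
  using generic_shift[of q x "-1"] by (simp add: field_simps)

lemma generic_inverse:
  assumes "generic q x" "q \<noteq> 0"
  shows "generic q (1 / x)"
  unfolding generic_def
proof (intro conjI allI notI)
  show "1 / x = 0 \<Longrightarrow> False" using assms by (auto simp: generic_def)
  fix k assume "1 / x = q powi k"
  then have "x = q powi (- k)" using assms by (auto simp: generic_def power_int_minus divide_simps mult.commute split: if_splits)
  then show False using assms(1) by (auto simp: generic_def)
qed

lemma generic_nz: "generic q x \<Longrightarrow> x \<noteq> 0"
  by (simp add: generic_def)

lemma generic_factor:
  assumes "generic q x" "q \<noteq> 0"
  shows "1 - x * q ^ k \<noteq> 0"
proof
  assume "1 - x * q ^ k = 0"
  then have "x = q powi (- int k)" using assms(2) by (simp add: power_int_minus field_simps)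
  then show False using assms(1) by (auto simp: generic_def)
qed

lemma generic_1: "generic q x \<Longrightarrow> q \<noteq> 0 \<Longrightarrow> 1 - x \<noteq> 0"
  using generic_factor[of q x 0] by simp

lemma generic_qpoch: "generic q x \<Longrightarrow> q \<noteq> 0 \<Longrightarrow> qpoch q x k \<noteq> 0"
  using generic_factor by (auto simp: qpoch_def)

lemma qpoch_qq_nz:
  assumes "norm q < 1"
  shows "qpoch q q k \<noteq> 0"
proof -
  have "1 - q * q ^ j \<noteq> 0" for j
  proof
    assume "1 - q * q ^ j = 0"
    then have "norm (q ^ Suc j) = 1" by simp
    moreover have "norm (q ^ Suc j) < 1"
      unfolding norm_power using assms by (simp add: power_less_one_iff del: power_Suc)
    ultimately show False by simp
  qed
  then show ?thesis by (auto simp: qpoch_def)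
qed

section \<open>The terms of the very-well-poised series\<close>

lemma ratio_summable:
  fixes f r :: "nat \<Rightarrow> complex"
  assumes rec: "\<And>k. f (Suc k) = f k * r k" and r: "r \<longlonglongrightarrow> l" and l: "norm l < 1"
  shows "summable (\<lambda>k. norm (f k))"
proof -
  obtain c where c: "norm l < c" "c < 1" using l dense by blast
  have "eventually (\<lambda>k. norm (r k) < c) sequentially"
    using order_tendstoD(2)[OF tendsto_norm[OF r] c(1)] .
  then obtain N where N: "\<And>k. k \<ge> N \<Longrightarrow> norm (r k) < c"
    by (auto simp: eventually_sequentially)
  have "norm (f (Suc k)) \<le> c * norm (f k)" if "k \<ge> N" for k
    using mult_left_mono[OF less_imp_le[OF N[OF that]] norm_ge_zero[of "f k"]]
    by (simp add: rec norm_mult mult_ac)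
  then show ?thesis
    using summable_norm_cancel summable_ratio_test[of c N "\<lambda>k. norm (f k)"] c(2) by force
qed

text \<open>The argument \<open>z\<close> is a free variable here. Relations that only raise
  parameters hold for every small \<open>z\<close>; the value forced by the parameters enters with
  \<open>zdef\<close> in \<open>vwp_down\<close>.\<close>

definition vterm :: "complex \<Rightarrow> complex \<Rightarrow> complex \<Rightarrow> complex \<Rightarrow> complex \<Rightarrow> complex \<Rightarrow> complex
    \<Rightarrow> complex \<Rightarrow> nat \<Rightarrow> complex" where
  "vterm q a p1 p2 p3 p4 p5 z k =
     (1 - a * q ^ (2 * k)) / (1 - a)
     * ((qpoch q a k * qpoch q p1 k * qpoch q p2 k * qpoch q p3 k * qpoch q p4 k * qpoch q p5 k)
       / (qpoch q q k * qpoch q (a*q/p1) k * qpoch q (a*q/p2) k * qpoch q (a*q/p3) k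
          * qpoch q (a*q/p4) k * qpoch q (a*q/p5) k))
     * z ^ k"

definition vser :: "complex \<Rightarrow> complex \<Rightarrow> complex \<Rightarrow> complex \<Rightarrow> complex \<Rightarrow> complex \<Rightarrow> complex
    \<Rightarrow> complex \<Rightarrow> complex" where
  "vser q a p1 p2 p3 p4 p5 z = (\<Sum>k. vterm q a p1 p2 p3 p4 p5 z k)"

lemma W87_series_vser:
  "W87_series q a [p1, p2, p3, p4, p5] = vser q a p1 p2 p3 p4 p5 (W87_arg q a [p1, p2, p3, p4, p5])"
  by (simp add: W87_series_def vser_def vterm_def qpochs_def mult_ac)

lemma vser_swap45: "vser q a p1 p2 p3 p4 p5 z = vser q a p1 p2 p3 p5 p4 z"
  by (simp add: vser_def vterm_def mult_ac)

lemma vterm_mult_power: "vterm q a p1 p2 p3 p4 p5 z k * w ^ k = vterm q a p1 p2 p3 p4 p5 (z * w) k"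
  by (simp add: vterm_def power_mult_distrib)

text \<open>The ratio of consecutive terms as a rational function of u = q^k, so that its limit for
  large k is its value at u = 0, which is \<open>z\<close>.\<close>

definition vratio :: "complex \<Rightarrow> complex \<Rightarrow> complex \<Rightarrow> complex \<Rightarrow> complex \<Rightarrow> complex \<Rightarrow> complex
    \<Rightarrow> complex \<Rightarrow> complex \<Rightarrow> complex" where
  "vratio q a p1 p2 p3 p4 p5 z u =
     (1 - a*q^2*u^2) / (1 - a*u^2)
     * (((1 - a*u) * (1 - p1*u) * (1 - p2*u) * (1 - p3*u) * (1 - p4*u) * (1 - p5*u))
       / ((1 - q*u) * (1 - a*q/p1*u) * (1 - a*q/p2*u) * (1 - a*q/p3*u)
          * (1 - a*q/p4*u) * (1 - a*q/p5*u)))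
     * z"

lemma vterm_Suc:
  assumes "1 - a * q ^ (2 * k) \<noteq> 0"
  shows "vterm q a p1 p2 p3 p4 p5 z (Suc k)
    = vterm q a p1 p2 p3 p4 p5 z k * vratio q a p1 p2 p3 p4 p5 z (q ^ k)"
proof -
  define d where "d = 1 - a * q ^ (2 * k)"
  have "d \<noteq> 0" using assms by (simp add: d_def)
  have e: "q ^ (2 * Suc k) = q^2 * (q^k)^2" "q ^ (2 * k) = (q^k)^2"
    by (simp_all add: power_mult[symmetric] power2_eq_square power_mult_distrib mult_2 power_add)
  have d': "1 - a * (q^k)^2 = d" by (simp add: d_def e)
  show ?thesis
    unfolding vterm_def vratio_def qpoch_Suc e d' using \<open>d \<noteq> 0\<close>
    by (simp add: mult_ac)
qed

lemma generic_square_factor: "generic q a \<Longrightarrow> q \<noteq> 0 \<Longrightarrow> 1 - a * (q ^ k)^2 \<noteq> 0"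
  using generic_factor[of q a "k*2"] by (simp add: power_mult)

lemma vratio_tendsto:
  assumes "norm q < 1"
  shows "(\<lambda>k. vratio q a p1 p2 p3 p4 p5 z (q ^ k)) \<longlonglongrightarrow> z"
proof -
  have "(\<lambda>k. q ^ k) \<longlonglongrightarrow> 0" using assms by (rule LIMSEQ_power_zero)
  then have "(\<lambda>k. vratio q a p1 p2 p3 p4 p5 z (q ^ k)) \<longlonglongrightarrow> vratio q a p1 p2 p3 p4 p5 z 0"
    unfolding vratio_def by (intro tendsto_intros) (use assms in auto)
  then show ?thesis by (simp add: vratio_def)
qed

lemma vterm_summable_norm:
  assumes "0 < norm q" "norm q < 1" "generic q a" "norm z < 1"
  shows "summable (\<lambda>k. norm (vterm q a p1 p2 p3 p4 p5 z k))"
proof (rule ratio_summable[OF _ vratio_tendsto[OF assms(2)] assms(4)])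
  fix k show "vterm q a p1 p2 p3 p4 p5 z (Suc k)
      = vterm q a p1 p2 p3 p4 p5 z k * vratio q a p1 p2 p3 p4 p5 z (q ^ k)"
    using assms generic_factor[of q a "2*k"] by (intro vterm_Suc) auto
qed

lemma vterm_summable:
  assumes "0 < norm q" "norm q < 1" "generic q a" "norm z < 1"
  shows "summable (vterm q a p1 p2 p3 p4 p5 z)"
  using vterm_summable_norm[OF assms] summable_norm_cancel by blast

lemma vterm_sums:
  assumes "0 < norm q" "norm q < 1" "generic q a" "norm z < 1"
  shows "vterm q a p1 p2 p3 p4 p5 z sums vser q a p1 p2 p3 p4 p5 z"
  using vterm_summable[OF assms] by (simp add: vser_def summable_sums)

lemma vterm_up5:
  assumes "q \<noteq> 0" "generic q (a/p5)"
  shows "(1 - p5) * (1 - a/p5) * vterm q a p1 p2 p3 p4 (p5*q) (z/q) k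
    = vterm q a p1 p2 p3 p4 p5 z k * (1/q^k + a*q^k - p5 - a/p5)"
proof -
  have nz: "p5 \<noteq> 0" "a \<noteq> 0" using assms(2) by (auto simp: generic_def)
  define u where "u = q ^ k"
  have u: "u \<noteq> 0" using assms by (simp add: u_def)
  have g: "1 - a/p5 \<noteq> 0" "qpoch q (a/p5*q) k \<noteq> 0" "qpoch q (a/p5) k \<noteq> 0"
    using assms generic_1 generic_qpoch generic_mult_q by blast+
  have s1: "(1-p5) * qpoch q (p5*q) k = qpoch q p5 k * (1 - p5*u)"
    and s2: "(1-a/p5) * qpoch q (a/p5*q) k = qpoch q (a/p5) k * (1 - a/p5*u)"
    unfolding u_def by (rule qpoch_shift)+
  have e: "a*q/(p5*q) = a/p5" "a*q/p5 = a/p5*q" "(z/q)^k = z^k/u"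
    using assms by (auto simp: u_def power_divide)
  have s3: "(1-a/p5)/qpoch q (a/p5) k = (1 - a/p5*u) / qpoch q (a/p5*q) k"
    using s2 g by (simp add: field_simps)
  have key: "(1-p5) * (1-a/p5) * (qpoch q (p5*q) k / qpoch q (a/p5) k) / u
      = qpoch q p5 k / qpoch q (a/p5*q) k * (1/u + a*u - p5 - a/p5)"
  proof -
    have "(1-p5) * (1-a/p5) * (qpoch q (p5*q) k / qpoch q (a/p5) k) / u
      = ((1-p5) * qpoch q (p5*q) k) * ((1-a/p5) / qpoch q (a/p5) k) / u" by simp
    also have "\<dots> = (qpoch q p5 k * (1 - p5*u)) * ((1 - a/p5*u) / qpoch q (a/p5*q) k) / u"
      unfolding s1 s3 ..
    also have "\<dots> = qpoch q p5 k / qpoch q (a/p5*q) k * (((1 - p5*u)*(1-a/p5*u))/u)" by simp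
    also have "((1 - p5*u)*(1-a/p5*u))/u = 1/u + a*u - p5 - a/p5"
      using u nz by (simp add: field_simps power2_eq_square)
    finally show ?thesis .
  qed
  define B where "B = (1 - a * q ^ (2 * k)) / (1 - a)
     * ((qpoch q a k * qpoch q p1 k * qpoch q p2 k * qpoch q p3 k * qpoch q p4 k)
       / (qpoch q q k * qpoch q (a*q/p1) k * qpoch q (a*q/p2) k * qpoch q (a*q/p3) k
          * qpoch q (a*q/p4) k)) * z ^ k"
  have "(1 - p5) * (1 - a/p5) * vterm q a p1 p2 p3 p4 (p5*q) (z/q) k
    = B * ((1-p5) * (1-a/p5) * (qpoch q (p5*q) k / qpoch q (a/p5) k) / u)"
    unfolding vterm_def e B_def by (simp add: mult_ac)
  also have "\<dots> = B * (qpoch q p5 k / qpoch q (a/p5*q) k * (1/u + a*u - p5 - a/p5))"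
    unfolding key ..
  also have "\<dots> = vterm q a p1 p2 p3 p4 p5 z k * (1/q^k + a*q^k - p5 - a/p5)"
    unfolding vterm_def e B_def u_def by (simp add: mult_ac)
  finally show ?thesis .
qed

text \<open>This is \<open>vterm_up5\<close> read backwards at p5/q. The weight is now a reciprocal,
  no longer a combination of q^k and 1/q^k, and needs a moment of its own.\<close>

lemma vterm_down5:
  assumes "q \<noteq> 0" "generic q p5" "generic q (a/p5)"
  shows "vterm q a p1 p2 p3 p4 (p5/q) (z*q) k
    = (1 - p5/q) * (1 - a*q/p5)
      * (vterm q a p1 p2 p3 p4 p5 z k * (q^k / ((1 - p5/q*q^k) * (1 - a*q/p5*q^k))))"
proof -
  have g: "generic q (a/(p5/q))" using generic_mult_q[OF assms(3,1)] by simp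
  have nz: "1 - p5/q*q^k \<noteq> 0" "1 - a*q/p5*q^k \<noteq> 0" "p5 \<noteq> 0"
    using generic_factor[OF generic_div_q] generic_factor[OF g] assms by (auto simp: generic_def)
  have "(1 - p5/q) * (1 - a*q/p5) * vterm q a p1 p2 p3 p4 p5 z k
     = vterm q a p1 p2 p3 p4 (p5/q) (z*q) k * (1/q^k + a*q^k - p5/q - a*q/p5)"
    using vterm_up5[OF assms(1) g, of p1 p2 p3 p4 "z*q" k] assms by simp
  also have "1/q^k + a*q^k - p5/q - a*q/p5 = (1 - p5/q*q^k) * (1 - a*q/p5*q^k) / q^k"
    using assms(1) nz(3) by (simp add: field_simps power2_eq_square)
  finally have eq: "(1 - p5/q) * (1 - a*q/p5) * vterm q a p1 p2 p3 p4 p5 z k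
     = vterm q a p1 p2 p3 p4 (p5/q) (z*q) k * ((1 - p5/q*q^k) * (1 - a*q/p5*q^k) / q^k)" .
  have "vterm q a p1 p2 p3 p4 (p5/q) (z*q) k = vterm q a p1 p2 p3 p4 (p5/q) (z*q) k
     * ((1 - p5/q*q^k) * (1 - a*q/p5*q^k) / q^k) * (q^k / ((1 - p5/q*q^k) * (1 - a*q/p5*q^k)))"
    using nz assms(1) by (simp del: mult_divide_mult_cancel_left_if)
  then show ?thesis unfolding eq[symmetric] by (simp only: mult.assoc)
qed

text \<open>At u = q^(k+1) the weight (1 - a u)(1 - u)/u equals 1/u + a u - 1 - a: raising all
  parameters has the same shape as raising one, with constant 1 + a. The index moves by one, but the
  weight vanishes at u = 1, so no term is lost.\<close>

lemma vterm_plus: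
  assumes q: "q \<noteq> 0" "norm q < 1" and ga: "generic q a"
    and g: "generic q (a/p1)" "generic q (a/p2)" "generic q (a/p3)" "generic q (a/p4)" "generic q (a/p5)"
  shows "z/q * (1-a*q)*(1-a*q^2)*((1-p1)*(1-p2)*(1-p3)*(1-p4)*(1-p5))
      / ((1-a*q/p1)*(1-a*q/p2)*(1-a*q/p3)*(1-a*q/p4)*(1-a*q/p5))
      * vterm q (a*q^2) (p1*q) (p2*q) (p3*q) (p4*q) (p5*q) (z/q) k
    = vterm q a p1 p2 p3 p4 p5 z (Suc k) * ((1 - a*q^Suc k)*(1 - q^Suc k)/q^Suc k)"
proof -
  define u where "u = q ^ Suc k"
  have u: "u \<noteq> 0" using q by (simp add: u_def)
  have e: "a*q^2*q/(p*q) = a*q/p*q" for p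
    using q by (simp add: power2_eq_square)
  have gq: "generic q (a*q/p)" if "generic q (a/p)" for p
    using generic_mult_q[OF that q(1)] by simp
  have nz: "1 - a*q/p \<noteq> 0" "qpoch q (a*q/p*q) k \<noteq> 0" if "generic q (a/p)" for p
    using generic_1[OF gq[OF that] q(1)] generic_qpoch[OF generic_mult_q[OF gq[OF that] q(1)] q(1)] by auto
  have ga1: "generic q (a*q)" "generic q (a*q^2)"
    using generic_mult_q[OF ga q(1)] generic_mult_q[OF generic_mult_q[OF ga q(1)] q(1)]
    by (auto simp: power2_eq_square mult.assoc)
  have nza: "1 - a \<noteq> 0" "1 - a*q \<noteq> 0" "1 - a*q^2 \<noteq> 0"
    using generic_1[OF ga q(1)] generic_1[OF ga1(1) q(1)] generic_1[OF ga1(2) q(1)] by auto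
  have uq: "1 - u \<noteq> 0"
  proof
    assume "1 - u = 0"
    then have "norm (q ^ Suc k) = 1" by (simp add: u_def)
    moreover have "norm (q ^ Suc k) < 1"
      unfolding norm_power using q by (simp add: power_less_one_iff del: power_Suc)
    ultimately show False by simp
  qed
  have ua: "1 - a*u \<noteq> 0" using generic_factor[OF ga q(1), of "Suc k"] by (simp add: u_def)
  have s: "qpoch q x (Suc k) = (1-x) * qpoch q (x*q) k" for x by (rule qpoch_Suc_shift)
  have sq: "qpoch q q (Suc k) = qpoch q q k * (1-u)"
    by (simp add: qpoch_Suc u_def)
  have sa: "qpoch q a (Suc k) * (1 - a*u) = (1-a)*(1-a*q)*qpoch q (a*q^2) k"
  proof -
    have "qpoch q a (Suc (Suc k)) = (1-a)*((1-a*q)*qpoch q (a*q*q) k)"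
      by (simp only: qpoch_Suc_shift)
    then show ?thesis by (simp add: qpoch_Suc[of q a "Suc k"] u_def power2_eq_square mult.assoc)
  qed
  have sq2: "a*q^2*q^(2*k) = a*q^(2*Suc k)" by (simp add: power2_eq_square)
  define N1 N2 D1 D2 where
    "N1 = qpoch q (p1*q) k * qpoch q (p2*q) k * qpoch q (p3*q) k * qpoch q (p4*q) k * qpoch q (p5*q) k"
    and "N2 = (1-p1)*(1-p2)*(1-p3)*(1-p4)*(1-p5)"
    and "D1 = qpoch q (a*q/p1*q) k * qpoch q (a*q/p2*q) k * qpoch q (a*q/p3*q) k
          * qpoch q (a*q/p4*q) k * qpoch q (a*q/p5*q) k"
    and "D2 = (1-a*q/p1)*(1-a*q/p2)*(1-a*q/p3)*(1-a*q/p4)*(1-a*q/p5)"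
  have D: "D1 \<noteq> 0" "D2 \<noteq> 0" "qpoch q q k \<noteq> 0"
    unfolding D1_def D2_def using nz g qpoch_qq_nz[OF q(2)] by auto
  define M where "M = 1 - a*q^(2*Suc k)"
  define V where "V = qpoch q (a*q^2) k"
  have L: "vterm q (a*q^2) (p1*q) (p2*q) (p3*q) (p4*q) (p5*q) (z/q) k
    = M/(1-a*q^2) * (V*N1/(qpoch q q k*D1)) * (z^k/q^k)"
    unfolding vterm_def e sq2 N1_def D1_def M_def V_def power_divide by (simp only: mult_ac)
  have R: "vterm q a p1 p2 p3 p4 p5 z (Suc k)
    = M/(1-a) * (qpoch q a (Suc k)*(N1*N2)/(qpoch q q k*(1-u)*(D1*D2))) * z^Suc k"
    unfolding vterm_def s[of p1] s[of p2] s[of p3] s[of p4] s[of p5] s[of "a*q/p1"] s[of "a*q/p2"]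
      s[of "a*q/p3"] s[of "a*q/p4"] s[of "a*q/p5"] sq N1_def N2_def D1_def D2_def M_def
    by (simp only: mult_ac)
  have qa: "qpoch q a (Suc k) = (1-a)*(1-a*q)*V/(1-a*u)" using sa ua by (simp add: V_def field_simps)
  have "z/q * (1-a*q)*(1-a*q^2)*N2 / D2 * (M/(1-a*q^2) * (V*N1/(qpoch q q k*D1)) * (z^k/q^k))
     = M/(1-a) * ((1-a)*(1-a*q)*V/(1-a*u)*(N1*N2)/(qpoch q q k*(1-u)*(D1*D2))) * z^Suc k
       * ((1 - a*u)*(1 - u)/u)"
  proof -
    have "u = q^k*q" by (simp add: u_def)
    then have h1: "z/q * (z^k/q^k) = z^Suc k/u" using q by simp
    have h2: "z/q * (1-a*q)*(1-a*q^2)*N2 / D2 * (M/(1-a*q^2) * (V*N1/(qpoch q q k*D1)) * (z^k/q^k))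
       = (z/q * (z^k/q^k)) * ((1-a*q)*(N2 / D2) * (M * (V*N1/(qpoch q q k*D1))))"
      using nza by (simp add: divide_simps)
    have h3: "M/(1-a) * ((1-a)*(1-a*q)*V/(1-a*u)*(N1*N2)/(qpoch q q k*(1-u)*(D1*D2))) * z^Suc k
       * ((1 - a*u)*(1 - u)/u) = z^Suc k/u * ((1-a*q)*(N2 / D2) * (M * (V*N1/(qpoch q q k*D1))))"
      using nza uq ua by (simp add: divide_simps)
    show ?thesis unfolding h2 h3 h1 ..
  qed
  then show ?thesis unfolding L R qa u_def[symmetric] N2_def[symmetric] D2_def[symmetric] .
qed

text \<open>\<open>zq\<close> is stronger than convergence: upward shifts turn the argument into
  z/q, and the moment contains 1/q^k.\<close>

locale vwp =
  fixes q a p1 p2 p3 p4 p5 z :: complex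
  assumes q0: "q \<noteq> 0" and q1: "norm q < 1" and ga: "generic q a"
    and g1: "generic q (a/p1)" and g2: "generic q (a/p2)" and g3: "generic q (a/p3)"
    and g4: "generic q (a/p4)" and g5: "generic q (a/p5)"
    and zq: "norm z < norm q"
begin

lemma q0n: "0 < norm q" using q0 by simp

lemma z1: "norm z < 1" using zq q1 by linarith

lemma pnz: "p1 \<noteq> 0" "p2 \<noteq> 0" "p3 \<noteq> 0" "p4 \<noteq> 0" "p5 \<noteq> 0" "a \<noteq> 0"
  using g1 g2 g3 g4 g5 ga by (auto simp: generic_def)

abbreviation t :: "nat \<Rightarrow> complex" where "t \<equiv> vterm q a p1 p2 p3 p4 p5 z"

text \<open>Up to normalization every upward shift of the series equals \<open>mom\<close> minus a
  multiple of the series itself, so any two of them are related by eliminating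
  \<open>mom\<close>.\<close>

definition mom :: complex where "mom = (\<Sum>k. t k * (1/q^k + a*q^k))"

lemma t_sums: "t sums vser q a p1 p2 p3 p4 p5 z"
  using vterm_sums q0n q1 ga z1 by blast

lemma t_weighted_summable:
  assumes "norm (z * w) < 1"
  shows "summable (\<lambda>k. t k * w ^ k)"
  unfolding vterm_mult_power by (rule vterm_summable[OF q0n q1 ga assms])

lemma t_over_summable: "summable (\<lambda>k. t k / q ^ k)"
  using t_weighted_summable[of "1/q"] zq q0 by (simp add: norm_divide power_divide)

lemma mom_sums: "(\<lambda>k. t k * (1/q^k + a*q^k)) sums mom"
proof -
  have "norm (z * q) < 1"
    using mult_strict_mono[of "norm z" 1 "norm q" 1] z1 q1 by (simp add: norm_mult)
  then have "summable (\<lambda>k. t k / q^k + a * (t k * q^k))"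
    by (intro summable_add t_over_summable summable_mult t_weighted_summable)
  then show ?thesis
    unfolding mom_def by (intro summable_sums) (simp add: algebra_simps)
qed

lemma up5: "(1-p5)*(1-a/p5) * vser q a p1 p2 p3 p4 (p5*q) (z/q)
    = mom - (p5 + a/p5) * vser q a p1 p2 p3 p4 p5 z"
proof -
  have "norm (z/q) < 1" using zq q0 by (simp add: norm_divide)
  then have "(\<lambda>k. (1-p5)*(1-a/p5) * vterm q a p1 p2 p3 p4 (p5*q) (z/q) k)
      sums ((1-p5)*(1-a/p5) * vser q a p1 p2 p3 p4 (p5*q) (z/q))"
    by (intro sums_mult vterm_sums q0n q1 ga)
  moreover have "(\<lambda>k. t k * (1/q^k + a*q^k) - (p5 + a/p5) * t k)
      sums (mom - (p5 + a/p5) * vser q a p1 p2 p3 p4 p5 z)"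
    by (intro sums_diff sums_mult mom_sums t_sums)
  moreover have "(1-p5)*(1-a/p5) * vterm q a p1 p2 p3 p4 (p5*q) (z/q) k
      = t k * (1/q^k + a*q^k) - (p5 + a/p5) * t k" for k
    unfolding vterm_up5[OF q0 g5] by (simp add: algebra_simps)
  ultimately show ?thesis using sums_unique2 by auto
qed

lemma plus: "z/q * (1-a*q)*(1-a*q^2)*((1-p1)*(1-p2)*(1-p3)*(1-p4)*(1-p5))
      / ((1-a*q/p1)*(1-a*q/p2)*(1-a*q/p3)*(1-a*q/p4)*(1-a*q/p5))
      * vser q (a*q^2) (p1*q) (p2*q) (p3*q) (p4*q) (p5*q) (z/q)
    = mom - (1 + a) * vser q a p1 p2 p3 p4 p5 z" (is "?K * _ = _")
proof -
  let ?f = "\<lambda>k. t k * (1/q^k + a*q^k) - (1 + a) * t k"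
  have ga2: "generic q (a*q^2)"
    using generic_mult_q[OF generic_mult_q[OF ga q0] q0] by (simp add: power2_eq_square mult.assoc)
  have "norm (z/q) < 1" using zq q0 by (simp add: norm_divide)
  then have "(\<lambda>k. ?K * vterm q (a*q^2) (p1*q) (p2*q) (p3*q) (p4*q) (p5*q) (z/q) k)
      sums (?K * vser q (a*q^2) (p1*q) (p2*q) (p3*q) (p4*q) (p5*q) (z/q))"
    by (intro sums_mult vterm_sums q0n q1 ga2)
  moreover have "?K * vterm q (a*q^2) (p1*q) (p2*q) (p3*q) (p4*q) (p5*q) (z/q) k = ?f (Suc k)" for k
  proof -
    have "t (Suc k) * ((1 - a*q^Suc k)*(1 - q^Suc k)/q^Suc k) = ?f (Suc k)"
      using q0 by (simp add: field_simps del: power_Suc)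
    then show ?thesis unfolding vterm_plus[OF q0 q1 ga g1 g2 g3 g4 g5] .
  qed
  ultimately have "(\<lambda>k. ?f (Suc k)) sums (?K * vser q (a*q^2) (p1*q) (p2*q) (p3*q) (p4*q) (p5*q) (z/q))"
    by simp
  then have "?f sums (?K * vser q (a*q^2) (p1*q) (p2*q) (p3*q) (p4*q) (p5*q) (z/q) + ?f 0)"
    by (rule sums_Suc)
  moreover have "?f 0 = 0" by (simp add: algebra_simps)
  moreover have "?f sums (mom - (1 + a) * vser q a p1 p2 p3 p4 p5 z)"
    by (intro sums_diff sums_mult mom_sums t_sums)
  ultimately show ?thesis using sums_unique2 by fastforce
qed

end

definition kern :: "complex \<Rightarrow> complex \<Rightarrow> complex \<Rightarrow> nat \<Rightarrow> complex" where
  "kern q a p k = q^k / ((1 - p/q*q^k) * (1 - a*q/p*q^k))"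

locale vwp_down = vwp +
  assumes gp5: "generic q p5"
    and zdef: "z * (p1*p2*p3*p4*p5) = a^2*q^2"
begin

definition dmom :: complex where "dmom = (\<Sum>k. t k * kern q a p5 k)"

lemma dnz: "1 - p5/q*q^k \<noteq> 0" "1 - a*q/p5*q^k \<noteq> 0"
  using generic_factor[OF generic_div_q[OF gp5 q0] q0] generic_factor[OF generic_mult_q[OF g5 q0] q0]
  by (simp_all)

lemma down5: "vser q a p1 p2 p3 p4 (p5/q) (z*q) = (1-p5/q)*(1-a*q/p5)*dmom"
  and dmom_sums: "(\<lambda>k. t k * kern q a p5 k) sums dmom"
proof -
  have zq1: "norm (z * q) < 1"
    using mult_strict_mono[of "norm z" 1 "norm q" 1] z1 q1 by (simp add: norm_mult)
  have nz: "(1-p5/q)*(1-a*q/p5) \<noteq> 0" using dnz[of 0] by simp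
  have e: "vterm q a p1 p2 p3 p4 (p5/q) (z*q) k = (1-p5/q)*(1-a*q/p5)*(t k * kern q a p5 k)" for k
    unfolding vterm_down5[OF q0 gp5 g5] kern_def ..
  have s: "(\<lambda>k. (1-p5/q)*(1-a*q/p5)*(t k * kern q a p5 k)) sums vser q a p1 p2 p3 p4 (p5/q) (z*q)"
    using vterm_sums[OF q0n q1 ga zq1, of p1 p2 p3 p4 "p5/q"] unfolding e .
  then have "summable (\<lambda>k. t k * kern q a p5 k)"
    using nz summable_cmult_iff[of "(1-p5/q)*(1-a*q/p5)"] sums_summable by blast
  then show d: "(\<lambda>k. t k * kern q a p5 k) sums dmom" unfolding dmom_def by (rule summable_sums)
  show "vser q a p1 p2 p3 p4 (p5/q) (z*q) = (1-p5/q)*(1-a*q/p5)*dmom"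
    using sums_unique2[OF s sums_mult[OF d]] .
qed

abbreviation (in vwp) "f1 \<equiv> 1/(p1*p2*p3) + 1/(p1*p2*p4) + 1/(p1*p3*p4) + 1/(p2*p3*p4)"
abbreviation (in vwp) "f2 \<equiv> 1/(p1*p2) + 1/(p1*p3) + 1/(p1*p4) + 1/(p2*p3) + 1/(p2*p4) + 1/(p3*p4)"
abbreviation (in vwp) "f3 \<equiv> 1/p1 + 1/p2 + 1/p3 + 1/p4"
abbreviation (in vwp) "f4 \<equiv> 1/(p1*p2*p3*p4)"
abbreviation (in vwp) "w \<equiv> a*q/p5"

lemma (in vwp) prod_inv:
  "(1-x/p1)*(1-x/p2)*(1-x/p3)*(1-x/p4) = 1 - x*f3 + x^2*f2 - x^3*f1 + x^4*f4"
  using pnz by (simp add: divide_simps) (simp add: algebra_simps power2_eq_square power3_eq_cube power4_eq_xxxx)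

lemma (in vwp) prod_lin:
  "(1-p1*x)*(1-p2*x)*(1-p3*x)*(1-p4*x) = (p1*p2*p3*p4) * (f4 - f1*x + f2*x^2 - f3*x^3 + x^4)"
  using pnz by (simp add: divide_simps) (simp add: algebra_simps power2_eq_square power3_eq_cube power4_eq_xxxx)

lemma zw: "z = q*(a*w*f4)" and zp: "z*(p1*p2*p3*p4) = q*a*w"
  using zdef pnz by (auto simp: field_simps power2_eq_square)

text \<open>The multiplier of \<open>t k\<close> is a difference \<open>G (k+1) - G k\<close>; the reflection
  \<open>x \<mapsto> 1/(a x)\<close> of \<open>x = q^k\<close> exchanges the two products in its numerator, which is
  why the denominator \<open>1 - a x\<^sup>2\<close> cancels.\<close>

lemma contiguous_moments:
  "q*(f3 + w*f4 - 1 - w*f1 - 1/w + w^2*f4) * vser q a p1 p2 p3 p4 p5 z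
    - q*(1-a*w*f4)/a * (mom - (1+a) * vser q a p1 p2 p3 p4 p5 z)
    - a*q/w^2*(1-w/a)*(1-w*f3+w^2*f2-w^3*f1+w^4*f4) * dmom = 0"
proof -
  define C1 where "C1 = q*(f3 + w*f4 - 1 - w*f1 - 1/w + w^2*f4)"
  define C2 where "C2 = q*(1-a*w*f4)/a"
  define C3 where "C3 = a*q/w^2*(1-w/a)*(1-w*f3+w^2*f2-w^3*f1+w^4*f4)"
  define G where "G k = t k / q^k * (q/a * ((1-q^k) * ((1-a*q^k/p1)*(1-a*q^k/p2)*(1-a*q^k/p3)*(1-a*q^k/p4))
      / ((1-a*(q^k)^2) * (1-p5/q*q^k))))" for k
  have wnz: "w \<noteq> 0" using pnz q0 by simp
  have "G (Suc k) - G k = C1 * t k - C2 * (t k * (1/q^k + a*q^k) - (1+a)*t k) - C3 * (t k * kern q a p5 k)" for k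
  proof -
    define x where "x = q^k"
    have xn: "x \<noteq> 0" using q0 by (simp add: x_def)
    have n1: "1 - a*x^2 \<noteq> 0" using generic_square_factor[OF ga q0] by (simp add: x_def)
    have aw: "a*x/w = p5/q*x" using pnz q0 by (simp add: field_simps)
    have n2: "1 - a*x/w \<noteq> 0" "1 - w*x \<noteq> 0"
      using dnz[of k] unfolding aw by (auto simp: x_def)
    have n3: "1 - a*(q*x)^2 \<noteq> 0" "1 - q*x \<noteq> 0" "1 - p5*x \<noteq> 0"
      using generic_square_factor[OF ga q0, of "Suc k"] qpoch_qq_nz[OF q1, of "Suc k"]
         generic_factor[OF gp5 q0, of k]
      by (auto simp: x_def qpoch_Suc mult_ac)
    have n: "1 - a*q/p*x \<noteq> 0" if "generic q (a/p)" for p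
      using generic_factor[OF generic_mult_q[OF that q0] q0, of k] by (simp add: x_def)
    have n4: "1 - a*q/p1*x \<noteq> 0" "1 - a*q/p2*x \<noteq> 0" "1 - a*q/p3*x \<noteq> 0" "1 - a*q/p4*x \<noteq> 0"
      using n g1 g2 g3 g4 by blast+
    have ts: "t (Suc k) = t k * vratio q a p1 p2 p3 p4 p5 z x"
      unfolding x_def using generic_factor[OF ga q0, of "2*k"] by (intro vterm_Suc) auto
    have Gs: "G (Suc k) = t k * (q/(a*x*(1-a*x^2)) * (a*w*(1-a*x)*(f4-f1*x+f2*x^2-f3*x^3+x^4)/(1-w*x)))"
    proof -
      have qs: "q^Suc k = q*x" by (simp add: x_def)
      have "G (Suc k) = t k * (vratio q a p1 p2 p3 p4 p5 z x / (q*x) * (q/a * ((1-q*x)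
         * ((1-a*q/p1*x)*(1-a*q/p2*x)*(1-a*q/p3*x)*(1-a*q/p4*x)) / ((1-a*(q*x)^2) * (1-p5*x)))))"
        unfolding G_def qs ts using q0 by (simp add: mult_ac)
      also have "vratio q a p1 p2 p3 p4 p5 z x / (q*x) * (q/a * ((1-q*x)
         * ((1-a*q/p1*x)*(1-a*q/p2*x)*(1-a*q/p3*x)*(1-a*q/p4*x)) / ((1-a*(q*x)^2) * (1-p5*x))))
         = z/(a*x*(1-a*x^2)) * ((1-a*x) * ((1-p1*x)*(1-p2*x)*(1-p3*x)*(1-p4*x)) / (1-w*x))"
      proof -
        \<comment> \<open>Named factors are atoms for simp, which then cancels them instead of
          multiplying them out.\<close>
        define A1 A2 A3 A4 where "A1 = 1-a*q/p1*x" "A2 = 1-a*q/p2*x" "A3 = 1-a*q/p3*x" "A4 = 1-a*q/p4*x"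
        define A5 where "A5 = 1-a*q/p5*x"
        define A6 A7 A8 where "A6 = 1-a*(q*x)^2" "A7 = 1-q*x" "A8 = 1-p5*x"
        have nz: "A1 \<noteq> 0" "A2 \<noteq> 0" "A3 \<noteq> 0" "A4 \<noteq> 0" "A6 \<noteq> 0" "A7 \<noteq> 0" "A8 \<noteq> 0"
          using n3 n4 by (auto simp: A1_A2_A3_A4_def A6_A7_A8_def)
        have e: "a*q^2*x^2 = a*(q*x)^2" by (simp add: power_mult_distrib)
        show ?thesis
          unfolding vratio_def e A1_A2_A3_A4_def[symmetric] A5_def[symmetric] A6_A7_A8_def[symmetric]
          using nz q0 by simp (simp only: mult_ac)
      qed
      also have "\<dots> = q/(a*x*(1-a*x^2)) * (a*w*(1-a*x)*(f4-f1*x+f2*x^2-f3*x^3+x^4)/(1-w*x))"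
      proof -
        have "z * ((1-p1*x)*(1-p2*x)*(1-p3*x)*(1-p4*x)) = (q*a*w) * (f4-f1*x+f2*x^2-f3*x^3+x^4)"
          unfolding prod_lin zp[symmetric] by (simp only: mult.assoc)
        then have "z * ((1-p1*x)*(1-p2*x)*(1-p3*x)*(1-p4*x)) * ((1-a*x)/((a*x*(1-a*x^2))*(1-w*x)))
          = (q*a*w) * (f4-f1*x+f2*x^2-f3*x^3+x^4) * ((1-a*x)/((a*x*(1-a*x^2))*(1-w*x)))"
          by (rule arg_cong)
        then show ?thesis by (simp only: mult_ac times_divide_eq_left times_divide_eq_right divide_divide_eq_left)
      qed
      finally show ?thesis .
    qed
    have Gk: "G k = t k * (q/(a*x*(1-a*x^2)) * ((1-x)*(1-(a*x)*f3+(a*x)^2*f2-(a*x)^3*f1+(a*x)^4*f4)/(1-a*x/w)))"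
    proof -
      have "G k = t k / x * (q/a * ((1-x) * (1-(a*x)*f3+(a*x)^2*f2-(a*x)^3*f1+(a*x)^4*f4)
        / ((1-a*x^2) * (1-a*x/w))))"
        unfolding G_def x_def[symmetric] prod_inv aw by (simp only: mult_ac)
      then show ?thesis by (simp only: mult_ac times_divide_eq_left times_divide_eq_right divide_divide_eq_left)
    qed
    have kx: "kern q a p5 k = x/((1-a*x/w)*(1-w*x))"
      unfolding kern_def aw by (simp add: x_def)
    have "G (Suc k) - G k = t k * (C1 - C2*(1/x+a*x-1-a) - C3*kern q a p5 k)"
      unfolding Gs Gk C1_def C2_def C3_def kx contiguous_cert[OF pnz(6) xn wnz n1 n2, of q f3 f4 f1 f2]
      by (simp only: right_diff_distrib)
    then show ?thesis unfolding x_def by (simp add: algebra_simps)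
  qed
  then have "(\<lambda>k. G (Suc k) - G k) sums (C1 * vser q a p1 p2 p3 p4 p5 z
      - C2 * (mom - (1+a) * vser q a p1 p2 p3 p4 p5 z) - C3 * dmom)"
    by (simp only:) (intro sums_diff sums_mult t_sums mom_sums dmom_sums)
  \<comment> \<open>The upper boundary term vanishes because |z| < |q| forces t k / q^k to 0, the
    lower one because of the factor 1 - q^0.\<close>
  moreover have "(\<lambda>k. G (Suc k) - G k) sums (0 - G 0)"
  proof (rule telescope_sums)
    have qk: "(\<lambda>k. q^k) \<longlonglongrightarrow> 0" using q1 by (rule LIMSEQ_power_zero)
    have "(\<lambda>k. t k / q^k) \<longlonglongrightarrow> 0" using t_over_summable by (rule summable_LIMSEQ_zero)
    then have "G \<longlonglongrightarrow> 0 * (q/a * ((1-0) * ((1-a*0/p1)*(1-a*0/p2)*(1-a*0/p3)*(1-a*0/p4))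
      / ((1-a*0^2) * (1-p5/q*0))))"
      unfolding G_def by (intro tendsto_intros qk) (use pnz q0 in auto)
    then show "G \<longlonglongrightarrow> 0" by simp
  qed
  ultimately have "C1 * vser q a p1 p2 p3 p4 p5 z
      - C2 * (mom - (1+a) * vser q a p1 p2 p3 p4 p5 z) - C3 * dmom = 0 - G 0"
    using sums_unique2 by blast
  then show ?thesis unfolding C1_def C2_def C3_def G_def by simp
qed

end

text \<open>Normalized so that \<open>plus_coeff\<close> times the raised series is
  \<open>mom - (1 + a) * phi\<close>.\<close>

definition plus_coeff :: "complex \<Rightarrow> complex \<Rightarrow> complex \<Rightarrow> complex \<Rightarrow> complex \<Rightarrow> complex \<Rightarrow> complex
    \<Rightarrow> complex \<Rightarrow> complex" where
  "plus_coeff q a p1 p2 p3 p4 p5 z = z/q * (1-a*q)*(1-a*q^2)*((1-p1)*(1-p2)*(1-p3)*(1-p4)*(1-p5))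
      / ((1-a*q/p1)*(1-a*q/p2)*(1-a*q/p3)*(1-a*q/p4)*(1-a*q/p5))"

definition down_coeff :: "complex \<Rightarrow> complex \<Rightarrow> complex \<Rightarrow> complex \<Rightarrow> complex \<Rightarrow> complex \<Rightarrow> complex
    \<Rightarrow> complex" where
  "down_coeff q a p1 p2 p3 p4 p5
     = - (p5/a) * ((1-a*q/(p1*p5))*(1-a*q/(p2*p5))*(1-a*q/(p3*p5))*(1-a*q/(p4*p5))) / (1-a*q/p5)"

context vwp
begin

abbreviation "phi \<equiv> vser q a p1 p2 p3 p4 p5 z"
abbreviation "phi_plus \<equiv> vser q (a*q^2) (p1*q) (p2*q) (p3*q) (p4*q) (p5*q) (z/q)"

text \<open>\<open>mom\<close> is eliminated between \<open>up5\<close> and \<open>plus\<close>;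
  their constants differ by 1 + a - p5 - a/p5 = (1 - p5)(1 - a/p5).\<close>

lemma up5_plus:
  "(1-p5)*(1-a/p5) * (vser q a p1 p2 p3 p4 (p5*q) (z/q) - phi)
    = plus_coeff q a p1 p2 p3 p4 p5 z * phi_plus"
proof -
  have e: "(1-p5)*(1-a/p5) * phi = (1 + a - (p5 + a/p5)) * phi" using pnz by (simp add: field_simps)
  have p: "plus_coeff q a p1 p2 p3 p4 p5 z * phi_plus = mom - (1 + a) * phi"
    using plus unfolding plus_coeff_def .
  have "(1-p5)*(1-a/p5) * (vser q a p1 p2 p3 p4 (p5*q) (z/q) - phi)
    = mom - (p5 + a/p5) * phi - (1 + a - (p5 + a/p5)) * phi"
    by (simp only: right_diff_distrib[of "(1-p5)*(1-a/p5)"] up5 e)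
  then show ?thesis unfolding p by (simp add: algebra_simps)
qed

text \<open>\<open>mom\<close> is symmetric in the five parameters, so the upward relations for
  \<open>p4\<close> and \<open>p5\<close> can be subtracted.\<close>

lemma up5_up4:
  "(1-p5)*(1-a/p5) * vser q a p1 p2 p3 p4 (p5*q) (z/q)
    - (1-p4)*(1-a/p4) * vser q a p1 p2 p3 (p4*q) p5 (z/q) = (p4 - p5)*(1 - a/(p4*p5)) * phi"
proof -
  interpret s: vwp q a p1 p2 p3 p5 p4 z
    using q0 q1 ga g1 g2 g3 g4 g5 zq by unfold_locales
  have "s.mom = mom" unfolding s.mom_def mom_def vterm_def by (simp only: mult_ac)
  then have "(1-p4)*(1-a/p4) * vser q a p1 p2 p3 (p4*q) p5 (z/q) = mom - (p4 + a/p4) * phi"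
    using s.up5 by (simp only: vser_swap45[of q a p1 p2 p3 p5])
  moreover have "(p4 - p5)*(1 - a/(p4*p5)) = (p4 + a/p4) - (p5 + a/p5)"
    using pnz by (simp add: field_simps)
  ultimately show ?thesis using up5 by (simp add: left_diff_distrib)
qed

end

context vwp_down
begin

abbreviation "phi_down \<equiv> vser q a p1 p2 p3 p4 (p5/q) (z*q)"

lemma zcoeff: "q*(1-a*w*f4)/a = (q-z)/a"
  using zw by (simp add: right_diff_distrib)

lemma down_prod: "1-w*f3+w^2*f2-w^3*f1+w^4*f4
    = (1-a*q/(p1*p5))*(1-a*q/(p2*p5))*(1-a*q/(p3*p5))*(1-a*q/(p4*p5))"
  using prod_inv[of w] by (simp only: divide_divide_eq_left mult.commute[of p5])

lemma down_nz: "1-p5/q \<noteq> 0" "1-a*q/p5 \<noteq> 0"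
  using dnz[of 0] by simp_all

lemma dmom_down:
  "a*q/w^2*(1-w/a)*(1-w*f3+w^2*f2-w^3*f1+w^4*f4) * dmom = down_coeff q a p1 p2 p3 p4 p5 * phi_down"
proof -
  define L where "L = (1-a*q/(p1*p5))*(1-a*q/(p2*p5))*(1-a*q/(p3*p5))*(1-a*q/(p4*p5))"
  have h: "a*q/w^2*(1-w/a) = - (p5/a)*(1-p5/q)"
    using pnz q0 by (simp add: field_simps power2_eq_square)
  define r s where "r = 1-p5/q" and "s = 1-w"
  have "s \<noteq> 0" using down_nz by (simp add: s_def)
  then show ?thesis
    unfolding h down5 down_coeff_def down_prod L_def[symmetric] r_def[symmetric] s_def[symmetric] by simp
qed

text \<open>The first bracket is symmetric in all five parameters, the second singles out
  \<open>p5\<close>. Only the symmetric part makes relations for different lowered parameters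
  comparable; for W2 it becomes S2 up to a factor.\<close>

lemma coeff_sym:
  "q*(f3 + w*f4 - 1 - w*f1 - 1/w + w^2*f4)
    = (q*(1/p1+1/p2+1/p3+1/p4+1/p5) + z + z/a - q)
      - (z*(p1+p2+p3+p4)/a + q/p5 + z + p5/a - q*z/p5)"
proof -
  have h1: "q*w*f1 = z*(p1+p2+p3+p4)/a"
    unfolding zw using pnz q0 by (simp add: divide_simps)
  have h2: "q*w*f4 = z/a" "q*w^2*f4 = q*z/p5" "q/w = p5/a"
    unfolding zw using pnz q0 by (simp_all add: field_simps power2_eq_square)
  have h3: "q*(F3 + W*F4 - 1 - W*F1 - 1/W + W^2*F4)
      = q*F3 + q*W*F4 - q - q*W*F1 - q/W + q*W^2*F4" for F1 F3 F4 W
    by (simp add: algebra_simps)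
  have h4: "q*(1/p1+1/p2+1/p3+1/p4+1/p5) = q*f3 + q/p5" by (simp add: distrib_left)
  show ?thesis unfolding h3 h4 h1 h2 by simp
qed

text \<open>The terms are arranged so that the left side is symmetric in the five parameters: it
  stays the same whichever of them is lowered on the right.\<close>

lemma contiguous_down:
  "(q*(1/p1+1/p2+1/p3+1/p4+1/p5) + z + z/a - q) * phi
      - (q-z)/a * plus_coeff q a p1 p2 p3 p4 p5 z * phi_plus
    = (z*(p1+p2+p3+p4)/a + q/p5 + z + p5/a - q*z/p5) * phi
      + down_coeff q a p1 p2 p3 p4 p5 * phi_down"
proof -
  have "q*(f3 + w*f4 - 1 - w*f1 - 1/w + w^2*f4) * phi
    - (q-z)/a * (plus_coeff q a p1 p2 p3 p4 p5 z * phi_plus)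
    - down_coeff q a p1 p2 p3 p4 p5 * phi_down = 0"
    using contiguous_moments unfolding dmom_down zcoeff plus[symmetric] plus_coeff_def .
  then show ?thesis unfolding coeff_sym by (simp add: algebra_simps)
qed

text \<open>This is the coefficient left for \<open>phi\<close> once \<open>phi - phi_down\<close>
  has been replaced by a raised series. That it factors is what gives
  \<open>contiguous_plus_down\<close> product coefficients.\<close>

lemma coeff_factor:
  "q*(f3 + w*f4 - 1 - w*f1 - 1/w + w^2*f4) - down_coeff q a p1 p2 p3 p4 p5
    = z/a * ((1-p1)*(1-p2)*(1-p3)*(1-p4)) / (1-a*q/p5)"
proof -
  define F1 F2 F3 F4 where "F1 = f1" and "F2 = f2" and "F3 = f3" and "F4 = f4"
  define W where "W = w"
  have W: "W \<noteq> 0" "1 - W \<noteq> 0" using pnz q0 down_nz by (auto simp: W_def)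
  have "p5/a = q/W" using pnz q0 by (simp add: W_def)
  have z: "z/a = q*W*F4" unfolding zw W_def F4_def using pnz by simp
  have "(1-p1)*(1-p2)*(1-p3)*(1-p4) = (p1*p2*p3*p4) * (F4 - F1 + F2 - F3 + 1)"
    using prod_lin[of 1] by (simp add: F1_def F2_def F3_def F4_def)
  then have r: "z/a * ((1-p1)*(1-p2)*(1-p3)*(1-p4)) = q*W*(F4 - F1 + F2 - F3 + 1)"
    unfolding z using pnz by (simp add: F4_def)
  have l: "q*(F3 + W*F4 - 1 - W*F1 - 1/W + W^2*F4) - (- (q/W) * (1-W*F3+W^2*F2-W^3*F1+W^4*F4) / (1-W))
    = q*W*(F4 - F1 + F2 - F3 + 1) / (1-W)"
    using W by (simp add: divide_simps) (simp add: algebra_simps power2_eq_square power3_eq_cube power4_eq_xxxx)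
  show ?thesis
    unfolding down_coeff_def down_prod[symmetric] r F1_def[symmetric] F2_def[symmetric] F3_def[symmetric]
      F4_def[symmetric] W_def[symmetric] \<open>p5/a = q/W\<close> using l by simp
qed

text \<open>\<open>phi_down\<close> is eliminated between the contiguous relation and
  \<open>up5_plus\<close> applied to \<open>phi_down\<close>. In the raised series of
  \<open>phi_down\<close> the two shifts cancel for \<open>p5\<close> and \<open>z\<close>, which
  return to their original values. Genericity of \<open>p1\<close> to \<open>p4\<close> permits the
  division by \<open>M\<close>.\<close>

lemma contiguous_plus_down:
  assumes gp: "generic q p1" "generic q p2" "generic q p3" "generic q p4"
  shows "phi = (1-z/q)*(1-a*q)*(1-a*q^2)*(1-p5) / ((1-a*q/p1)*(1-a*q/p2)*(1-a*q/p3)*(1-a*q/p4)) * phi_plus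
    + p5*(1-a*q)*(1-a*q^2)
       * ((1-a*q/(p1*p5))*(1-a*q/(p2*p5))*(1-a*q/(p3*p5))*(1-a*q/(p4*p5)))
       / ((1-a*q/p1)*(1-a*q/p2)*(1-a*q/p3)*(1-a*q/p4)*(1-a*q/p5)*(1-a*q^2/p5))
       * vser q (a*q^2) (p1*q) (p2*q) (p3*q) (p4*q) p5 z"
    (is "_ = ?A * _ + ?B * ?f")
proof -
  interpret d: vwp q a p1 p2 p3 p4 "p5/q" "z*q"
  proof
    show "norm (z*q) < norm q"
      using mult_strict_right_mono[OF z1 q0n] by (simp add: norm_mult)
    show "generic q (a/(p5/q))" using generic_mult_q[OF g5 q0] by simp
  qed (use q0 q1 ga g1 g2 g3 g4 in auto)
  define K where "K = plus_coeff q a p1 p2 p3 p4 (p5/q) (z*q)"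
  define c where "c = down_coeff q a p1 p2 p3 p4 p5"
  define M where "M = z/a * ((1-p1)*(1-p2)*(1-p3)*(1-p4)) / (1-a*q/p5)"
  define T where "T = (q-z)/a * plus_coeff q a p1 p2 p3 p4 p5 z"
  define E where "E = (1-p5/q)*(1-a*q/p5)"
  have znz: "z \<noteq> 0" using zdef pnz q0 by auto
  have E: "E \<noteq> 0" using down_nz by (simp add: E_def)
  have M: "M \<noteq> 0" using znz pnz gp generic_1[OF _ q0] down_nz by (simp add: M_def)
  have r1: "E * (phi - phi_down) = K * ?f"
    using d.up5_plus q0 by (simp add: K_def E_def)
  have "q*(f3 + w*f4 - 1 - w*f1 - 1/w + w^2*f4) * phi - T * phi_plus - c * phi_down = 0"
    using contiguous_moments unfolding dmom_down zcoeff plus[symmetric] plus_coeff_def T_def c_def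
    by (simp only: mult.assoc)
  moreover have "q*(f3 + w*f4 - 1 - w*f1 - 1/w + w^2*f4) = M + c"
    using coeff_factor unfolding M_def c_def by (simp add: algebra_simps)
  ultimately have r2: "(M + c) * phi - T * phi_plus - c * phi_down = 0" by simp
  have "E * M * phi = E * T * phi_plus - c * (E * (phi - phi_down))"
    using arg_cong[OF r2, of "\<lambda>x. E * x"] by (simp add: algebra_simps)
  then have "E * M * phi = E * T * phi_plus - c * K * ?f" by (simp add: r1)
  then have "phi = T/M * phi_plus - c*K/(E*M) * ?f" using E M by (simp add: field_simps)
  moreover have "T/M = ?A"
  proof -
    define P where "P = (1-p1)*(1-p2)*(1-p3)*(1-p4)"
    define R where "R = (1-a*q/p1)*(1-a*q/p2)*(1-a*q/p3)*(1-a*q/p4)"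
    define y where "y = 1 - a*q/p5"
    have nz: "P \<noteq> 0" "y \<noteq> 0" using gp generic_1[OF _ q0] down_nz by (auto simp: P_def y_def)
    have "T/M = (q-z)/a * (z/q * (1-a*q)*(1-a*q^2)*(P*(1-p5)) / (R*y)) / (z/a*P/y)"
      unfolding T_def M_def plus_coeff_def P_def R_def y_def by (simp only: mult.assoc)
    also have "\<dots> = (1-z/q)*(1-a*q)*(1-a*q^2)*(1-p5) / R"
      using nz znz pnz q0 by (simp add: divide_simps)
    finally show ?thesis unfolding R_def .
  qed
  moreover have "c*K/(E*M) = - ?B"
  proof -
    define P where "P = (1-p1)*(1-p2)*(1-p3)*(1-p4)"
    define R where "R = (1-a*q/p1)*(1-a*q/p2)*(1-a*q/p3)*(1-a*q/p4)"
    define L where "L = (1-a*q/(p1*p5))*(1-a*q/(p2*p5))*(1-a*q/(p3*p5))*(1-a*q/(p4*p5))"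
    define y r y2 where "y = 1 - a*q/p5" and "r = 1 - p5/q" and "y2 = 1-a*q^2/p5"
    have nz: "P \<noteq> 0" "y \<noteq> 0" "r \<noteq> 0" using gp generic_1[OF _ q0] down_nz by (auto simp: P_def y_def r_def)
    have s2e: "1 - a*q/(p5/q) = y2" by (simp add: y2_def power2_eq_square)
    have "c*K/(E*M) = (- (p5/a)*L/y) * (z*q/q * (1-a*q)*(1-a*q^2)*(P*r) / (R*y2)) / ((r*y)*(z/a*P/y))"
      unfolding c_def K_def E_def M_def plus_coeff_def down_coeff_def s2e P_def R_def L_def y_def r_def
      by (simp only: mult.assoc)
    also have "\<dots> = - (p5*(1-a*q)*(1-a*q^2) * L / (R*y*y2))"
      using nz znz pnz q0 by (simp add: divide_simps)
    finally show ?thesis unfolding R_def L_def y_def y2_def .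
  qed
  ultimately show ?thesis by simp
qed

end

section \<open>The recurrence of the Casoratian\<close>

text \<open>\<open>X'\<close> and \<open>Y'\<close> belong to (b, f), \<open>X\<close> and
  \<open>Y\<close> to (bq, f/q), \<open>Xm\<close> and \<open>Yp\<close> to both. Substituting the
  two relations into the Casoratian yields three products; that of \<open>Xm\<close> and
  \<open>Yp\<close> cancels and the other two form the Casoratian at the shifted point.\<close>

lemma wronskian_step_identity:
  fixes q b z2 z3 A a f u3 h k m n4 n5 n6 g l j v1 w3 y3 X Xm X' Y Y' Yp :: complex
  assumes nz: "q \<noteq> 0" "b \<noteq> 0" "z2 \<noteq> 0" "z3 \<noteq> 0" "A \<noteq> 0" "k \<noteq> 0" "n4 \<noteq> 0" "n5 \<noteq> 0" "n6 \<noteq> 0" "j \<noteq> 0"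
    and a: "a = q^2/(z2*z3*A)" and f: "f = q^2/(b*z3*A)"
    and w3: "w3 = - (a*q^3/(A*f^3)) * y3"
    and X': "- (v1/b)*k*X' - l*j*X = - (n5/b)*h*Xm"
    and Y': "Y' = (1-z3/q)*m*g/n4*Yp + (z2*m*(l*w3)/(n4*n5*n6))*Y"
  shows "(q/z2)*(-(q/(b*A))*(u3*h)/k)*Xm*Y' + (a/b)*(q-z3)*(z3/q*m*(v1*u3*g)/(n4*n5))*X'*Yp
    = - (q^2/(A*f)) * (l*j*m*u3/(k*n4*n5*n6))
      * ((q/z2)*(-(q^2/(f*A))*(y3*h)/j)*Xm*Y + (a/(b*q))*(q-z3)*g*n6*X*Yp)"
proof -
  define C where "C = (q/z2)*(-(q/(b*A))*(u3*h)/k)"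
  define E where "E = (a/b)*(q-z3)*(z3/q*m*(u3*g)/(n4*n5))"
  define r where "r = - (q^2/(A*f)) * (l*j*m*u3/(k*n4*n5*n6))"
  have a0: "a \<noteq> 0" "f \<noteq> 0" using nz by (auto simp: a f)
  have w3': "w3 = - (b^3*z3^2*A/(z2*q)) * y3"
    unfolding w3 a f using nz by (simp add: field_simps power2_eq_square power3_eq_cube)
  have qf: "q^2/(A*f) = b*z3" "q^2/(f*A) = b*z3" unfolding f using nz by simp_all
  have "v1*k*X' = n5*h*Xm - b*l*j*X"
    using arg_cong[OF X', of "\<lambda>x. - b*x"] nz by (simp add: algebra_simps)
  then have X'': "v1*X' = n5*h/k*Xm - b*l*j/k*X" using nz by (simp add: field_simps)
  have c1: "C*(z2*m*(l*w3)/(n4*n5*n6)) = r*((q/z2)*(-(q^2/(f*A))*(y3*h)/j))"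
    unfolding C_def r_def w3' qf using nz by (simp add: divide_simps power2_eq_square power3_eq_cube)
  \<comment> \<open>The two contributions to the product of \<open>Xm\<close> and \<open>Yp\<close>
    come from different series. They cancel because a z2 z3 A = q^2, which encodes the value of
    s.\<close>
  have c2: "C*((1-z3/q)*m*g/n4) + E*(n5*h/k) = 0"
  proof -
    have e1: "C*((1-z3/q)*m*g/n4) = - (q*(q-z3)/(z2*A)) * (u3*h*m*g/(b*k*n4))"
      unfolding C_def using nz by (simp add: divide_simps)
    have e2: "E*(n5*h/k) = (a*z3/q*(q-z3)) * (u3*h*m*g/(b*k*n4))"
      unfolding E_def using nz by (simp add: divide_simps)
    have e3: "a*z3/q*(q-z3) = q*(q-z3)/(z2*A)"
      unfolding a using nz by (simp add: field_simps power2_eq_square)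
    show ?thesis unfolding e1 e2 e3 by simp
  qed
  have c3: "- (E*(b*l*j/k)) = r*((a/(b*q))*(q-z3)*g*n6)"
    unfolding E_def r_def qf using nz by (simp add: divide_simps)
  have "(q/z2)*(-(q/(b*A))*(u3*h)/k)*Xm*Y' + (a/b)*(q-z3)*(z3/q*m*(v1*u3*g)/(n4*n5))*X'*Yp
    = C*Xm*Y' + E*(v1*X')*Yp"
    unfolding C_def E_def by simp
  also have "\<dots> = C*(z2*m*(l*w3)/(n4*n5*n6))*(Xm*Y) + (C*((1-z3/q)*m*g/n4) + E*(n5*h/k))*(Xm*Yp)
      + (- (E*(b*l*j/k)))*(X*Yp)"
    unfolding X'' Y' by (simp add: algebra_simps)
  also have "\<dots> = r*((q/z2)*(-(q^2/(f*A))*(y3*h)/j)*Xm*Y + (a/(b*q))*(q-z3)*g*n6*X*Yp)"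
    unfolding c1 c2 c3 by (simp add: algebra_simps)
  finally show ?thesis unfolding r_def .
qed

text \<open>\<open>solX\<close> is \<open>W2\<close> and \<open>solY\<close> is \<open>W3\<close>. In \<open>wron_b\<close> the contiguous relation that lowers \<open>q/b\<close>
  has removed \<open>W2p\<close> from the bracket; in \<open>wron_f\<close> the one that lowers \<open>q/f\<close>. That the two agree
  is what makes the shift \<open>(b, f) \<mapsto> (bq, f/q)\<close> possible.\<close>

definition solX :: "complex \<Rightarrow> complex \<Rightarrow> complex \<Rightarrow> complex \<Rightarrow> complex \<Rightarrow> complex \<Rightarrow> complex \<Rightarrow> complex" where
  "solX q a b c d e f = vser q (c*d*e/a^2) (c*e/a) (c*d/a) (d*e/a) (q/f) (q/b) (b*f/a)"

definition solY :: "complex \<Rightarrow> complex \<Rightarrow> complex \<Rightarrow> complex \<Rightarrow> complex \<Rightarrow> complex \<Rightarrow> complex \<Rightarrow> complex" where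
  "solY q a b c d e f = vser q (b^2/a) b (b*c/a) (b*d/a) (b*e/a) (b*f/a) (a^2*q^2/(b*c*d*e*f))"

definition wron_b :: "complex \<Rightarrow> complex \<Rightarrow> complex \<Rightarrow> complex \<Rightarrow> complex \<Rightarrow> complex \<Rightarrow> complex \<Rightarrow> complex" where
  "wron_b q a b c d e f =
     q*a/(b*f) * down_coeff q (c*d*e/a^2) (c*e/a) (c*d/a) (d*e/a) (q/f) (q/b)
       * vser q (c*d*e/a^2) (c*e/a) (c*d/a) (d*e/a) (q/f) (q/b/q) (b*f/a*q) * solY q a b c d e f
     + a/b * (q - a^2*q^2/(b*c*d*e*f))
       * plus_coeff q (b^2/a) b (b*c/a) (b*d/a) (b*e/a) (b*f/a) (a^2*q^2/(b*c*d*e*f))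
       * solX q a b c d e f
       * vser q (b^2/a*q^2) (b*q) (b*c/a*q) (b*d/a*q) (b*e/a*q) (b*f/a*q) (a^2*q^2/(b*c*d*e*f)/q)"

definition wron_f :: "complex \<Rightarrow> complex \<Rightarrow> complex \<Rightarrow> complex \<Rightarrow> complex \<Rightarrow> complex \<Rightarrow> complex \<Rightarrow> complex" where
  "wron_f q a b c d e f =
     q*a/(b*f) * down_coeff q (c*d*e/a^2) (c*e/a) (c*d/a) (d*e/a) (q/b) (q/f)
       * vser q (c*d*e/a^2) (c*e/a) (c*d/a) (d*e/a) (q/f/q) (q/b) (b*f/a*q) * solY q a b c d e f
     + a/b * (q - a^2*q^2/(b*c*d*e*f)) * ((1 - b*f/a)*(1 - b/f))
       * solX q a b c d e f
       * vser q (b^2/a) b (b*c/a) (b*d/a) (b*e/a) (b*f/a*q) (a^2*q^2/(b*c*d*e*f)/q)"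

text \<open>\<open>gX\<close> and \<open>gY\<close> make the lower parameters of both series
  generic. Moreover \<open>b\<close> and \<open>f\<close> occur because either q/b or q/f may be
  lowered, bf/a because it is lowered in the second series, and b, bc/a, bd/a, be/a because
  \<open>contiguous_plus_down\<close> divides by 1 minus each of them.\<close>

locale generic_params =
  fixes q a b c d e f :: complex
  assumes q0: "q \<noteq> 0" and q1: "norm q < 1"
    and nz: "a \<noteq> 0" "b \<noteq> 0" "c \<noteq> 0" "d \<noteq> 0" "e \<noteq> 0" "f \<noteq> 0"
    and gA: "generic q (c*d*e/a^2)" "generic q (b^2/a)"
    and gX: "generic q (c/a)" "generic q (d/a)" "generic q (e/a)"
       "generic q (c*d*e*f/a^2)" "generic q (b*c*d*e/a^2)" "generic q f" "generic q b"
    and gY: "generic q (b/a)" "generic q (b/c)" "generic q (b/d)" "generic q (b/e)" "generic q (b/f)"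
       "generic q (b*c/a)" "generic q (b*d/a)" "generic q (b*e/a)" "generic q (b*f/a)"
    and z2: "norm (b*f/a) < norm q" and z3: "norm (a^2*q^2/(b*c*d*e*f)) < norm q"
begin

lemma generic_qdiv: "generic q x \<Longrightarrow> generic q (q/x)"
  using generic_mult_q[OF generic_inverse[OF _ q0] q0, of x] by simp

sublocale X: vwp_down q "c*d*e/a^2" "c*e/a" "c*d/a" "d*e/a" "q/f" "q/b" "b*f/a"
proof
  have e: "c*d*e/a^2/(c*e/a) = d/a" "c*d*e/a^2/(c*d/a) = e/a" "c*d*e/a^2/(d*e/a) = c/a"
    "c*d*e/a^2/(q/f) = c*d*e*f/a^2/q" "c*d*e/a^2/(q/b) = b*c*d*e/a^2/q"
    using nz by (simp_all add: field_simps power2_eq_square)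
  show "generic q (c*d*e/a^2/(c*e/a))" "generic q (c*d*e/a^2/(c*d/a))" "generic q (c*d*e/a^2/(d*e/a))"
    "generic q (c*d*e/a^2/(q/f))" "generic q (c*d*e/a^2/(q/b))"
    unfolding e using gX generic_div_q[OF _ q0] by blast+
  show "generic q (q/b)" using gX generic_qdiv by blast
  show "b*f/a*(c*e/a*(c*d/a)*(d*e/a)*(q/f)*(q/b)) = (c*d*e/a^2)^2*q^2"
    using nz by (simp add: field_simps power2_eq_square)
qed (use q0 q1 gA z2 in auto)

sublocale Y: vwp_down q "b^2/a" b "b*c/a" "b*d/a" "b*e/a" "b*f/a" "a^2*q^2/(b*c*d*e*f)"
proof
  have e: "b^2/a/b = b/a" "b^2/a/(b*c/a) = b/c" "b^2/a/(b*d/a) = b/d" "b^2/a/(b*e/a) = b/e"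
    "b^2/a/(b*f/a) = b/f"
    using nz by (simp_all add: field_simps power2_eq_square)
  show "generic q (b^2/a/b)" "generic q (b^2/a/(b*c/a))" "generic q (b^2/a/(b*d/a))"
    "generic q (b^2/a/(b*e/a))" "generic q (b^2/a/(b*f/a))"
    unfolding e using gY by blast+
  show "a^2*q^2/(b*c*d*e*f)*(b*(b*c/a)*(b*d/a)*(b*e/a)*(b*f/a)) = (b^2/a)^2*q^2"
    using nz by (simp add: field_simps power2_eq_square)
qed (use q0 q1 gA gY z3 in auto)

text \<open>\<open>contiguous_down\<close> for q/b and for q/f has the same left side, so the two
  lowered terms differ by \<open>m4 - m5\<close> times \<open>X.phi\<close>. By \<open>m\<close>
  this multiple is exactly what \<open>up5_plus\<close> produces when W3p is traded for the series
  with bf/a raised.\<close>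

lemma wron_b_eq_wron_f: "wron_b q a b c d e f = wron_f q a b c d e f"
proof -
  interpret Xs: vwp_down q "c*d*e/a^2" "c*e/a" "c*d/a" "d*e/a" "q/b" "q/f" "b*f/a"
    by unfold_locales (use X.q0 X.q1 X.ga X.g1 X.g2 X.g3 X.g4 X.g5 X.zq X.zdef generic_qdiv gX in \<open>auto simp: mult_ac\<close>)
  define A where "A = c*d*e/a^2"
  define z where "z = b*f/a"
  define z' where "z' = a^2*q^2/(b*c*d*e*f)"
  have n: "A \<noteq> 0" "z \<noteq> 0" "z' \<noteq> 0" using nz q0 by (auto simp: A_def z_def z'_def)
  define S where "S = q*(1/(c*e/a)+1/(c*d/a)+1/(d*e/a)+1/(q/f)+1/(q/b)) + z + z/A - q"
  define T where "T = (q-z)/A * plus_coeff q A (c*e/a) (c*d/a) (d*e/a) (q/f) (q/b) z * X.phi_plus"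
  define m5 where "m5 = z*(c*e/a+c*d/a+d*e/a+q/f)/A + q/(q/b) + z + (q/b)/A - q*z/(q/b)"
  define m4 where "m4 = z*(c*e/a+c*d/a+d*e/a+q/b)/A + q/(q/f) + z + (q/f)/A - q*z/(q/f)"
  have d5: "S * X.phi - T = m5 * X.phi
      + down_coeff q A (c*e/a) (c*d/a) (d*e/a) (q/f) (q/b) * X.phi_down"
    using X.contiguous_down unfolding A_def[symmetric] z_def[symmetric] S_def T_def m5_def .
  have T': "T = (q-z)/A * plus_coeff q A (c*e/a) (c*d/a) (d*e/a) (q/b) (q/f) z * Xs.phi_plus"
    unfolding T_def using vser_swap45 by (simp add: plus_coeff_def mult_ac)
  have S': "S = q*(1/(c*e/a)+1/(c*d/a)+1/(d*e/a)+1/(q/b)+1/(q/f)) + z + z/A - q"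
    unfolding S_def by simp
  have d4: "S * X.phi - T = m4 * X.phi
      + down_coeff q A (c*e/a) (c*d/a) (d*e/a) (q/b) (q/f) * Xs.phi_down"
    using Xs.contiguous_down
    unfolding A_def[symmetric] z_def[symmetric] S'[symmetric] T'[folded A_def z_def, symmetric] m4_def[symmetric]
    unfolding vser_swap45[of q A _ _ _ "q/b" "q/f"] .
  have yp: "(1 - b*f/a)*(1 - b/f) *
      (vser q (b^2/a) b (b*c/a) (b*d/a) (b*e/a) (b*f/a*q) (z'/q) - Y.phi)
      = plus_coeff q (b^2/a) b (b*c/a) (b*d/a) (b*e/a) (b*f/a) z' * Y.phi_plus"
    using Y.up5_plus nz unfolding z'_def by (simp add: power2_eq_square)
  have m: "q*a/(b*f) * (m4 - m5) = a/b*(q-z')*((1-z)*(1-b/f))"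
  proof -
    have h1: "m4 - m5 = (q/b - q/f)*(1-z)*(b*f/q - 1/A)"
      unfolding m4_def m5_def using n nz q0 by (simp add: field_simps)
    have h2: "1/A = z'*b*f/q^2"
      unfolding A_def z'_def using nz q0 by (simp add: field_simps power2_eq_square)
    define y where "y = 1 - z"
    show ?thesis unfolding h1 h2 y_def[symmetric] using nz q0 by (simp add: field_simps power2_eq_square)
  qed
  have split: "u*(V - m5*x)*y + W*x = u*(V - m4*x)*y + (u*(m4-m5))*(x*y) + W*x" for u V W x y
    by (simp add: algebra_simps)
  have merge: "V + r*g*(x*y) + r*(g*(w - y))*x = V + r*g*x*w" for r g w V x y :: complex
    by (simp add: algebra_simps)
  have "wron_b q a b c d e f = q*a/(b*f) * (S*X.phi - T - m5*X.phi) * Y.phi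
    + a/b*(q-z') * ((1 - b*f/a)*(1 - b/f) *
      (vser q (b^2/a) b (b*c/a) (b*d/a) (b*e/a) (b*f/a*q) (z'/q) - Y.phi)) * X.phi"
    unfolding wron_b_def solX_def solY_def yp using d5 unfolding A_def z_def z'_def by (simp add: mult_ac)
  also have "\<dots> = q*a/(b*f) * (S*X.phi - T - m4*X.phi) * Y.phi
    + (q*a/(b*f) * (m4 - m5)) * (X.phi * Y.phi)
    + a/b*(q-z') * ((1 - b*f/a)*(1 - b/f) *
      (vser q (b^2/a) b (b*c/a) (b*d/a) (b*e/a) (b*f/a*q) (z'/q) - Y.phi)) * X.phi"
    by (rule split)
  also have "\<dots> = q*a/(b*f) * (S*X.phi - T - m4*X.phi) * Y.phi
    + a/b*(q-z') * ((1 - b*f/a)*(1 - b/f)) * X.phi *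
      vser q (b^2/a) b (b*c/a) (b*d/a) (b*e/a) (b*f/a*q) (z'/q)"
    unfolding m unfolding z_def[symmetric] by (rule merge)
  also have "\<dots> = wron_f q a b c d e f"
    unfolding wron_f_def solX_def solY_def using d4
    unfolding A_def z_def z'_def vser_swap45[of q _ _ _ _ "q/b"] by (simp add: mult_ac)
  finally show ?thesis .
qed

text \<open>The coefficients are written out in factors whose behaviour under b -> bq is visible;
  both the recurrence and the limit of the iteration start from this form.\<close>

lemma wron_b_explicit:
  "wron_b q a b c d e f
    = q/(b*f/a)*(-(q/(b*(c*d*e/a^2)))*((1-b*c/a)*(1-b*d/a)*(1-b*e/a)*(1-c*d*e/a^2*b*f/q))/(1-c*d*e/a^2*b))
        * vser q (c*d*e/a^2) (c*e/a) (c*d/a) (d*e/a) (q/f) (1/b) (b*f/a*q) * solY q a b c d e f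
      + a/b*(q-a^2*q^2/(b*c*d*e*f))
        * (a^2*q^2/(b*c*d*e*f)/q*((1-b^2*q/a)*(1-b^2*q^2/a))*((1-b)*((1-b*c/a)*(1-b*d/a)*(1-b*e/a))*(1-b*f/a))
            / ((1-b*q/a)*(1-b*q/c)*(1-b*q/d)*(1-b*q/e)*(1-b*q/f)))
        * solX q a b c d e f
        * vser q (b^2*q^2/a) (b*q) (b*c*q/a) (b*d*q/a) (b*e*q/a) (b*f*q/a) (a^2*q^2/(b*c*d*e*f)/q)"
proof -
  define A where "A = c*d*e/a^2"
  define z2 where "z2 = b*f/a"
  define z3 where "z3 = a^2*q^2/(b*c*d*e*f)"
  define u3 where "u3 = (1-b*c/a)*(1-b*d/a)*(1-b*e/a)"
  define h where "h = 1 - A*b*f/q"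
  define k where "k = 1 - A*b"
  define m where "m = (1-b^2*q/a)*(1-b^2*q^2/a)"
  define n4 where "n4 = (1-b*q/a)*(1-b*q/c)*(1-b*q/d)*(1-b*q/e)"
  define n5 where "n5 = 1-b*q/f"
  define g where "g = 1-z2"
  define X' where "X' = solX q a b c d e f"
  define Xm where "Xm = vser q A (c*e/a) (c*d/a) (d*e/a) (q/f) (1/b) (z2*q)"
  define Y' where "Y' = solY q a b c d e f"
  define Yp where "Yp = vser q (b^2*q^2/a) (b*q) (b*c*q/a) (b*d*q/a) (b*e*q/a) (b*f*q/a) (z3/q)"
  have "wron_b q a b c d e f
    = (q/z2)*(-(q/(b*A))*(u3*h)/k)*Xm*Y' + (a/b)*(q-z3)*(z3/q*m*((1-b)*u3*g)/(n4*n5))*X'*Yp"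
  proof -
    have "down_coeff q A (c*e/a) (c*d/a) (d*e/a) (q/f) (q/b) = -(q/(b*A))*(u3*h)/k"
    proof -
      have e: "A*q/(c*e/a*(q/b)) = b*d/a" "A*q/(c*d/a*(q/b)) = b*e/a" "A*q/(d*e/a*(q/b)) = b*c/a"
        "A*q/(q/f*(q/b)) = A*b*f/q" "A*q/(q/b) = A*b"
        using nz q0 by (simp_all add: A_def field_simps power2_eq_square)
      show ?thesis unfolding down_coeff_def e u3_def h_def k_def by (simp add: mult_ac)
    qed
    moreover have "plus_coeff q (b^2/a) b (b*c/a) (b*d/a) (b*e/a) (b*f/a) z3
        = z3/q*m*((1-b)*u3*g)/(n4*n5)"
    proof -
      define A' where "A' = b^2/a"
      have e1: "A'*q = b^2*q/a" "A'*q^2 = b^2*q^2/a" by (simp_all add: A'_def)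
      have e2: "b^2*q/a/b = b*q/a" "b^2*q/a/(b*c/a) = b*q/c" "b^2*q/a/(b*d/a) = b*q/d"
        "b^2*q/a/(b*e/a) = b*q/e" "b^2*q/a/(b*f/a) = b*q/f"
        using nz by (simp_all add: field_simps power2_eq_square)
      show ?thesis unfolding plus_coeff_def A'_def[symmetric] e1 unfolding e2 unfolding z2_def[symmetric] m_def u3_def g_def n4_def n5_def
        by (simp only: mult.assoc)
    qed
    moreover have "q*a/(b*f) = q/z2" by (simp add: z2_def)
    moreover have "vser q A (c*e/a) (c*d/a) (d*e/a) (q/f) (q/b/q) (z2*q) = Xm"
      unfolding Xm_def using q0 by simp
    moreover have "vser q (b^2/a*q^2) (b*q) (b*c/a*q) (b*d/a*q) (b*e/a*q) (z2*q) (z3/q) = Yp"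
      unfolding Yp_def z2_def by simp
    ultimately show ?thesis
      unfolding wron_b_def X'_def Y'_def A_def[symmetric] z2_def[symmetric] z3_def[symmetric] by simp
  qed
  then show ?thesis
    unfolding Xm_def Yp_def X'_def Y'_def u3_def h_def k_def m_def n4_def n5_def g_def
    unfolding A_def z2_def z3_def .
qed

text \<open>The computation ends in \<open>wron_f\<close> at the shifted point, where
  \<open>wron_b_eq_wron_f\<close> turns it into a recurrence for \<open>wron_b\<close>
  alone.\<close>

lemma wron_step:
  assumes gs: "generic_params q a (b*q) c d e (f/q)"
  shows "wron_b q a b c d e f = - (q^2*a^2/(c*d*e*f)) * ((1-q/f)*(1-c*d*e*f/(a^2*q))
        *((1-b^2*q/a)*(1-b^2*q^2/a))*((1-b*c/a)*(1-b*d/a)*(1-b*e/a))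
        / ((1-b*c*d*e/a^2)*((1-b*q/a)*(1-b*q/c)*(1-b*q/d)*(1-b*q/e))*(1-b*q/f)*(1-b*q^2/f)))
      * wron_b q a (b*q) c d e (f/q)"
proof -
  interpret s: generic_params q a "b*q" c d e "f/q" by (rule gs)
  define A where "A = c*d*e/a^2"
  define z2 where "z2 = b*f/a"
  define z3 where "z3 = a^2*q^2/(b*c*d*e*f)"
  have n: "A \<noteq> 0" "z2 \<noteq> 0" "z3 \<noteq> 0" using nz q0 by (auto simp: A_def z2_def z3_def)
  define u3 where "u3 = (1-b*c/a)*(1-b*d/a)*(1-b*e/a)"
  define h where "h = 1 - A*b*f/q"
  define k where "k = 1 - A*b"
  define m where "m = (1-b^2*q/a)*(1-b^2*q^2/a)"
  define n4 where "n4 = (1-b*q/a)*(1-b*q/c)*(1-b*q/d)*(1-b*q/e)"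
  define n5 where "n5 = 1-b*q/f"
  define n6 where "n6 = 1-b*q^2/f"
  define g where "g = 1-z2"
  define l where "l = 1-q/f"
  define j where "j = 1-A*f/q"
  define w3 where "w3 = (1-a*q/(c*f))*(1-a*q/(d*f))*(1-a*q/(e*f))"
  define y3 where "y3 = (1-c*f/(a*q))*(1-d*f/(a*q))*(1-e*f/(a*q))"
  define X' where "X' = solX q a b c d e f"
  define X where "X = solX q a (b*q) c d e (f/q)"
  define Xm where "Xm = vser q A (c*e/a) (c*d/a) (d*e/a) (q/f) (1/b) (z2*q)"
  define Y' where "Y' = solY q a b c d e f"
  define Y where "Y = solY q a (b*q) c d e (f/q)"
  define Yp where "Yp = vser q (b^2*q^2/a) (b*q) (b*c*q/a) (b*d*q/a) (b*e*q/a) (b*f*q/a) (z3/q)"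
  have ab: "A*b = b*c*d*e/a^2" "A*f/q = c*d*e*f/a^2/q"
    by (simp_all add: A_def)
  have k0: "k \<noteq> 0" unfolding k_def ab by (rule generic_1[OF gX(5) q0])
  have j0: "j \<noteq> 0" unfolding j_def ab by (rule generic_1[OF generic_div_q[OF gX(4) q0] q0])
  have g1: "1-b*q/x \<noteq> 0" if "generic q (b/x)" for x
    using generic_1[OF generic_mult_q[OF that q0] q0] by simp
  have n40: "n4 \<noteq> 0" "n5 \<noteq> 0" using g1 gY by (auto simp: n4_def n5_def)
  have n60: "n6 \<noteq> 0"
    using generic_1[OF generic_mult_q[OF generic_mult_q[OF gY(5) q0] q0] q0]
    by (simp add: n6_def power2_eq_square mult.assoc)
  have ae: "a = q^2/(z2*z3*A)"
    using nz q0 by (simp add: z2_def z3_def A_def field_simps power2_eq_square power3_eq_cube)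
  have fe: "f = q^2/(b*z3*A)"
    using nz q0 by (simp add: z3_def A_def field_simps power2_eq_square)
  \<comment> \<open>Reflecting 1 - x = -x (1 - 1/x) in three factors matches the coefficient from
    the W3 side with \<open>down_coeff\<close> from the W2 side.\<close>
  have w3e: "w3 = - (a*q^3/(A*f^3)) * y3"
  proof -
    have "1-a*q/(x*f) = - (a*q/(x*f)) * (1-x*f/(a*q))" if "x \<noteq> 0" for x
      using that nz q0 by (simp add: field_simps)
    then have "w3 = (- (a*q/(c*f)) * (1-c*f/(a*q))) * (- (a*q/(d*f)) * (1-d*f/(a*q)))
        * (- (a*q/(e*f)) * (1-e*f/(a*q)))"
      unfolding w3_def using nz by simp
    also have "\<dots> = - ((a*q/(c*f)) * (a*q/(d*f)) * (a*q/(e*f))) * y3"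
      unfolding y3_def by (simp only: mult_minus_left mult_minus_right minus_minus mult_ac)
    also have "(a*q/(c*f)) * (a*q/(d*f)) * (a*q/(e*f)) = a*q^3/(A*f^3)"
      unfolding A_def using nz by (simp add: field_simps power2_eq_square power3_eq_cube)
    finally show ?thesis .
  qed
  have zs: "b*q*(f/q)/a = z2" "a^2*q^2/(b*q*c*d*e*(f/q)) = z3"
    using q0 by (simp_all add: z2_def z3_def)
  \<comment> \<open>The starting parameters are q/f and 1/b. Raising 1/b gives q/b, the series at
    (b, f); raising q/f gives q^2/f, the series at (bq, f/q).\<close>
  have Xe: "- ((1-b)/b)*k*X' - l*j*X = - (n5/b)*h*Xm"
  proof -
    interpret t: vwp q A "c*e/a" "c*d/a" "d*e/a" "q/f" "1/b" "z2*q"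
    proof
      have e: "A/(c*e/a) = d/a" "A/(c*d/a) = e/a" "A/(d*e/a) = c/a"
        "A/(q/f) = c*d*e*f/a^2/q" "A/(1/b) = b*c*d*e/a^2"
        using nz by (simp_all add: A_def field_simps power2_eq_square)
      show "generic q (A/(c*e/a))" "generic q (A/(c*d/a))" "generic q (A/(d*e/a))"
        "generic q (A/(q/f))" "generic q (A/(1/b))"
        unfolding e using gX generic_div_q[OF _ q0] by blast+
      show "norm (z2*q) < norm q"
        using mult_strict_right_mono[OF X.z1[folded z2_def] X.q0n] by (simp add: norm_mult)
    qed (use q0 q1 gA in \<open>auto simp: A_def\<close>)
    have e: "1/b*q = q/b" "z2*q/q = z2" "A/(1/b) = A*b" "q/f*q = q/(f/q)" "1/b = q/(b*q)"
      "A/(q/f) = A*f/q" using q0 by simp_all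
    have "(1-1/b)*(1-A/(1/b)) * vser q A (c*e/a) (c*d/a) (d*e/a) (q/f) (1/b*q) (z2*q/q)
      - (1-q/f)*(1-A/(q/f)) * vser q A (c*e/a) (c*d/a) (d*e/a) (q/f*q) (1/b) (z2*q/q)
      = (q/f - 1/b)*(1 - A/(q/f*(1/b))) * Xm"
      unfolding Xm_def by (rule t.up5_up4)
    moreover have "vser q A (c*e/a) (c*d/a) (d*e/a) (q/f) (1/b*q) (z2*q/q) = X'"
      unfolding X'_def solX_def A_def z2_def using q0 by simp
    moreover have "vser q A (c*e/a) (c*d/a) (d*e/a) (q/f*q) (1/b) (z2*q/q) = X"
      unfolding X_def solX_def A_def zs using q0 by simp
    moreover have "(1-1/b)*(1-A/(1/b)) = - ((1-b)/b)*k"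
      unfolding k_def using nz by (simp add: field_simps)
    moreover have "(1-q/f)*(1-A/(q/f)) = l*j" by (simp add: l_def j_def)
    moreover have "(q/f - 1/b)*(1 - A/(q/f*(1/b))) = - (n5/b)*h"
      unfolding n5_def h_def using nz q0 by (simp add: field_simps)
    ultimately show ?thesis by simp
  qed
  \<comment> \<open>The last series of \<open>contiguous_plus_down\<close> keeps its
    \<open>p5\<close>, here bf/a, which the shift does not change, and raises the other parameters
    as b -> bq does; it is therefore \<open>Y\<close>.\<close>
  have Ye: "Y' = (1-z3/q)*m*g/n4*Yp + (z2*m*(l*w3)/(n4*n5*n6))*Y"
  proof -
    define A' where "A' = b^2/a"
    have e1: "A'*q = b^2*q/a" "A'*q^2 = b^2*q^2/a" by (simp_all add: A'_def)
    have e2: "b^2*q/a/b = b*q/a" "b^2*q/a/(b*c/a) = b*q/c" "b^2*q/a/(b*d/a) = b*q/d"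
      "b^2*q/a/(b*e/a) = b*q/e" "b^2*q/a/(b*f/a) = b*q/f" "b^2*q^2/a/(b*f/a) = b*q^2/f"
      "b^2*q/a/(b*(b*f/a)) = q/f" "b^2*q/a/(b*c/a*(b*f/a)) = a*q/(c*f)"
      "b^2*q/a/(b*d/a*(b*f/a)) = a*q/(d*f)" "b^2*q/a/(b*e/a*(b*f/a)) = a*q/(e*f)"
      using nz by (simp_all add: field_simps power2_eq_square)
    have Yf: "Y = vser q (b^2*q^2/a) (b*q) (b*c/a*q) (b*d/a*q) (b*e/a*q) (b*f/a) z3"
      unfolding Y_def solY_def zs unfolding z2_def using q0 by (simp add: power_mult_distrib mult_ac)
    have Ypf: "Yp = vser q (b^2*q^2/a) (b*q) (b*c/a*q) (b*d/a*q) (b*e/a*q) (b*f/a*q) (z3/q)"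
      unfolding Yp_def by simp
    have pd: "Y' = (1-z3/q)*(1-b^2*q/a)*(1-b^2*q^2/a)*(1-z2) / n4 * Yp
      + z2*(1-b^2*q/a)*(1-b^2*q^2/a) * (l*(1-a*q/(c*f))*(1-a*q/(d*f))*(1-a*q/(e*f))) / (n4*n5*n6) * Y"
      using Y.contiguous_plus_down[OF gX(7) gY(6-8)]
      unfolding A'_def[symmetric] e1 Yf Ypf unfolding e2 unfolding A'_def
        z3_def[symmetric] z2_def[symmetric] n4_def n5_def n6_def l_def Y'_def solY_def
      by (simp only: mult.assoc)
    then show ?thesis unfolding m_def g_def w3_def by (simp only: mult.assoc)
  qed
  have Eb: "wron_b q a b c d e f
    = (q/z2)*(-(q/(b*A))*(u3*h)/k)*Xm*Y' + (a/b)*(q-z3)*(z3/q*m*((1-b)*u3*g)/(n4*n5))*X'*Yp"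
    using wron_b_explicit
    unfolding Xm_def Yp_def X'_def Y'_def u3_def h_def k_def m_def n4_def n5_def g_def
    unfolding A_def z2_def z3_def .
  have Ef: "wron_f q a (b*q) c d e (f/q)
    = (q/z2)*(-(q^2/(f*A))*(y3*h)/j)*Xm*Y + (a/(b*q))*(q-z3)*g*n6*X*Yp"
  proof -
    have "down_coeff q A (c*e/a) (c*d/a) (d*e/a) (q/(b*q)) (q/(f/q)) = -(q^2/(f*A))*(y3*h)/j"
    proof -
      have e: "A*q/(c*e/a*(q/(f/q))) = d*f/(a*q)" "A*q/(c*d/a*(q/(f/q))) = e*f/(a*q)"
        "A*q/(d*e/a*(q/(f/q))) = c*f/(a*q)" "A*q/(q/(b*q)*(q/(f/q))) = A*b*f/q" "A*q/(q/(f/q)) = A*f/q"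
        "q/(f/q)/A = q^2/(f*A)"
        using nz q0 by (simp_all add: A_def field_simps power2_eq_square)
      show ?thesis unfolding down_coeff_def e y3_def h_def j_def by (simp add: mult_ac)
    qed
    moreover have "q*a/(b*q*(f/q)) = q/z2" using q0 by (simp add: z2_def)
    moreover have "vser q A (c*e/a) (c*d/a) (d*e/a) (q/(f/q)/q) (q/(b*q)) (z2*q) = Xm"
      unfolding Xm_def using q0 by simp
    moreover have "vser q ((b*q)^2/a) (b*q) (b*q*c/a) (b*q*d/a) (b*q*e/a) (z2*q) (z3/q) = Yp"
      unfolding Yp_def z2_def by (simp add: power_mult_distrib mult_ac)
    moreover have "1 - b*q/(f/q) = n6" by (simp add: n6_def power2_eq_square)
    ultimately show ?thesis
      unfolding wron_f_def X_def Y_def zs A_def[symmetric] g_def[symmetric] by simp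
  qed
  have "wron_b q a b c d e f = - (q^2/(A*f)) * (l*j*m*u3/(k*n4*n5*n6)) * wron_f q a (b*q) c d e (f/q)"
    unfolding Eb Ef
    by (rule wronskian_step_identity[OF q0 nz(2) n(2,3,1) k0 n40 n60 j0 ae fe w3e Xe Ye])
  also have "q^2/(A*f) = q^2*a^2/(c*d*e*f)" unfolding A_def by simp
  finally show ?thesis
    unfolding s.wron_b_eq_wron_f l_def j_def m_def u3_def k_def n4_def n5_def n6_def
    by (simp add: A_def mult_ac)
qed

end

section \<open>Infinite products and summation formulas\<close>

lemma qinf_has_prod:
  assumes "norm q < 1"
  shows "(\<lambda>j. 1 - x * q ^ j) has_prod qinf q x"
proof -
  have "summable (\<lambda>j. norm x * norm q ^ j)"
    using assms by (intro summable_mult summable_geometric) simp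
  then have "abs_convergent_prod (\<lambda>j. 1 - x * q ^ j)"
    by (simp add: abs_convergent_prod_conv_summable norm_mult norm_power)
  then show ?thesis
    unfolding qinf_def by (intro convergent_prod_has_prod abs_convergent_prod_imp_convergent_prod)
qed

lemma qpoch_tendsto_qinf: "norm q < 1 \<Longrightarrow> (\<lambda>n. qpoch q x n) \<longlonglongrightarrow> qinf q x"
  unfolding qpoch_def by (rule has_prod_imp_tendsto'[OF qinf_has_prod])

lemma qinf_eq_0_iff: "norm q < 1 \<Longrightarrow> qinf q x = 0 \<longleftrightarrow> (\<exists>j. x * q ^ j = 1)"
  using has_prod_eq_0_iff[OF qinf_has_prod, of q x] by (auto simp: image_iff)

lemma qinf_rec:
  assumes "norm q < 1"
  shows "qinf q x = (1 - x) * qinf q (x * q)"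
proof -
  have "(\<lambda>n. qpoch q x (Suc n)) \<longlonglongrightarrow> qinf q x"
    using qpoch_tendsto_qinf[OF assms] by (rule LIMSEQ_Suc)
  moreover have "(\<lambda>n. qpoch q x (Suc n)) \<longlonglongrightarrow> (1 - x) * qinf q (x * q)"
    unfolding qpoch_Suc_shift by (intro tendsto_intros qpoch_tendsto_qinf assms)
  ultimately show ?thesis by (rule LIMSEQ_unique)
qed

lemma qinf_0 [simp]: "qinf q 0 = 1"
  by (simp add: qinf_def)

lemma qinf_small_nz:
  assumes "norm q < 1" "norm x < 1"
  shows "qinf q x \<noteq> 0"
proof
  assume "qinf q x = 0"
  then obtain j where "x * q ^ j = 1" using qinf_eq_0_iff[OF assms(1)] by blast
  moreover have "norm (x * q ^ j) < 1"
    using mult_left_le[of "norm q ^ j" "norm x"] assms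
    by (simp add: norm_mult norm_power power_le_one)
  ultimately show False by simp
qed

lemma generic_qinf: "generic q x \<Longrightarrow> q \<noteq> 0 \<Longrightarrow> norm q < 1 \<Longrightarrow> qinf q x \<noteq> 0"
  using generic_factor[of q x] by (auto simp: qinf_eq_0_iff)

lemma holomorphic_qinf_UNIV:
  assumes "norm q < 1"
  shows "qinf q holomorphic_on UNIV"
proof (rule holomorphic_uniform_sequence)
  show "(\<lambda>x. qpoch q x n) holomorphic_on UNIV" for n
    unfolding qpoch_def by (intro holomorphic_intros)
  fix x :: complex
  define R where "R = norm x + 1"
  have "uniformly_convergent_on (cball x 1) (\<lambda>n x. \<Prod>j<n. 1 - x * q ^ j)"
  proof (rule uniformly_convergent_on_prod')
    show "uniformly_convergent_on (cball x 1) (\<lambda>N x. \<Sum>n<N. norm (1 - x * q ^ n - 1))"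
    proof (rule Weierstrass_m_test')
      show "norm (norm (1 - y * q ^ n - 1)) \<le> R * norm q ^ n" if "y \<in> cball x 1" for n y
      proof -
        have "norm y \<le> R"
          using that norm_triangle_ineq2[of y x] by (simp add: R_def dist_norm norm_minus_commute)
        then show ?thesis by (simp add: norm_mult norm_power mult_right_mono)
      qed
      show "summable (\<lambda>n. R * norm q ^ n)"
        using assms by (intro summable_mult summable_geometric) simp
    qed
  qed (auto intro!: continuous_intros)
  then obtain g where g: "uniform_limit (cball x 1) (\<lambda>n x. \<Prod>j<n. 1 - x * q ^ j) g sequentially"
    by (auto simp: uniformly_convergent_on_def)
  have "g y = qinf q y" if "y \<in> cball x 1" for y
  proof (rule LIMSEQ_unique)
    show "(\<lambda>n. \<Prod>j<n. 1 - y * q ^ j) \<longlonglongrightarrow> g y" using tendsto_uniform_limitI[OF g that] .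
    show "(\<lambda>n. \<Prod>j<n. 1 - y * q ^ j) \<longlonglongrightarrow> qinf q y"
      using qpoch_tendsto_qinf[OF assms] unfolding qpoch_def .
  qed
  then have "uniform_limit (cball x 1) (\<lambda>n x. qpoch q x n) (qinf q) sequentially"
    using g unfolding qpoch_def by (metis (no_types, lifting) uniform_limit_cong')
  then show "\<exists>d>0. cball x d \<subseteq> UNIV \<and> uniform_limit (cball x d) (\<lambda>n x. qpoch q x n) (qinf q) sequentially"
    by (intro exI[of _ 1]) auto
qed auto

lemma isCont_qinf: "norm q < 1 \<Longrightarrow> isCont (qinf q) x"
  using holomorphic_qinf_UNIV[of q] holomorphic_on_imp_continuous_on continuous_on_eq_continuous_at
  by blast

lemma qinf_tendsto:
  assumes "norm q < 1" "(f \<longlongrightarrow> l) F"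
  shows "((\<lambda>n. qinf q (f n)) \<longlongrightarrow> qinf q l) F"
  using isCont_tendsto_compose[OF isCont_qinf[OF assms(1)] assms(2)] .

lemma qinf_power_tendsto_1:
  assumes "norm q < 1"
  shows "(\<lambda>n. qinf q (x * q ^ n)) \<longlonglongrightarrow> 1"
proof -
  have "(\<lambda>n. x * q ^ n) \<longlonglongrightarrow> x * 0"
    by (intro tendsto_intros LIMSEQ_power_zero assms)
  then show ?thesis using qinf_tendsto[OF assms] by fastforce
qed

section \<open>Bounds for shifted factorials that are uniform in k\<close>

lemma qpoch_add: "qpoch q x (m + k) = qpoch q x m * qpoch q (x * q ^ m) k"
  by (induction k) (simp_all add: qpoch_Suc power_add mult_ac)

text \<open>The inequality 1 + t <= exp t turns the product into a geometric sum, so the constant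
  depends only on \<open>R\<close> and \<open>q\<close>.\<close>

lemma qpoch_upper:
  assumes "norm q < 1"
  obtains C where "C > 0" "\<And>(y::complex) k. norm y \<le> R \<Longrightarrow> norm (qpoch q y k) \<le> C"
proof
  show "exp (\<bar>R\<bar> / (1 - norm q)) > 0" by simp
  fix y :: complex and k assume y: "norm y \<le> R"
  have "norm (qpoch q y k) = (\<Prod>j<k. norm (1 - y * q ^ j))"
    by (simp add: qpoch_def prod_norm)
  also have "\<dots> \<le> (\<Prod>j<k. exp (\<bar>R\<bar> * norm q ^ j))"
  proof (rule prod_mono, safe)
    fix j
    have "norm (1 - y * q ^ j) \<le> 1 + norm y * norm q ^ j"
      using norm_triangle_ineq4[of 1 "y * q ^ j"] by (simp add: norm_mult norm_power)
    also have "\<dots> \<le> 1 + \<bar>R\<bar> * norm q ^ j"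
      using y by (intro add_left_mono mult_right_mono) auto
    also have "\<dots> \<le> exp (\<bar>R\<bar> * norm q ^ j)" by (rule exp_ge_add_one_self)
    finally show "norm (1 - y * q ^ j) \<le> exp (\<bar>R\<bar> * norm q ^ j)" .
  qed simp
  also have "\<dots> = exp (\<bar>R\<bar> * (\<Sum>j<k. norm q ^ j))"
    by (simp add: exp_sum sum_distrib_left)
  also have "\<dots> \<le> exp (\<bar>R\<bar> * (1 / (1 - norm q)))"
  proof -
    have "(\<Sum>j<k. norm q ^ j) \<le> (\<Sum>j. norm q ^ j)"
      using assms by (intro sum_le_suminf summable_geometric) auto
    then show ?thesis using assms mult_left_mono[of "\<Sum>j<k. norm q ^ j" "1 / (1 - norm q)" "\<bar>R\<bar>"]
      by (simp add: suminf_geometric)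
  qed
  finally show "norm (qpoch q y k) \<le> exp (\<bar>R\<bar> / (1 - norm q))" by simp
qed

text \<open>(x q^n)_k is the quotient of (x)_(n+k) by (x)_n. The first is never 0 and has a nonzero
  limit, hence is bounded away from 0; the second is bounded above. Uniformity in n is what
  dominated convergence along the iteration needs.\<close>

lemma qpoch_lower:
  assumes "norm q < 1" "q \<noteq> 0" "generic q x"
  obtains d where "d > 0" "\<And>n k. d \<le> norm (qpoch q (x * q ^ n) k)"
proof -
  have "(\<lambda>m. inverse (qpoch q x m)) \<longlonglongrightarrow> inverse (qinf q x)"
    using assms by (intro tendsto_inverse qpoch_tendsto_qinf generic_qinf)
  then have "Bseq (\<lambda>m. inverse (qpoch q x m))"
    using convergent_def convergent_imp_Bseq by blast
  then obtain B where B: "B > 0" "\<And>m. norm (inverse (qpoch q x m)) \<le> B"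
    by (auto elim: BseqE)
  obtain C where C: "C > 0" "\<And>y k. norm y \<le> norm x \<Longrightarrow> norm (qpoch q y k) \<le> C"
    using qpoch_upper[OF assms(1)] by blast
  have "1 / (B * C) \<le> norm (qpoch q (x * q ^ n) k)" for n k
  proof -
    have nz: "qpoch q x m \<noteq> 0" for m using assms generic_qpoch by blast
    have "norm (qpoch q x (n + k)) = norm (qpoch q x n) * norm (qpoch q (x * q ^ n) k)"
      by (simp add: qpoch_add norm_mult)
    moreover have "1 / B \<le> norm (qpoch q x (n + k))"
      using B(2)[of "n + k"] B(1) nz[of "n + k"] by (simp add: norm_inverse norm_divide field_simps)
    moreover have "norm (qpoch q x n) * norm (qpoch q (x * q ^ n) k) \<le> C * norm (qpoch q (x * q ^ n) k)"
      using C by (intro mult_right_mono) auto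
    ultimately have "1 / B \<le> C * norm (qpoch q (x * q ^ n) k)" by linarith
    then show ?thesis using B(1) C(1) by (simp add: field_simps)
  qed
  moreover have "1 / (B * C) > 0" using B C by simp
  ultimately show ?thesis using that by blast
qed

text \<open>The base q is a power of q and so not \<open>generic\<close>; its factorials need their
  own bound.\<close>

lemma qpoch_qq_lower:
  assumes "norm q < 1" "q \<noteq> 0"
  obtains d where "d > 0" "\<And>k. d \<le> norm (qpoch q q k)"
proof -
  have "(\<lambda>m. inverse (qpoch q q m)) \<longlonglongrightarrow> inverse (qinf q q)"
    using assms by (intro tendsto_inverse qpoch_tendsto_qinf qinf_small_nz)
  then have "Bseq (\<lambda>m. inverse (qpoch q q m))"
    using convergent_def convergent_imp_Bseq by blast
  then obtain B where B: "B > 0" "\<And>m. norm (inverse (qpoch q q m)) \<le> B"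
    by (auto elim: BseqE)
  have "1 / B \<le> norm (qpoch q q k)" for k
    using B(2)[of k] B(1) qpoch_qq_nz[OF assms(1), of k] by (simp add: norm_inverse norm_divide field_simps)
  then show ?thesis using that[of "1 / B"] B(1) by simp
qed

lemma qpoch_shift_tendsto_1:
  assumes "norm q < 1"
  shows "(\<lambda>n. qpoch q (x * q ^ n) k) \<longlonglongrightarrow> 1"
proof -
  have "(\<lambda>n. qpoch q (x * q ^ n) k) \<longlonglongrightarrow> (\<Prod>j<k. 1 - x * 0 * q ^ j)"
    unfolding qpoch_def by (intro tendsto_intros LIMSEQ_power_zero assms)
  then show ?thesis by simp
qed

lemma tannery_geometric:
  fixes T :: "nat \<Rightarrow> nat \<Rightarrow> complex"
  assumes lim: "\<And>k. (\<lambda>n. T n k) \<longlonglongrightarrow> t k"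
    and bound: "\<And>n k. n \<ge> N \<Longrightarrow> norm (T n k) \<le> C * r ^ k" and r: "0 \<le> r" "r < 1"
  shows "(\<lambda>n. \<Sum>k. T n k) \<longlonglongrightarrow> (\<Sum>k. t k)"
proof -
  have "eventually (\<lambda>n. \<forall>k. norm (T n k) \<le> C * r ^ k) sequentially"
    using bound eventually_sequentially by blast
  then have "\<forall>\<^sub>F (k, n) in at_top \<times>\<^sub>F sequentially. norm (T n k) \<le> C * r ^ k"
    unfolding eventually_prod_filter case_prod_conv
    by (intro exI[of _ "\<lambda>_. True"] exI[of _ "\<lambda>n. \<forall>k. norm (T n k) \<le> C * r ^ k"]) auto
  moreover have "summable (\<lambda>k. C * r ^ k)"
    using r by (intro summable_mult summable_geometric) auto
  ultimately show ?thesis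
    using tannerys_theorem[of "\<lambda>k n. T n k" t sequentially "\<lambda>k. C * r ^ k"] lim by simp
qed

lemma norm_quotient_bound:
  fixes x y :: complex
  assumes "norm x \<le> C" "d \<le> norm y" "d > 0"
  shows "norm (x / y) \<le> C / d"
proof -
  have "0 \<le> C" using assms(1) norm_ge_zero order_trans by blast
  then show ?thesis unfolding norm_divide using assms by (intro frac_le) auto
qed

subsection \<open>The nonterminating very-well-poised sum\<close>

text \<open>Telescoping certificate for \<open>w6_contiguous\<close> with x = q^k. Here
  \<open>e1\<close> and \<open>e2\<close> are the first two elementary symmetric functions of B, C,
  D, \<open>Q\<close> is Aq, and the third symmetric function is Q/z by the choice of the
  argument.\<close>

lemma cert6:
  fixes A Q z e1 e2 x :: complex
  shows "(1-z)*(1-A*x^2)*(1-z*e2*x+z*Q*e1*x^2-z*Q^2*x^3)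
     - (1-z*e1+z^2*e2-z^2*Q)*x*(1-Q*x^2)*(1-A*x)
   = - ((1-A*x)*(z-z*e1*x+z*e2*x^2-Q*x^3)*(1-Q*z*x) - (1-x)*(1-z*e2*x+z*Q*e1*x^2-z*Q^2*x^3)*(1-A*z*x))"
  by (simp add: algebra_simps power2_eq_square power3_eq_cube power4_eq_xxxx)

text \<open>The equations f 0 * g n = g 0 * f n are obtained without dividing by \<open>r n\<close>,
  so the recurrence coefficient may vanish.\<close>

lemma iterate_limit:
  fixes f g r :: "nat \<Rightarrow> complex"
  assumes f: "\<And>n. f n = r n * f (Suc n)" and g: "\<And>n. g n = r n * g (Suc n)"
    and lim: "f \<longlonglongrightarrow> l" "g \<longlonglongrightarrow> l" and l: "l \<noteq> 0"
  shows "f 0 = g 0"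
proof -
  have "f 0 = (\<Prod>k<n. r k) * f n \<and> g 0 = (\<Prod>k<n. r k) * g n" for n
  proof (induction n)
    case (Suc n)
    then show ?case using f[of n] g[of n] by simp
  qed simp
  then have eq: "f 0 * g n = g 0 * f n" for n
    using mult.commute mult.left_commute by metis
  have "(\<lambda>n. f 0 * g n) \<longlonglongrightarrow> f 0 * l" "(\<lambda>n. g 0 * f n) \<longlonglongrightarrow> g 0 * l"
    by (intro tendsto_intros lim)+
  then have "f 0 * l = g 0 * l" unfolding eq using LIMSEQ_unique by blast
  then show ?thesis using l by simp
qed

text \<open>The terms of the very-well-poised 6W5 series (a 6phi5) at its natural argument
  Aq/(BCD).\<close>

definition w6 :: "complex \<Rightarrow> complex \<Rightarrow> complex \<Rightarrow> complex \<Rightarrow> complex \<Rightarrow> nat \<Rightarrow> complex" where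
  "w6 q A B C D k = (1 - A*q^(2*k))/(1-A)
    * ((qpoch q A k * qpoch q B k * qpoch q C k * qpoch q D k)
      / (qpoch q q k * qpoch q (A*q/B) k * qpoch q (A*q/C) k * qpoch q (A*q/D) k))
    * (A*q/(B*C*D))^k"

locale w6_params =
  fixes q A B C D :: complex
  assumes q0: "q \<noteq> 0" and q1: "norm q < 1" and gA: "generic q A"
    and gB: "generic q (A/B)" and gC: "generic q (A/C)" and gD: "generic q (A/D)"
    and z1: "norm (A*q/(B*C*D)) < 1"
begin

lemma nz: "A \<noteq> 0" "B \<noteq> 0" "C \<noteq> 0" "D \<noteq> 0"
  using gA gB gC gD by (auto simp: generic_def)

lemma shifted: "w6_params q (A*q^n) B C D"
proof
  show "generic q (A*q^n)" using generic_shift[OF gA q0, of "int n"] by simp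
  show "generic q (A*q^n/B)" "generic q (A*q^n/C)" "generic q (A*q^n/D)"
    using generic_shift[OF gB q0, of "int n"] generic_shift[OF gC q0, of "int n"]
      generic_shift[OF gD q0, of "int n"] by simp_all
  have "norm (A*q/(B*C*D)) * norm q^n \<le> norm (A*q/(B*C*D))"
    using q1 by (intro mult_left_le power_le_one) auto
  then show "norm (A*q^n*q/(B*C*D)) < 1"
    using z1 by (simp add: norm_mult norm_divide norm_power mult_ac)
qed (rule q0 q1)+

text \<open>The geometric ratio shrinks with n because scaling A scales the argument. This yields
  both the summable majorant and, for k > 0, the vanishing of the terms in the limit.\<close>

lemma w6_bound:
  obtains c where "\<And>n k. norm (w6 q (A*q^n) B C D k) \<le> c * (norm (A*q/(B*C*D)) * norm q^n)^k"
proof -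
  obtain cA where cA: "cA > 0" "\<And>y k. norm y \<le> norm A \<Longrightarrow> norm (qpoch q y k) \<le> cA"
    using qpoch_upper[OF q1] by blast
  obtain cB where cB: "cB > 0" "\<And>y k. norm y \<le> norm B \<Longrightarrow> norm (qpoch q y k) \<le> cB"
    using qpoch_upper[OF q1] by blast
  obtain cC where cC: "cC > 0" "\<And>y k. norm y \<le> norm C \<Longrightarrow> norm (qpoch q y k) \<le> cC"
    using qpoch_upper[OF q1] by blast
  obtain cD where cD: "cD > 0" "\<And>y k. norm y \<le> norm D \<Longrightarrow> norm (qpoch q y k) \<le> cD"
    using qpoch_upper[OF q1] by blast
  have g: "generic q (A/X*q)" if "generic q (A/X)" for X
    using generic_mult_q[OF that q0] .
  obtain d1 where d1: "d1 > 0" "\<And>n k. d1 \<le> norm (qpoch q (A/B*q*q^n) k)"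
    using qpoch_lower[OF q1 q0 g[OF gB]] by blast
  obtain d2 where d2: "d2 > 0" "\<And>n k. d2 \<le> norm (qpoch q (A/C*q*q^n) k)"
    using qpoch_lower[OF q1 q0 g[OF gC]] by blast
  obtain d3 where d3: "d3 > 0" "\<And>n k. d3 \<le> norm (qpoch q (A/D*q*q^n) k)"
    using qpoch_lower[OF q1 q0 g[OF gD]] by blast
  obtain d4 where d4: "d4 > 0" "\<And>n k. d4 \<le> norm (qpoch q (A*q^n) k)"
    using qpoch_lower[OF q1 q0 gA] by blast
  obtain d5 where d5: "d5 > 0" "\<And>k. d5 \<le> norm (qpoch q q k)"
    using qpoch_qq_lower[OF q1 q0] by blast
  have "norm (w6 q (A*q^n) B C D k) \<le> (1 + norm A) / d4 * ((cA*cB*cC*cD) / (d5*d1*d2*d3)) * (norm (A*q/(B*C*D)) * norm q^n)^k"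
    for n k
  proof -
    have An: "norm (A*q^n) \<le> norm A"
      using q1 by (simp add: norm_mult norm_power mult_left_le power_le_one)
    have "norm (1 - A*q^n*q^(2*k)) \<le> 1 + norm (A*q^n*q^(2*k))"
      using norm_triangle_ineq4[of 1 "A*q^n*q^(2*k)"] by simp
    also have "norm (A*q^n*q^(2*k)) \<le> norm (A*q^n)"
      unfolding norm_mult[of "A*q^n"] norm_power using q1 by (intro mult_left_le power_le_one) auto
    finally have h1: "norm (1 - A*q^n*q^(2*k)) \<le> 1 + norm A" using An by linarith
    have h2: "d4 \<le> norm (1 - A*q^n)" using d4(2)[of n 1] by (simp add: qpoch_Suc[of _ _ 0, simplified])
    have h3: "norm ((1 - A*q^n*q^(2*k)) / (1 - A*q^n)) \<le> (1 + norm A) / d4"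
      using norm_quotient_bound[OF h1 h2 d4(1)] .
    have e: "A*q^n*q/X = A/X*q*q^n" for X by simp
    have h4: "norm ((qpoch q (A*q^n) k * qpoch q B k * qpoch q C k * qpoch q D k)
      / (qpoch q q k * qpoch q (A*q^n*q/B) k * qpoch q (A*q^n*q/C) k * qpoch q (A*q^n*q/D) k))
      \<le> (cA*cB*cC*cD) / (d5*d1*d2*d3)"
      unfolding norm_divide norm_mult e
      using cA cB cC cD d1 d2 d3 d5 An
      by (intro frac_le mult_mono mult_pos_pos mult_nonneg_nonneg) (auto intro: less_imp_le)
    have h5: "norm (A*q^n*q/(B*C*D)) = norm (A*q/(B*C*D)) * norm q^n"
      by (simp add: norm_mult norm_divide norm_power)
    show ?thesis
      unfolding w6_def norm_mult[of "_ * _"] norm_mult[of "_ / _" "_ / _"] norm_power[of "_ / _"] h5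
      using h3 h4 order_trans[OF norm_ge_zero h3] by (intro mult_right_mono mult_mono) auto
  qed
  then show ?thesis using that by blast
qed

lemma w6_sums: "w6 q A B C D sums (\<Sum>k. w6 q A B C D k)"
proof -
  obtain c where "\<And>n k. norm (w6 q (A*q^n) B C D k) \<le> c * (norm (A*q/(B*C*D)) * norm q^n)^k"
    using w6_bound by blast
  from this[of 0] have "norm (w6 q A B C D k) \<le> c * norm (A*q/(B*C*D))^k" for k by simp
  moreover have "summable (\<lambda>k. c * norm (A*q/(B*C*D))^k)"
    using z1 by (intro summable_mult summable_geometric) simp
  ultimately have "summable (w6 q A B C D)"
    by (intro summable_comparison_test[of "w6 q A B C D" "\<lambda>k. c * norm (A*q/(B*C*D))^k"] exI[of _ 0] allI impI)
  then show ?thesis by (rule summable_sums)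
qed

lemma w6_limit: "(\<lambda>n. \<Sum>k. w6 q (A*q^n) B C D k) \<longlonglongrightarrow> 1"
proof -
  obtain c where c: "\<And>n k. norm (w6 q (A*q^n) B C D k) \<le> c * (norm (A*q/(B*C*D)) * norm q^n)^k"
    using w6_bound by blast
  define r where "r = norm (A*q/(B*C*D))"
  have c0: "0 \<le> c" using order_trans[OF norm_ge_zero c[of 0 0]] by simp
  have "norm (w6 q (A*q^n) B C D k) \<le> c * r^k" for n k
  proof -
    have "(r * norm q^n)^k \<le> r^k"
      using q1 by (intro power_mono mult_left_le power_le_one) (auto simp: r_def)
    then have "c * (r * norm q^n)^k \<le> c * r^k" using c0 by (rule mult_left_mono)
    then show ?thesis using c[of n k] unfolding r_def by (rule order_trans[rotated])
  qed
  moreover have "(\<lambda>n. w6 q (A*q^n) B C D k) \<longlonglongrightarrow> (if k = 0 then 1 else 0)" for k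
  proof (cases "k = 0")
    case True
    have "1 - A*q^n \<noteq> 0" for n using generic_factor[OF gA q0] .
    then show ?thesis using True by (simp add: w6_def)
  next
    case False
    have "(\<lambda>n. r * norm q^n) \<longlonglongrightarrow> r * 0"
      by (intro tendsto_intros LIMSEQ_power_zero) (use q1 in simp)
    then have "(\<lambda>n. c * (r * norm q^n)^k) \<longlonglongrightarrow> c * (r * 0)^k"
      by (rule tendsto_mult[OF tendsto_const tendsto_power])
    then have "(\<lambda>n. c * (r * norm q^n)^k) \<longlonglongrightarrow> 0" using False by (simp add: power_0_left)
    then have "(\<lambda>n. w6 q (A*q^n) B C D k) \<longlonglongrightarrow> 0"
    proof (rule Lim_null_comparison[rotated])
      show "\<forall>\<^sub>F n in sequentially. norm (w6 q (A*q^n) B C D k) \<le> c * (r * norm q^n)^k"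
        using c unfolding r_def by (intro always_eventually allI)
    qed
    then show ?thesis using False by simp
  qed
  ultimately have "(\<lambda>n. \<Sum>k. w6 q (A*q^n) B C D k) \<longlonglongrightarrow> (\<Sum>k. if k = 0 then 1 else 0)"
    using z1 by (intro tannery_geometric[where C = c and r = r and N = 0]) (auto simp: r_def)
  moreover have "(\<Sum>k. if k = 0 then 1 else (0::complex)) = 1"
    using sums_If_finite_set[of "{0}" "\<lambda>_. 1::complex"] sums_unique by fastforce
  ultimately show ?thesis by simp
qed

text \<open>Only A moves, to Aq, with B, C, D fixed. The argument gains a factor q at every step, so
  the iteration drives the series to its term k = 0.\<close>

lemma w6_contiguous:
  "(1 - A*q/(B*C*D)) * (\<Sum>k. w6 q A B C D k)
    = (1-A*q/(C*D))*(1-A*q/(B*D))*(1-A*q/(B*C)) * (1-A*q)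
        / ((1-A*q/B)*(1-A*q/C)*(1-A*q/D)) * (\<Sum>k. w6 q (A*q) B C D k)"
proof -
  interpret sh: w6_params q "A*q" B C D using shifted[of 1] by simp
  define z where "z = A*q/(B*C*D)"
  define e1 where "e1 = B + C + D"
  define e2 where "e2 = B*C + B*D + C*D"
  define K where "K = (1-A*q/(C*D))*(1-A*q/(B*D))*(1-A*q/(B*C))"
  define L where "L = (1-A*q) / ((1-A*q/B)*(1-A*q/C)*(1-A*q/D))"
  define G where "G k = - (w6 q A B C D k * ((1-q^k)*(1-A*z*q^k)/(1-A*(q^k)^2)))" for k
  have zB: "z*B = A*q/(C*D)" "z*C = A*q/(B*D)" "z*D = A*q/(B*C)" and ze: "z*(B*C*D) = A*q"
    unfolding z_def using nz by simp_all
  have K: "K = 1-z*e1+z^2*e2-z^2*(A*q)"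
  proof -
    have "K = (1-z*B)*(1-z*C)*(1-z*D)" unfolding K_def zB ..
    also have "\<dots> = 1-z*e1+z^2*e2-z^2*(z*(B*C*D))"
      by (simp add: e1_def e2_def algebra_simps power2_eq_square power3_eq_cube)
    finally show ?thesis unfolding ze .
  qed
  have P: "(1-A*q/B*x)*(1-A*q/C*x)*(1-A*q/D*x) = 1-z*e2*x+z*(A*q)*e1*x^2-z*(A*q)^2*x^3" for x
  proof -
    have e: "A*q/B = z*(C*D)" "A*q/C = z*(B*D)" "A*q/D = z*(B*C)" using nz by (simp_all add: z_def)
    have "(1-A*q/B*x)*(1-A*q/C*x)*(1-A*q/D*x)
      = 1-z*e2*x+z*(z*(B*C*D))*e1*x^2-z*(z*(B*C*D))^2*x^3"
      unfolding e by (simp add: e1_def e2_def algebra_simps power2_eq_square power3_eq_cube)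
    then show ?thesis unfolding ze .
  qed
  have R: "z*((1-B*x)*(1-C*x)*(1-D*x)) = z-z*e1*x+z*e2*x^2-A*q*x^3" for x
  proof -
    have "z*((1-B*x)*(1-C*x)*(1-D*x)) = z-z*e1*x+z*e2*x^2-z*(B*C*D)*x^3"
      by (simp add: e1_def e2_def algebra_simps power2_eq_square power3_eq_cube)
    then show ?thesis unfolding ze .
  qed
  have step: "G (Suc k) - G k = (1-z) * w6 q A B C D k - K*L * w6 q (A*q) B C D k" for k
  proof -
    define x where "x = q^k"
    define t where "t = w6 q A B C D k"
    have gg: "1 - A*q/X*x \<noteq> 0" "qpoch q (A/X*q*q) k \<noteq> 0" "qpoch q (A/X*q) k \<noteq> 0" "1 - A/X*q \<noteq> 0"
       if "generic q (A/X)" for X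
      using generic_factor[OF generic_mult_q[OF that q0] q0, of k]
        generic_qpoch[OF generic_mult_q[OF generic_mult_q[OF that q0] q0] q0, of k]
        generic_qpoch[OF generic_mult_q[OF that q0] q0, of k]
        generic_1[OF generic_mult_q[OF that q0] q0]
      by (auto simp: x_def)
    have n1: "1 - A*x^2 \<noteq> 0" "1 - A \<noteq> 0" "1 - A*q \<noteq> 0"
      using generic_square_factor[OF gA q0] generic_1[OF gA q0] generic_1[OF sh.gA q0] by (auto simp: x_def)
    have n2: "1 - A*(q*x)^2 \<noteq> 0" "1 - q*x \<noteq> 0"
      using generic_square_factor[OF gA q0, of "Suc k"] qpoch_qq_nz[OF q1, of "Suc k"]
      by (auto simp: x_def qpoch_Suc mult_ac)
    define PP where "PP = (1-A*q/B*x)*(1-A*q/C*x)*(1-A*q/D*x)"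
    have PP: "PP \<noteq> 0" using gg[OF gB] gg[OF gC] gg[OF gD] by (simp add: PP_def)
    define RR where "RR = (1-B*x)*(1-C*x)*(1-D*x)"
    have q2: "q^(2*k) = x^2" "q^(2*Suc k) = (q*x)^2"
      unfolding x_def by (metis power_mult mult.commute, metis power_mult mult.commute power_Suc)
    have ts: "w6 q A B C D (Suc k)
      = t * ((1-A*(q*x)^2)/(1-A*x^2) * ((1-A*x)*RR/((1-q*x)*PP)) * z)"
    proof -
      have "w6 q A B C D (Suc k) = (1-A*(q*x)^2)/(1-A)
        * ((qpoch q A k * qpoch q B k * qpoch q C k * qpoch q D k)
          / (qpoch q q k * qpoch q (A*q/B) k * qpoch q (A*q/C) k * qpoch q (A*q/D) k))
        * ((1-A*x)*RR/((1-q*x)*PP)) * (z * z^k)"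
        unfolding w6_def qpoch_Suc q2 RR_def PP_def x_def[symmetric] z_def[symmetric]
        by (simp add: mult_ac)
      then show ?thesis unfolding t_def w6_def q2 z_def[symmetric] using n1 by (simp add: mult_ac)
    qed
    have tp: "w6 q (A*q) B C D k * L = t * (x*(1-A*q*x^2)*(1-A*x)/((1-A*x^2)*PP))"
    proof -
      have sA: "qpoch q (A*q) k = qpoch q A k * (1-A*x)/(1-A)"
        using qpoch_shift[of A q k] n1 by (simp add: x_def field_simps)
      have sX: "qpoch q (A*q*q/X) k = qpoch q (A*q/X) k * (1-A*q/X*x)/(1-A*q/X)" if "generic q (A/X)" for X
        using qpoch_shift[of "A*q/X" q k] gg[OF that] by (simp add: x_def field_simps)
      have zk: "(A*q*q/(B*C*D))^k = x * z^k"
        by (simp add: z_def x_def power_mult_distrib[symmetric] mult_ac)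
      have mono: "m2/m1 * ((a*m3/m * nB * nC * nD) / (Q * (y1*u1/b1) * (y2*u2/b2) * (y3*u3/b3))) * (x * Z)
          * (m1/(b1*b2*b3))
        = m4/m * ((a * nB * nC * nD) / (Q * y1 * y2 * y3)) * Z * (x*m2*m3/(m4*(u1*u2*u3)))"
        if "m1 \<noteq> 0" "m4 \<noteq> 0" "b1 \<noteq> 0" "b2 \<noteq> 0" "b3 \<noteq> 0"
        for m m1 m2 m3 m4 a nB nC nD Q y1 y2 y3 u1 u2 u3 b1 b2 b3 Z :: complex
        using that by simp (simp only: mult_ac)
      show ?thesis
        unfolding w6_def sA sX[OF gB] sX[OF gC] sX[OF gD] zk L_def t_def q2 PP_def z_def[symmetric]
        by (rule mono[OF n1(3) n1(1) gg(4)[OF gB, unfolded times_divide_eq_left] gg(4)[OF gC, unfolded times_divide_eq_left] gg(4)[OF gD, unfolded times_divide_eq_left]])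
    qed
    have Gs: "G (Suc k) = - (t * (z*RR*(1-A*x)*(1-A*q*z*x)/((1-A*x^2)*PP)))"
      unfolding G_def ts using n2 by (simp add: x_def[symmetric] mult_ac)
    have Gk: "G k = - (t * ((1-x)*(1-A*z*x)/(1-A*x^2)))"
      unfolding G_def t_def x_def ..
    have "(1-z)*t - K*(L*w6 q (A*q) B C D k)
      = t * (((1-z)*(1-A*x^2)*PP - K*x*(1-A*q*x^2)*(1-A*x)) / ((1-A*x^2)*PP))"
    proof -
      have "(1-z)*t = t * ((1-z)*(1-A*x^2)*PP / ((1-A*x^2)*PP))" using n1 PP by simp
      moreover have "K*(L*w6 q (A*q) B C D k) = t * (K*x*(1-A*q*x^2)*(1-A*x) / ((1-A*x^2)*PP))"
        using tp by (simp add: mult_ac)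
      ultimately show ?thesis by (simp only: diff_divide_distrib right_diff_distrib)
    qed
    also have "(1-z)*(1-A*x^2)*PP - K*x*(1-A*q*x^2)*(1-A*x)
       = - ((1-A*x)*(z*RR)*(1-A*q*z*x) - (1-x)*PP*(1-A*z*x))"
      unfolding PP_def P K RR_def R by (rule cert6)
    also have "t * (- ((1-A*x)*(z*RR)*(1-A*q*z*x) - (1-x)*PP*(1-A*z*x)) / ((1-A*x^2)*PP)) = G (Suc k) - G k"
    proof -
      have "(1-x)*PP*(1-A*z*x) / ((1-A*x^2)*PP) = (1-x)*(1-A*z*x)/(1-A*x^2)" using PP by simp
      then show ?thesis unfolding Gs Gk by (simp add: diff_divide_distrib right_diff_distrib mult_ac)
    qed
    finally show ?thesis unfolding t_def by (simp add: mult_ac)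
  qed
  have "(\<lambda>k. G (Suc k) - G k) sums ((1-z) * (\<Sum>k. w6 q A B C D k) - K*L * (\<Sum>k. w6 q (A*q) B C D k))"
    unfolding step by (intro sums_diff sums_mult w6_sums sh.w6_sums)
  moreover have "(\<lambda>k. G (Suc k) - G k) sums (0 - G 0)"
  proof (rule telescope_sums)
    have qk: "(\<lambda>k. q^k) \<longlonglongrightarrow> 0" using q1 by (rule LIMSEQ_power_zero)
    have "w6 q A B C D \<longlonglongrightarrow> 0" using w6_sums summable_LIMSEQ_zero sums_summable by blast
    then have "G \<longlonglongrightarrow> - (0 * ((1-0)*(1-A*z*0)/(1-A*0^2)))"
      unfolding G_def by (intro tendsto_intros qk) auto
    then show "G \<longlonglongrightarrow> 0" by simp
  qed
  ultimately have "(1-z) * (\<Sum>k. w6 q A B C D k) - K*L * (\<Sum>k. w6 q (A*q) B C D k) = 0 - G 0"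
    using sums_unique2 by blast
  then show ?thesis unfolding K_def L_def z_def G_def by simp
qed

text \<open>Rogers' nonterminating 6phi5 sum. The product side obeys the same recurrence in A
  because each infinite product sheds its first factor.\<close>

theorem w6_sum:
  "(\<Sum>k. w6 q A B C D k) = qinf q (A*q) * qinf q (A*q/(C*D)) * qinf q (A*q/(B*D)) * qinf q (A*q/(B*C))
    / (qinf q (A*q/B) * qinf q (A*q/C) * qinf q (A*q/D) * qinf q (A*q/(B*C*D)))"
proof -
  define g where "g n = qinf q (A*q*q^n) * qinf q (A*q/(C*D)*q^n) * qinf q (A*q/(B*D)*q^n) * qinf q (A*q/(B*C)*q^n)
    / (qinf q (A*q/B*q^n) * qinf q (A*q/C*q^n) * qinf q (A*q/D*q^n) * qinf q (A*q/(B*C*D)*q^n))" for n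
  define f where "f n = (\<Sum>k. w6 q (A*q^n) B C D k)" for n
  define r where "r n = (1-A*q*q^n)*(1-A*q/(C*D)*q^n)*(1-A*q/(B*D)*q^n)*(1-A*q/(B*C)*q^n)
        / ((1-A*q/B*q^n)*(1-A*q/C*q^n)*(1-A*q/D*q^n)*(1-A*q/(B*C*D)*q^n))" for n
  have "f 0 = g 0"
  proof (rule iterate_limit[where f = f and g = g and r = r])
    fix n
    interpret n: w6_params q "A*q^n" B C D by (rule shifted)
    have z: "1 - A*q^n*q/(B*C*D) \<noteq> 0" using n.z1 by auto
    have "(1 - A*q^n*q/(B*C*D)) * f n = (1-A*q^n*q/(C*D))*(1-A*q^n*q/(B*D))*(1-A*q^n*q/(B*C)) * (1-A*q^n*q)
        / ((1-A*q^n*q/B)*(1-A*q^n*q/C)*(1-A*q^n*q/D)) * f (Suc n)"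
      using n.w6_contiguous by (simp add: f_def mult_ac)
    then have "f n = (1-A*q^n*q/(C*D))*(1-A*q^n*q/(B*D))*(1-A*q^n*q/(B*C)) * (1-A*q^n*q)
        / ((1-A*q^n*q/B)*(1-A*q^n*q/C)*(1-A*q^n*q/D)) * f (Suc n) / (1 - A*q^n*q/(B*C*D))"
      using nonzero_eq_divide_eq[OF z] mult.commute by metis
    then show "f n = r n * f (Suc n)"
      by (simp only: r_def mult_ac times_divide_eq_left times_divide_eq_right divide_divide_eq_left)
    have s: "qinf q (x*q^n) = (1-x*q^n) * qinf q (x*q^Suc n)" for x
      using qinf_rec[OF q1, of "x*q^n"] by (simp add: mult_ac)
    show "g n = r n * g (Suc n)"
      unfolding g_def r_def s[of "A*q"] s[of "A*q/(C*D)"] s[of "A*q/(B*D)"] s[of "A*q/(B*C)"]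
        s[of "A*q/B"] s[of "A*q/C"] s[of "A*q/D"] s[of "A*q/(B*C*D)"] by (simp only: mult_ac times_divide_times_eq)
  next
    show "f \<longlonglongrightarrow> 1" unfolding f_def by (rule w6_limit)
    have "g \<longlonglongrightarrow> 1*1*1*1/(1*1*1*1)"
      unfolding g_def by (intro tendsto_intros qinf_power_tendsto_1 q1) auto
    then show "g \<longlonglongrightarrow> 1" by simp
  qed simp
  then show ?thesis by (simp add: f_def g_def)
qed

end

subsection \<open>The \<open>q\<close>-binomial theorem\<close>

lemma binom_term_bound:
  assumes "q \<noteq> 0" "norm q < 1"
  obtains c where "c \<ge> 0" "\<And>k z. norm (qpoch q p k / qpoch q q k * z^k) \<le> c * norm z^k"
proof -
  obtain c where c: "c > 0" "\<And>y k. norm y \<le> norm p \<Longrightarrow> norm (qpoch q y k) \<le> c"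
    using qpoch_upper[OF assms(2)] by blast
  obtain d where d: "d > 0" "\<And>k. d \<le> norm (qpoch q q k)"
    using qpoch_qq_lower[OF assms(2,1)] by blast
  have "norm (qpoch q p k / qpoch q q k * z^k) \<le> c / d * norm z^k" for k z
    unfolding norm_mult norm_power
    using norm_quotient_bound[OF c(2)[of p] d(2) d(1)] by (intro mult_right_mono) auto
  then show ?thesis using c d that[of "c / d"] by simp
qed

lemma binom_sums:
  assumes "q \<noteq> 0" "norm q < 1" "norm z < 1"
  shows "(\<lambda>k. qpoch q p k / qpoch q q k * z^k) sums (\<Sum>k. qpoch q p k / qpoch q q k * z^k)"
proof -
  obtain c where "\<And>k z. norm (qpoch q p k / qpoch q q k * z^k) \<le> c * norm z^k"
    using binom_term_bound[OF assms(1,2)] by blast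
  moreover have "summable (\<lambda>k. c * norm z^k)"
    using assms(3) by (intro summable_mult summable_geometric) simp
  ultimately have "summable (\<lambda>k. qpoch q p k / qpoch q q k * z^k)"
    by (intro summable_comparison_test[of "\<lambda>k. qpoch q p k / qpoch q q k * z^k" "\<lambda>k. c * norm z^k"] exI[of _ 0] allI impI)
  then show ?thesis by (rule summable_sums)
qed

text \<open>The functional equation under z -> zq comes from the coefficients, (1 - q^(k+1)) c_(k+1)
  = (1 - p q^k) c_k, and both sides tend to 1 as z is iterated to 0.\<close>

theorem qbinomial:
  assumes q0: "q \<noteq> 0" and q1: "norm q < 1" and z: "norm z < 1"
  shows "(\<Sum>k. qpoch q p k / qpoch q q k * z^k) = qinf q (p*z) / qinf q z"
proof -
  define F where "F z = (\<Sum>k. qpoch q p k / qpoch q q k * z^k)" for z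
  have zn: "norm (z*q^n) < 1" for n
  proof -
    have "norm z * norm q^n \<le> norm z" using q1 by (intro mult_left_le power_le_one) auto
    then show ?thesis using z by (simp add: norm_mult norm_power)
  qed
  have rec: "F w = (1-p*w)/(1-w) * F (w*q)" if w: "norm w < 1" "norm (w*q) < 1" for w
  proof -
    let ?c = "\<lambda>k. qpoch q p k / qpoch q q k"
    have s1: "(\<lambda>k. ?c k * w^k) sums F w" and s2: "(\<lambda>k. ?c k * (w*q)^k) sums F (w*q)"
      unfolding F_def using binom_sums[OF q0 q1] w by blast+
    have "(\<lambda>k. ?c k * w^k - ?c k * (w*q)^k) sums (F w - F (w*q))"
      by (intro sums_diff s1 s2)
    then have "(\<lambda>k. ?c (Suc k) * w^Suc k - ?c (Suc k) * (w*q)^Suc k) sums (F w - F (w*q))"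
      by (subst sums_Suc_iff) simp
    moreover have "?c (Suc k) * w^Suc k - ?c (Suc k) * (w*q)^Suc k = w * (?c k * w^k) - p*w * (?c k * (w*q)^k)" for k
    proof -
      have n: "1 - q*q^k \<noteq> 0" using qpoch_qq_nz[OF q1, of "Suc k"] by (simp add: qpoch_Suc)
      have "?c (Suc k) = ?c k * (1-p*q^k)/(1-q*q^k)" by (simp add: qpoch_Suc)
      then have c: "?c (Suc k) * (1-q*q^k) = ?c k * (1-p*q^k)" using n by simp
      have "C * w^Suc k - C * (w*q)^Suc k = C * (1-q*q^k) * w^Suc k" for C
        by (simp add: power_mult_distrib algebra_simps)
      then have "?c (Suc k) * w^Suc k - ?c (Suc k) * (w*q)^Suc k = ?c (Suc k) * (1-q*q^k) * w^Suc k" .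
      also have "\<dots> = ?c k * (1-p*q^k) * w^Suc k" unfolding c ..
      also have "\<dots> = w * (?c k * w^k) - p*w * (?c k * (w*q)^k)"
        by (simp only: power_mult_distrib power_Suc right_diff_distrib left_diff_distrib mult_1_left mult_1_right mult_ac)
      finally show ?thesis .
    qed
    ultimately have "(\<lambda>k. w * (?c k * w^k) - p*w * (?c k * (w*q)^k)) sums (F w - F (w*q))" by simp
    moreover have "(\<lambda>k. w * (?c k * w^k) - p*w * (?c k * (w*q)^k)) sums (w * F w - p*w * F (w*q))"
      by (intro sums_diff sums_mult s1 s2)
    ultimately have "F w - F (w*q) = w * F w - p*w * F (w*q)" by (rule sums_unique2)
    then have "(1-w) * F w = (1-p*w) * F (w*q)" by (simp add: algebra_simps)
    moreover have "1 - w \<noteq> 0" using w by auto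
    ultimately show ?thesis by (simp add: field_simps)
  qed
  define g where "g n = qinf q (p*z*q^n) / qinf q (z*q^n)" for n
  have "F (z*q^0) = g 0"
  proof (rule iterate_limit[where f = "\<lambda>n. F (z*q^n)" and g = g and r = "\<lambda>n. (1-p*(z*q^n))/(1-z*q^n)"])
    fix n
    show "F (z*q^n) = (1-p*(z*q^n))/(1-z*q^n) * F (z*q^Suc n)"
      using rec[OF zn[of n]] zn[of "Suc n"] by (simp add: mult_ac)
    have e: "qinf q (x*q^n) = (1-x*q^n) * qinf q (x*q^Suc n)" for x
      using qinf_rec[OF q1, of "x*q^n"] by (simp add: mult_ac)
    show "g n = (1-p*(z*q^n))/(1-z*q^n) * g (Suc n)"
      unfolding g_def e[of "p*z"] e[of z] by (simp only: mult_ac times_divide_times_eq)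
  next
    obtain c where c: "c \<ge> 0" "\<And>k z. norm (qpoch q p k / qpoch q q k * z^k) \<le> c * norm z^k"
      using binom_term_bound[OF q0 q1] by blast
    have "(\<lambda>n. F (z*q^n)) \<longlonglongrightarrow> (\<Sum>k. if k = 0 then 1 else 0)"
      unfolding F_def
    proof (rule tannery_geometric[where C = c and r = "norm z" and N = 0])
      fix k
      show "(\<lambda>n. qpoch q p k / qpoch q q k * (z*q^n)^k) \<longlonglongrightarrow> (if k = 0 then 1 else 0)"
      proof (cases "k = 0")
        case False
        have "(\<lambda>n. z*q^n) \<longlonglongrightarrow> z*0"
          by (rule tendsto_mult[OF tendsto_const LIMSEQ_power_zero[OF q1]])
        then have "(\<lambda>n. qpoch q p k / qpoch q q k * (z*q^n)^k) \<longlonglongrightarrow> qpoch q p k / qpoch q q k * (z*0)^k"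
          by (rule tendsto_mult[OF tendsto_const tendsto_power])
        then show ?thesis using False by (simp add: power_0_left)
      qed simp
      fix n
      have "norm (z*q^n)^k \<le> norm z^k"
        unfolding norm_mult norm_power using q1 by (intro power_mono mult_left_le power_le_one) auto
      then have "c * norm (z*q^n)^k \<le> c * norm z^k" using c(1) by (rule mult_left_mono)
      then show "norm (qpoch q p k / qpoch q q k * (z*q^n)^k) \<le> c * norm z^k"
        using c(2)[of k "z*q^n"] by (rule order_trans[rotated])
    qed (use z in auto)
    moreover have "(\<Sum>k. if k = 0 then 1 else (0::complex)) = 1"
      using sums_If_finite_set[of "{0}" "\<lambda>_. 1::complex"] sums_unique by fastforce
    ultimately show "(\<lambda>n. F (z*q^n)) \<longlonglongrightarrow> 1" by simp
    have "g \<longlonglongrightarrow> 1/1"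
      unfolding g_def by (intro tendsto_divide qinf_power_tendsto_1 q1) auto
    then show "g \<longlonglongrightarrow> 1" by simp
  qed simp
  then show ?thesis by (simp add: F_def g_def)
qed

section \<open>The limit of the Casoratian\<close>

text \<open>(x/q^n)_k grows with n. Reversing its factors isolates the growth in (-x)^k times a
  product independent of x, which cancels in quotients; the remaining factorials have the fixed
  argument q/x and are bounded.\<close>

lemma qpoch_reflect:
  assumes "q \<noteq> 0" "x \<noteq> 0" "k \<le> n"
  shows "qpoch q (x/q^n) k * qpoch q (q/x) (n-k) = (-x)^k * (\<Prod>j<k. q^j/q^n) * qpoch q (q/x) n"
  using assms(3)
proof (induction k)
  case (Suc k)
  have nk: "n - k = Suc (n - Suc k)" using Suc by simp
  have e: "1 - x/q^n*q^k = - x * (q^k/q^n) * (1 - q/x*q^(n - Suc k))"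
  proof -
    have "q^n = q^k * (q * q^(n - Suc k))"
      using Suc by (simp add: power_add[symmetric] power_Suc[symmetric] del: power_Suc)
    then show ?thesis using assms by (simp add: field_simps)
  qed
  have "qpoch q (q/x) (n-k) = qpoch q (q/x) (n - Suc k) * (1 - q/x*q^(n - Suc k))"
    unfolding nk qpoch_Suc ..
  then have "qpoch q (x/q^n) (Suc k) * qpoch q (q/x) (n - Suc k)
    = qpoch q (x/q^n) k * qpoch q (q/x) (n-k) * (- x * (q^k/q^n))"
    unfolding qpoch_Suc e by (simp only: mult_ac)
  also have "\<dots> = (-x)^k * (\<Prod>j<k. q^j/q^n) * qpoch q (q/x) n * (- x * (q^k/q^n))"
    using Suc by simp
  finally show ?case by (simp add: mult_ac)
qed simp

text \<open>After reflection the quotient is (x/y)^k times bounded factors, so |x| <= |y| is the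
  natural condition. This covers k <= n; for larger k the factorials split at n, and the tails (x)_m
  and (y)_m no longer involve n.\<close>

lemma qpoch_quotient_bound:
  assumes "q \<noteq> 0" "norm q < 1" "generic q x" "generic q y" "norm x \<le> norm y"
  obtains C where "C > 0" "\<And>n k. norm (qpoch q (x/q^n) k / qpoch q (y/q^n) k) \<le> C"
proof -
  have gi: "generic q (q/w)" if "generic q w" for w
    using generic_mult_q[OF generic_inverse[OF that assms(1)] assms(1)] by simp
  obtain cx where cx: "cx > 0" "\<And>w k. norm w \<le> norm (q/x) \<Longrightarrow> norm (qpoch q w k) \<le> cx"
    using qpoch_upper[OF assms(2)] by blast
  obtain cy where cy: "cy > 0" "\<And>w k. norm w \<le> norm (q/y) \<Longrightarrow> norm (qpoch q w k) \<le> cy"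
    using qpoch_upper[OF assms(2)] by blast
  obtain ca where ca: "ca > 0" "\<And>w k. norm w \<le> norm x \<Longrightarrow> norm (qpoch q w k) \<le> ca"
    using qpoch_upper[OF assms(2)] by blast
  obtain dx where dx: "dx > 0" "\<And>n k. dx \<le> norm (qpoch q (q/x*q^n) k)"
    using qpoch_lower[OF assms(2,1) gi[OF assms(3)]] by blast
  obtain dy where dy: "dy > 0" "\<And>n k. dy \<le> norm (qpoch q (q/y*q^n) k)"
    using qpoch_lower[OF assms(2,1) gi[OF assms(4)]] by blast
  obtain da where da: "da > 0" "\<And>n k. da \<le> norm (qpoch q (y*q^n) k)"
    using qpoch_lower[OF assms(2,1) assms(4)] by blast
  have nz: "x \<noteq> 0" "y \<noteq> 0" using assms by (auto simp: generic_def)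
  have p1: "norm ((-x)^k / (-y)^k) \<le> 1" for k
    using assms(5) nz by (simp add: norm_divide norm_power power_mono)
  have small: "norm (qpoch q (x/q^n) k / qpoch q (y/q^n) k) \<le> (cx/dx)*(cy/dy)" if "k \<le> n" for n k
  proof -
    define P where "P = (\<Prod>j<k. q^j/q^n)"
    have P: "P \<noteq> 0" using assms(1) by (simp add: P_def)
    have qx: "qpoch q (q/x) m \<noteq> 0" and qy: "qpoch q (q/y) m \<noteq> 0" for m
      using gi assms generic_qpoch by blast+
    have ex: "qpoch q (x/q^n) k = (-x)^k * P * qpoch q (q/x) n / qpoch q (q/x) (n-k)"
      using qpoch_reflect[OF assms(1) nz(1) that] qx[of "n-k"] by (simp add: P_def eq_divide_eq)
    have ey: "qpoch q (y/q^n) k = (-y)^k * P * qpoch q (q/y) n / qpoch q (q/y) (n-k)"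
      using qpoch_reflect[OF assms(1) nz(2) that] qy[of "n-k"] by (simp add: P_def eq_divide_eq)
    have "qpoch q (x/q^n) k / qpoch q (y/q^n) k
      = ((-x)^k / (-y)^k) * ((qpoch q (q/x) n / qpoch q (q/x) (n-k)) * (qpoch q (q/y) (n-k) / qpoch q (q/y) n))"
    proof -
      have "(X*P*a/b) / (Y*P*a'/b') = (X/Y) * ((a/b)*(b'/a'))" for X Y a b a' b' :: complex
        using P by simp
      then show ?thesis unfolding ex ey .
    qed
    also have "norm \<dots> \<le> 1 * ((cx/dx)*(cy/dy))"
      unfolding norm_mult[of "_ / _"]
      using norm_quotient_bound[OF cx(2)[OF order_refl] _ dx(1), of "qpoch q (q/x) (n-k)" n] dx(2)[of 0]
        norm_quotient_bound[OF cy(2)[OF order_refl] _ dy(1), of "qpoch q (q/y) n" "n-k"] dy(2)[of 0]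
        p1 cx(1) dx(1) cy(1) dy(1)
      by (intro mult_mono) (auto intro!: divide_nonneg_nonneg mult_nonneg_nonneg)
    finally show ?thesis by simp
  qed
  \<comment> \<open>The summand 1 serves k <= n, the summand ca/da the tail for k > n.\<close>
  define C where "C = (cx/dx)*(cy/dy) * (1 + ca/da)"
  have pos: "(cx/dx)*(cy/dy) > 0" "ca/da > 0" using cx dx cy dy ca da by auto
  have "norm (qpoch q (x/q^n) k / qpoch q (y/q^n) k) \<le> C" for n k
  proof (cases "k \<le> n")
    case True
    have "(cx/dx)*(cy/dy) \<le> C" unfolding C_def using pos mult_left_mono[of 1 "1 + ca/da" "(cx/dx)*(cy/dy)"] by linarith
    then show ?thesis using small[OF True] by linarith
  next
    case False
    then obtain m where k: "k = n + m" using le_Suc_ex nat_le_linear by blast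
    have e: "qpoch q (w/q^n) k = qpoch q (w/q^n) n * qpoch q w m" for w
      unfolding k qpoch_add using assms(1) by simp
    have "norm (qpoch q x m / qpoch q y m) \<le> ca/da"
      using norm_quotient_bound[OF ca(2)[OF order_refl] _ da(1)] da(2)[of 0] by simp
    then have "norm (qpoch q x m / qpoch q y m) \<le> 1 + ca/da" by linarith
    then have "norm (qpoch q (x/q^n) n / qpoch q (y/q^n) n) * norm (qpoch q x m / qpoch q y m) \<le> C"
      unfolding C_def using small[of n n] pos by (intro mult_mono) auto
    moreover have "qpoch q (x/q^n) k / qpoch q (y/q^n) k
       = (qpoch q (x/q^n) n / qpoch q (y/q^n) n) * (qpoch q x m / qpoch q y m)"
      unfolding e by simp
    ultimately show ?thesis by (simp only: norm_mult)
  qed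
  moreover have "C > 0" unfolding C_def by (rule mult_pos_pos[OF pos(1)]) (use pos in simp)
  ultimately show ?thesis using that by blast
qed

text \<open>These powers (x/y)^k are what changes the argument of the series in the limit.\<close>

lemma qpoch_quotient_limit:
  assumes "q \<noteq> 0" "norm q < 1" "y \<noteq> 0"
  shows "(\<lambda>n. qpoch q (x/q^n) k / qpoch q (y/q^n) k) \<longlonglongrightarrow> (x/y)^k"
proof -
  have "qpoch q (x/q^n) k / qpoch q (y/q^n) k = (\<Prod>j<k. (q^n - x*q^j) / (q^n - y*q^j))" for n
  proof -
    have "(1 - x/q^n*q^j) / (1 - y/q^n*q^j) = (q^n - x*q^j) / (q^n - y*q^j)" for j
    proof -
      have "1 - w/q^n*q^j = (q^n - w*q^j)/q^n" for w using assms(1) by (simp add: field_simps)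
      then show ?thesis using assms(1) by simp
    qed
    then show ?thesis unfolding qpoch_def prod_dividef[symmetric] by simp
  qed
  moreover have "(\<lambda>n. \<Prod>j<k. (q^n - x*q^j) / (q^n - y*q^j)) \<longlonglongrightarrow> (\<Prod>j<k. (0 - x*q^j) / (0 - y*q^j))"
    using assms by (intro tendsto_intros LIMSEQ_power_zero) auto
  moreover have "(\<Prod>j<k. (0 - x*q^j) / (0 - y*q^j)) = (x/y)^k"
    using assms by simp
  ultimately show ?thesis by simp
qed

text \<open>One parameter tends to 0, another to infinity, with fixed product. The growing factorial
  is paired with the growing lower one, (p5/q^n)_k against (Aq/(p4 q^n))_k, and contributes (p4
  p5/(Aq))^k, which \<open>ze\<close> combines with \<open>z\<close> into the 6W5 argument; the
  other pair tends to 1. \<open>le\<close> is the condition of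
  \<open>qpoch_quotient_bound\<close>.\<close>

lemma vser_limit_6:
  assumes q0: "q \<noteq> 0" and q1: "norm q < 1" and gA: "generic q A"
    and g: "generic q (A/B)" "generic q (A/C)" "generic q (A/D)" "generic q (A/p4)" "generic q (A/p5)"
    and gp: "generic q p5" and z: "norm z < 1" and le: "norm (p4*p5) \<le> norm (A*q)"
    and ze: "z*p4*p5/(A*q) = A*q/(B*C*D)"
  shows "(\<lambda>n. vser q A B C D (p4*q^n) (p5/q^n) z) \<longlonglongrightarrow> (\<Sum>k. w6 q A B C D k)"
  unfolding vser_def
proof -
  have nz: "A \<noteq> 0" "B \<noteq> 0" "C \<noteq> 0" "D \<noteq> 0" "p4 \<noteq> 0" "p5 \<noteq> 0"
    using gA g gp by (auto simp: generic_def)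
  have g': "generic q (A*q/X)" if "generic q (A/X)" for X using generic_mult_q[OF that q0] by simp
  define H where "H k = (1 - A*q^(2*k))/(1-A)
    * ((qpoch q A k * qpoch q B k * qpoch q C k * qpoch q D k)
      / (qpoch q q k * qpoch q (A*q/B) k * qpoch q (A*q/C) k * qpoch q (A*q/D) k))" for k
  define u where "u n k = qpoch q (p5/q^n) k / qpoch q (A*q/p4/q^n) k" for n k
  define w where "w n k = qpoch q (p4*q^n) k / qpoch q (A*q/p5*q^n) k" for n k
  have v: "vterm q A B C D (p4*q^n) (p5/q^n) z k = H k * u n k * w n k * z^k" for n k
  proof -
    have e: "A*q/(p4*q^n) = A*q/p4/q^n" "A*q/(p5/q^n) = A*q/p5*q^n" by simp_all
    show ?thesis unfolding vterm_def H_def u_def w_def e by (simp add: mult_ac)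
  qed
  obtain cA where cA: "cA > 0" "\<And>y k. norm y \<le> norm A \<Longrightarrow> norm (qpoch q y k) \<le> cA"
    using qpoch_upper[OF q1] by blast
  obtain cB where cB: "cB > 0" "\<And>y k. norm y \<le> norm B \<Longrightarrow> norm (qpoch q y k) \<le> cB"
    using qpoch_upper[OF q1] by blast
  obtain cC where cC: "cC > 0" "\<And>y k. norm y \<le> norm C \<Longrightarrow> norm (qpoch q y k) \<le> cC"
    using qpoch_upper[OF q1] by blast
  obtain cD where cD: "cD > 0" "\<And>y k. norm y \<le> norm D \<Longrightarrow> norm (qpoch q y k) \<le> cD"
    using qpoch_upper[OF q1] by blast
  obtain c4 where c4: "c4 > 0" "\<And>y k. norm y \<le> norm p4 \<Longrightarrow> norm (qpoch q y k) \<le> c4"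
    using qpoch_upper[OF q1] by blast
  obtain d1 where d1: "d1 > 0" "\<And>n k. d1 \<le> norm (qpoch q (A*q/B*q^n) k)"
    using qpoch_lower[OF q1 q0 g'[OF g(1)]] by blast
  obtain d2 where d2: "d2 > 0" "\<And>n k. d2 \<le> norm (qpoch q (A*q/C*q^n) k)"
    using qpoch_lower[OF q1 q0 g'[OF g(2)]] by blast
  obtain d3 where d3: "d3 > 0" "\<And>n k. d3 \<le> norm (qpoch q (A*q/D*q^n) k)"
    using qpoch_lower[OF q1 q0 g'[OF g(3)]] by blast
  obtain d4 where d4: "d4 > 0" "\<And>n k. d4 \<le> norm (qpoch q (A*q/p5*q^n) k)"
    using qpoch_lower[OF q1 q0 g'[OF g(5)]] by blast
  obtain d5 where d5: "d5 > 0" "\<And>k. d5 \<le> norm (qpoch q q k)"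
    using qpoch_qq_lower[OF q1 q0] by blast
  have "norm p5 \<le> norm (A*q/p4)"
    using le nz by (simp add: norm_mult norm_divide field_simps)
  then obtain cu where cu: "cu > 0" "\<And>n k. norm (u n k) \<le> cu"
    unfolding u_def using qpoch_quotient_bound[OF q0 q1 gp g'[OF g(4)]] by blast
  define CH where "CH = (1 + norm A) / norm (1-A) * ((cA*cB*cC*cD) / (d5*d1*d2*d3))"
  have H: "norm (H k) \<le> CH" for k
  proof -
    have "norm (1 - A*q^(2*k)) \<le> 1 + norm (A*q^(2*k))"
      using norm_triangle_ineq4[of 1 "A*q^(2*k)"] by simp
    also have "norm (A*q^(2*k)) \<le> norm A"
      unfolding norm_mult[of A] norm_power using q1 by (intro mult_left_le power_le_one) auto
    finally have h1: "norm ((1 - A*q^(2*k))/(1-A)) \<le> (1 + norm A) / norm (1-A)"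
      unfolding norm_divide by (intro divide_right_mono) auto
    have h4: "norm ((qpoch q A k * qpoch q B k * qpoch q C k * qpoch q D k)
      / (qpoch q q k * qpoch q (A*q/B) k * qpoch q (A*q/C) k * qpoch q (A*q/D) k))
      \<le> (cA*cB*cC*cD) / (d5*d1*d2*d3)"
      unfolding norm_divide norm_mult
      using cA cB cC cD d1(1) d2(1) d3(1) d5 d1(2)[of 0] d2(2)[of 0] d3(2)[of 0]
      by (intro frac_le mult_mono mult_pos_pos mult_nonneg_nonneg) (auto intro: less_imp_le)
    show ?thesis unfolding H_def CH_def norm_mult[of "_ / _"]
      using h1 h4 order_trans[OF norm_ge_zero h1] by (intro mult_mono) auto
  qed
  have w: "norm (w n k) \<le> c4/d4" for n k
    unfolding w_def
  proof (rule norm_quotient_bound[OF c4(2) d4(2) d4(1)])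
    show "norm (p4*q^n) \<le> norm p4"
      using q1 by (simp add: norm_mult norm_power mult_left_le power_le_one)
  qed
  have CH: "0 \<le> CH" using order_trans[OF norm_ge_zero H] .
  have b: "norm (vterm q A B C D (p4*q^n) (p5/q^n) z k) \<le> CH * cu * (c4/d4) * norm z^k" for n k
    unfolding v norm_mult norm_power
    using H[of k] cu w[of n k] c4(1) d4(1) CH by (intro mult_mono mult_nonneg_nonneg) (auto intro: less_imp_le)
  have l: "(\<lambda>n. vterm q A B C D (p4*q^n) (p5/q^n) z k) \<longlonglongrightarrow> w6 q A B C D k" for k
  proof -
    have "(\<lambda>n. H k * u n k * w n k * z^k) \<longlonglongrightarrow> H k * (p5/(A*q/p4))^k * (1/1) * z^k"
      unfolding u_def w_def
      using nz q0 by (intro tendsto_intros qpoch_quotient_limit qpoch_shift_tendsto_1 q0 q1) auto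
    moreover have "H k * (p5/(A*q/p4))^k * (1/1) * z^k = w6 q A B C D k"
    proof -
      have "H k * (p5/(A*q/p4))^k * (1/1) * z^k = H k * (z*p4*p5/(A*q))^k"
        by (simp add: power_mult_distrib power_divide)
      then show ?thesis unfolding ze by (simp only: H_def w6_def)
    qed
    ultimately show ?thesis unfolding v by (simp only:)
  qed
  show "(\<lambda>n. \<Sum>k. vterm q A B C D (p4*q^n) (p5/q^n) z k) \<longlonglongrightarrow> (\<Sum>k. w6 q A B C D k)"
    by (rule tannery_geometric[OF l b]) (use z in auto)
qed

text \<open>The scaling sends every upper parameter except \<open>p\<close>, and every lower one
  except the base q, to 0, while the argument is untouched; only (p)_k/(q)_k survives.\<close>

lemma vser_limit_binomial:
  assumes q0: "q \<noteq> 0" and q1: "norm q < 1" and gA: "generic q A"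
    and g: "generic q (A/p1)" "generic q (A/p2)" "generic q (A/p3)" "generic q (A/p4)" "generic q (A/p)"
    and z: "norm z < 1"
  shows "(\<lambda>n. vser q (A*q^(2*n)) (p1*q^n) (p2*q^n) (p3*q^n) (p4*q^n) p z)
    \<longlonglongrightarrow> (\<Sum>k. qpoch q p k / qpoch q q k * z^k)"
  unfolding vser_def
proof -
  have g': "generic q (A*q/X)" if "generic q (A/X)" for X using generic_mult_q[OF that q0] by simp
  have v: "vterm q (A*q^(2*n)) (p1*q^n) (p2*q^n) (p3*q^n) (p4*q^n) p z k
    = (1 - A*q^(2*k)*q^(2*n)) / (1 - A*q^(2*n))
      * ((qpoch q (A*q^(2*n)) k * qpoch q (p1*q^n) k * qpoch q (p2*q^n) k * qpoch q (p3*q^n) k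
           * qpoch q (p4*q^n) k)
        / (qpoch q (A*q/p1*q^n) k * qpoch q (A*q/p2*q^n) k * qpoch q (A*q/p3*q^n) k * qpoch q (A*q/p4*q^n) k
           * qpoch q (A*q/p*q^(2*n)) k))
      * (qpoch q p k / qpoch q q k * z^k)" for n k
  proof -
    have e: "A*q^(2*n)*q/(X*q^n) = A*q/X*q^n" "A*q^(2*n)*q/X = A*q/X*q^(2*n)" for X
      using q0 by (simp_all add: mult_2 power_add)
    show ?thesis unfolding vterm_def e(1) unfolding e(2) by (simp add: mult_ac)
  qed
  obtain c where c: "c \<ge> 0" "\<And>k z. norm (qpoch q p k / qpoch q q k * z^k) \<le> c * norm z^k"
    using binom_term_bound[OF q0 q1] by blast
  obtain cA where cA: "cA > 0" "\<And>y k. norm y \<le> norm A \<Longrightarrow> norm (qpoch q y k) \<le> cA"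
    using qpoch_upper[OF q1] by blast
  obtain c1 where c1: "c1 > 0" "\<And>y k. norm y \<le> norm p1 \<Longrightarrow> norm (qpoch q y k) \<le> c1"
    using qpoch_upper[OF q1] by blast
  obtain c2 where c2: "c2 > 0" "\<And>y k. norm y \<le> norm p2 \<Longrightarrow> norm (qpoch q y k) \<le> c2"
    using qpoch_upper[OF q1] by blast
  obtain c3 where c3: "c3 > 0" "\<And>y k. norm y \<le> norm p3 \<Longrightarrow> norm (qpoch q y k) \<le> c3"
    using qpoch_upper[OF q1] by blast
  obtain c4 where c4: "c4 > 0" "\<And>y k. norm y \<le> norm p4 \<Longrightarrow> norm (qpoch q y k) \<le> c4"
    using qpoch_upper[OF q1] by blast
  obtain d1 where d1: "d1 > 0" "\<And>n k. d1 \<le> norm (qpoch q (A*q/p1*q^n) k)"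
    using qpoch_lower[OF q1 q0 g'[OF g(1)]] by blast
  obtain d2 where d2: "d2 > 0" "\<And>n k. d2 \<le> norm (qpoch q (A*q/p2*q^n) k)"
    using qpoch_lower[OF q1 q0 g'[OF g(2)]] by blast
  obtain d3 where d3: "d3 > 0" "\<And>n k. d3 \<le> norm (qpoch q (A*q/p3*q^n) k)"
    using qpoch_lower[OF q1 q0 g'[OF g(3)]] by blast
  obtain d4 where d4: "d4 > 0" "\<And>n k. d4 \<le> norm (qpoch q (A*q/p4*q^n) k)"
    using qpoch_lower[OF q1 q0 g'[OF g(4)]] by blast
  obtain d5 where d5: "d5 > 0" "\<And>n k. d5 \<le> norm (qpoch q (A*q/p*q^n) k)"
    using qpoch_lower[OF q1 q0 g'[OF g(5)]] by blast
  obtain d6 where d6: "d6 > 0" "\<And>n k. d6 \<le> norm (qpoch q (A*q^n) k)"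
    using qpoch_lower[OF q1 q0 gA] by blast
  define C where "C = (1 + norm A) / d6 * ((cA*c1*c2*c3*c4) / (d1*d2*d3*d4*d5))"
  have sm: "norm (x*q^m) \<le> norm x" for x m
    using q1 by (simp add: norm_mult norm_power mult_left_le power_le_one)
  have b: "norm (vterm q (A*q^(2*n)) (p1*q^n) (p2*q^n) (p3*q^n) (p4*q^n) p z k) \<le> C * c * norm z^k" for n k
  proof -
    have "norm (1 - A*q^(2*k)*q^(2*n)) \<le> 1 + norm (A*q^(2*k)*q^(2*n))"
      using norm_triangle_ineq4[of 1 "A*q^(2*k)*q^(2*n)"] by simp
    then have h1: "norm (1 - A*q^(2*k)*q^(2*n)) \<le> 1 + norm A"
      using sm[of "A*q^(2*k)" "2*n"] sm[of A "2*k"] by linarith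
    have h2: "d6 \<le> norm (1 - A*q^(2*n))" using d6(2)[of "2*n" 1] by (simp add: qpoch_Suc[of _ _ 0, simplified])
    note h3 = norm_quotient_bound[OF h1 h2 d6(1)]
    have h4: "norm ((qpoch q (A*q^(2*n)) k * qpoch q (p1*q^n) k * qpoch q (p2*q^n) k * qpoch q (p3*q^n) k
           * qpoch q (p4*q^n) k)
        / (qpoch q (A*q/p1*q^n) k * qpoch q (A*q/p2*q^n) k * qpoch q (A*q/p3*q^n) k * qpoch q (A*q/p4*q^n) k
           * qpoch q (A*q/p*q^(2*n)) k)) \<le> (cA*c1*c2*c3*c4) / (d1*d2*d3*d4*d5)"
      unfolding norm_divide norm_mult
      using cA c1 c2 c3 c4 d1 d2 d3 d4 d5 sm
      by (intro frac_le mult_mono mult_pos_pos mult_nonneg_nonneg) (auto intro: less_imp_le)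
    have h5: "norm ((1 - A*q^(2*k)*q^(2*n)) / (1 - A*q^(2*n))
      * ((qpoch q (A*q^(2*n)) k * qpoch q (p1*q^n) k * qpoch q (p2*q^n) k * qpoch q (p3*q^n) k
           * qpoch q (p4*q^n) k)
        / (qpoch q (A*q/p1*q^n) k * qpoch q (A*q/p2*q^n) k * qpoch q (A*q/p3*q^n) k * qpoch q (A*q/p4*q^n) k
           * qpoch q (A*q/p*q^(2*n)) k))) \<le> C"
      unfolding C_def norm_mult[of "_ / _" "_ / _"]
      using h3 h4 order_trans[OF norm_ge_zero h3] by (intro mult_mono) auto
    show ?thesis unfolding v norm_mult[of _ "_ * _ ^ _"] mult.assoc[of C]
      using h5 c(2)[of k z] order_trans[OF norm_ge_zero h5] by (intro mult_mono) auto
  qed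
  have l: "(\<lambda>n. vterm q (A*q^(2*n)) (p1*q^n) (p2*q^n) (p3*q^n) (p4*q^n) p z k)
      \<longlonglongrightarrow> qpoch q p k / qpoch q q k * z^k" for k
  proof -
    have s: "(\<lambda>n. qpoch q (x*q^(2*n)) k) \<longlonglongrightarrow> 1" for x
      using LIMSEQ_subseq_LIMSEQ[OF qpoch_shift_tendsto_1[OF q1, of x k], of "\<lambda>n. 2*n"]
      by (simp add: o_def strict_mono_def)
    have p: "(\<lambda>n. q^(2*n)) \<longlonglongrightarrow> 0"
      using LIMSEQ_subseq_LIMSEQ[OF LIMSEQ_power_zero[OF q1], of "\<lambda>n. 2*n"]
      by (simp add: o_def strict_mono_def)
    have "(\<lambda>n. (1 - A*q^(2*k)*q^(2*n)) / (1 - A*q^(2*n))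
      * ((qpoch q (A*q^(2*n)) k * qpoch q (p1*q^n) k * qpoch q (p2*q^n) k * qpoch q (p3*q^n) k
           * qpoch q (p4*q^n) k)
        / (qpoch q (A*q/p1*q^n) k * qpoch q (A*q/p2*q^n) k * qpoch q (A*q/p3*q^n) k * qpoch q (A*q/p4*q^n) k
           * qpoch q (A*q/p*q^(2*n)) k))
      * (qpoch q p k / qpoch q q k * z^k))
      \<longlonglongrightarrow> (1 - A*q^(2*k)*0)/(1-A*0) * ((1*1*1*1*1)/(1*1*1*1*1)) * (qpoch q p k / qpoch q q k * z^k)"
      by (intro tendsto_mult tendsto_divide tendsto_diff tendsto_const s p qpoch_shift_tendsto_1 q1) auto
    then show ?thesis unfolding v by simp
  qed
  show "(\<lambda>n. \<Sum>k. vterm q (A*q^(2*n)) (p1*q^n) (p2*q^n) (p3*q^n) (p4*q^n) p z k)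
    \<longlonglongrightarrow> (\<Sum>k. qpoch q p k / qpoch q q k * z^k)"
    by (rule tannery_geometric[OF l b]) (use z in auto)
qed

section \<open>The closed form of the Casoratian\<close>

definition wron_closed :: "complex \<Rightarrow> complex \<Rightarrow> complex \<Rightarrow> complex \<Rightarrow> complex \<Rightarrow> complex \<Rightarrow> complex \<Rightarrow> complex" where
  "wron_closed q a b c d e f = a*q/b
     * (qinf q (q/c) * qinf q (q/d) * qinf q (q/e) * qinf q (q/f) * qinf q (a^2*q/(c*d*e*f))
        * qinf q (c*d*e*q/a^2) * qinf q (b^2*q/a) * qinf q (b*c/a) * qinf q (b*d/a) * qinf q (b*e/a))
     / (qinf q (c*q/a) * qinf q (d*q/a) * qinf q (e*q/a) * qinf q (b*c*d*e/a^2)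
        * qinf q (a^2*q^2/(b*c*d*e*f)) * qinf q (b*q/c) * qinf q (b*q/d) * qinf q (b*q/e)
        * qinf q (b*q/f) * qinf q (b*q/a))"

context generic_params
begin

text \<open>The product bf is unchanged, so the two convergence conditions carry over; every other
  monomial is multiplied by a power of q.\<close>

lemma shifted: "generic_params q a (b*q^n) c d e (f/q^n)"
proof -
  have g: "generic q (x*q^m)" if "generic q x" for x m
    using generic_shift[OF that q0, of "int m"] by simp
  have gi: "generic q (x/q^m)" if "generic q x" for x m
    using generic_shift[OF that q0, of "- int m"] by (simp add: power_int_minus divide_inverse)
  have e: "(b*q^n)^2/a = b^2/a*q^(2*n)" "c*d*e*(f/q^n)/a^2 = c*d*e*f/a^2/q^n"
    "b*q^n*c*d*e/a^2 = b*c*d*e/a^2*q^n" "b*q^n/a = b/a*q^n" "b*q^n/c = b/c*q^n" "b*q^n/d = b/d*q^n"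
    "b*q^n/e = b/e*q^n" "b*q^n/(f/q^n) = b/f*q^(2*n)" "b*q^n*c/a = b*c/a*q^n" "b*q^n*d/a = b*d/a*q^n"
    "b*q^n*e/a = b*e/a*q^n" "b*q^n*(f/q^n)/a = b*f/a" "a^2*q^2/(b*q^n*c*d*e*(f/q^n)) = a^2*q^2/(b*c*d*e*f)"
    using q0 by (simp_all add: power2_eq_square mult_2 power_add)
  show ?thesis
  proof unfold_locales
  qed (unfold e, (rule q0 q1 z2 z3 gA gX gY nz | (rule g, rule gA gX gY)
      | (rule gi, rule gA gX gY) | (simp add: nz q0; fail))+)
qed

text \<open>Each infinite product that moves sheds one factor, except those at b^2 q/a and bq/f:
  their arguments gain q^2, so they shed two.\<close>

lemma wron_closed_step:
  "wron_closed q a b c d e f = - (q^2*a^2/(c*d*e*f)) * ((1-q/f)*(1-c*d*e*f/(a^2*q))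
        *((1-b^2*q/a)*(1-b^2*q^2/a))*((1-b*c/a)*(1-b*d/a)*(1-b*e/a))
        / ((1-b*c*d*e/a^2)*((1-b*q/a)*(1-b*q/c)*(1-b*q/d)*(1-b*q/e))*(1-b*q/f)*(1-b*q^2/f)))
      * wron_closed q a (b*q) c d e (f/q)"
proof -
  have r: "qinf q x = (1-x) * qinf q (x*q)" for x by (rule qinf_rec[OF q1])
  have r2: "qinf q (x*q) = (1-x*q) * ((1-x*q^2) * qinf q (x*q^3))" for x
    unfolding r[of "x*q"] r[of "x*q*q"] by (simp add: power2_eq_square power3_eq_cube mult_ac)
  have e1: "qinf q (q/f) = (1-q/f) * qinf q (q/(f/q))"
    and e2: "qinf q (a^2*q/(c*d*e*f)) = (1-a^2*q/(c*d*e*f)) * qinf q (a^2*q/(c*d*e*(f/q)))"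
    and e4: "qinf q (b*c/a) = (1-b*c/a) * qinf q (b*q*c/a)"
    and e5: "qinf q (b*d/a) = (1-b*d/a) * qinf q (b*q*d/a)"
    and e6: "qinf q (b*e/a) = (1-b*e/a) * qinf q (b*q*e/a)"
    and e7: "qinf q (b*c*d*e/a^2) = (1-b*c*d*e/a^2) * qinf q (b*q*c*d*e/a^2)"
    and e8: "qinf q (b*q/c) = (1-b*q/c) * qinf q (b*q*q/c)"
    and e9: "qinf q (b*q/d) = (1-b*q/d) * qinf q (b*q*q/d)"
    and e10: "qinf q (b*q/e) = (1-b*q/e) * qinf q (b*q*q/e)"
    and e11: "qinf q (b*q/a) = (1-b*q/a) * qinf q (b*q*q/a)"
    using r[of "q/f"] r[of "a^2*q/(c*d*e*f)"] r[of "b*c/a"] r[of "b*d/a"] r[of "b*e/a"]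
      r[of "b*c*d*e/a^2"] r[of "b*q/c"] r[of "b*q/d"] r[of "b*q/e"] r[of "b*q/a"]
    by (simp_all add: mult_ac)
  have e3: "qinf q (b^2*q/a) = (1-b^2*q/a) * ((1-b^2*q^2/a) * qinf q ((b*q)^2*q/a))"
    using r2[of "b^2/a"] by (simp add: power_mult_distrib power2_eq_square power3_eq_cube mult_ac)
  have e12: "qinf q (b*q/f) = (1-b*q/f) * ((1-b*q^2/f) * qinf q (b*q*q/(f/q)))"
    using r2[of "b/f"] by (simp add: power2_eq_square power3_eq_cube mult_ac)
  have e13: "a^2*q^2/(b*q*c*d*e*(f/q)) = a^2*q^2/(b*c*d*e*f)" using q0 by simp
  \<comment> \<open>Reflecting one factor turns the sign and prefactor of \<open>wron_step\<close>
    into the q that the prefactor aq/b produces under b -> bq.\<close>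
  have k: "- (q^2*a^2/(c*d*e*f)) * (1-c*d*e*f/(a^2*q)) = q * (1-a^2*q/(c*d*e*f))"
    using nz q0 by (simp add: field_simps power2_eq_square)
  have mono: "B*(xc*xd*xe*(l*xf)*(K*xg)*xh*(m1*(m2*xi))*(u1*x1)*(u2*x2)*(u3*x3))
      / (y1*y2*y3*(k1*y4)*y5*(n1*y6)*(n2*y7)*(n3*y8)*(n4*(n6*y9))*(n5*y10))
    = q*K*(l*(m1*m2)*(u1*u2*u3)/(k1*(n5*n1*n2*n3)*n4*n6))
      * (B/q*(xc*xd*xe*xf*xg*xh*xi*x1*x2*x3)/(y1*y2*y3*y4*y5*y6*y7*y8*y9*y10))"
    for B xc xd xe l xf K xg xh m1 m2 xi u1 x1 u2 x2 u3 x3 y1 y2 y3 k1 y4 y5 n1 y6 n2 y7 n3 y8 n4 n6 y9 n5 y10 :: complex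
    using q0 by simp (simp only: mult_ac)
  have "wron_closed q a b c d e f = q*(1-a^2*q/(c*d*e*f))
        * ((1-q/f) *((1-b^2*q/a)*(1-b^2*q^2/a))*((1-b*c/a)*(1-b*d/a)*(1-b*e/a))
        / ((1-b*c*d*e/a^2)*((1-b*q/a)*(1-b*q/c)*(1-b*q/d)*(1-b*q/e))*(1-b*q/f)*(1-b*q^2/f)))
      * (a*q/b/q
     * (qinf q (q/c) * qinf q (q/d) * qinf q (q/e) * qinf q (q/(f/q)) * qinf q (a^2*q/(c*d*e*(f/q)))
        * qinf q (c*d*e*q/a^2) * qinf q ((b*q)^2*q/a) * qinf q (b*q*c/a) * qinf q (b*q*d/a) * qinf q (b*q*e/a))
     / (qinf q (c*q/a) * qinf q (d*q/a) * qinf q (e*q/a) * qinf q (b*q*c*d*e/a^2)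
        * qinf q (a^2*q^2/(b*c*d*e*f)) * qinf q (b*q*q/c) * qinf q (b*q*q/d) * qinf q (b*q*q/e)
        * qinf q (b*q*q/(f/q)) * qinf q (b*q*q/a)))"
    unfolding wron_closed_def e1 e2 e3 e4 e5 e6 e7 e8 e9 e10 e11 e12 by (rule mono)
  then show ?thesis unfolding wron_closed_def e13 k[symmetric]
    by (simp only: mult_ac times_divide_eq_left times_divide_eq_right divide_divide_eq_left)
qed

text \<open>\<open>gc\<close> keeps the infinite products at q/c, q/d, q/e, and with them the limit
  \<open>l\<close>, away from 0, as \<open>iterate_limit\<close> requires. The bound |q|^2 in
  \<open>z3'\<close> is needed to dominate the series with lowered parameter 1/b, which exceeds q/b
  by the factor 1/q.\<close>

theorem wron_b_closed:
  assumes gc: "generic q c" "generic q d" "generic q e"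
    and z3': "norm (a^2*q^2/(b*c*d*e*f)) \<le> norm q * norm q"
  shows "wron_b q a b c d e f = wron_closed q a b c d e f"
proof -
  define A where "A = c*d*e/a^2"
  define z2 where "z2 = b*f/a"
  define z3 where "z3 = a^2*q^2/(b*c*d*e*f)"
  define h where "h = 1 - A*b*f/q"
  define S6 where "S6 = (\<Sum>k. w6 q A (c*e/a) (c*d/a) (d*e/a) k)"
  define F where "F p z = (\<Sum>k. qpoch q p k / qpoch q q k * z^k)" for p z
  define l where "l = a*q * (qinf q (q/c) * qinf q (q/d) * qinf q (q/e) * qinf q (A*q))
     / (qinf q (c*q/a) * qinf q (d*q/a) * qinf q (e*q/a) * qinf q z3)"
  \<comment> \<open>The factor b q^n removes the 1/b that would make the Casoratian diverge along
    the iteration; it puts a factor 1/q into the recurrence.\<close>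
  define f1 where "f1 n = b*q^n * wron_b q a (b*q^n) c d e (f/q^n)" for n
  define g1 where "g1 n = b*q^n * wron_closed q a (b*q^n) c d e (f/q^n)" for n
  define r where "r n = (let B = b*q^n; G = f/q^n in 1/q*(- (q^2*a^2/(c*d*e*G)) * ((1-q/G)*(1-c*d*e*G/(a^2*q))
        *((1-B^2*q/a)*(1-B^2*q^2/a))*((1-B*c/a)*(1-B*d/a)*(1-B*e/a))
        / ((1-B*c*d*e/a^2)*((1-B*q/a)*(1-B*q/c)*(1-B*q/d)*(1-B*q/e))*(1-B*q/G)*(1-B*q^2/G)))))" for n
  have n: "A \<noteq> 0" "z2 \<noteq> 0" "z3 \<noteq> 0" using nz q0 by (auto simp: A_def z2_def z3_def)
  have zz: "norm z2 < 1" "norm z3 < 1" "norm (z2*q) < 1" "norm (z3/q) < 1"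
    using X.z1[folded z2_def] Y.z1[folded z3_def] z3[folded z3_def] q0
      mult_strict_mono[of "norm z2" 1 "norm q" 1] q1
    by (auto simp: norm_mult norm_divide)
  have wz: "A*q/(c*e/a*(c*d/a)*(d*e/a)) = a*q/(c*d*e)"
    using nz by (simp add: A_def field_simps power2_eq_square)
  have wzz: "a*q/(c*d*e) = z2*z3/q"
    using nz q0 by (simp add: z2_def z3_def field_simps power2_eq_square)
  have w1: "norm (a*q/(c*d*e)) < 1"
    using zz mult_strict_mono[of "norm z2" 1 "norm (z3/q)" 1] unfolding wzz by (simp add: norm_mult norm_divide)
  have Aq: "A/(c*e/a) = d/a" "A/(c*d/a) = e/a" "A/(d*e/a) = c/a"
    "A/(q/f) = c*d*e*f/a^2/q" "A/(q/b) = b*c*d*e/a^2/q" "A/(1/b) = b*c*d*e/a^2"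
    using nz by (simp_all add: A_def field_simps power2_eq_square)
  have gAq: "generic q A" "generic q (A/(c*e/a))" "generic q (A/(c*d/a))" "generic q (A/(d*e/a))"
    "generic q (A/(q/f))" "generic q (A/(q/b))" "generic q (A/(1/b))"
    unfolding Aq unfolding A_def
    by (rule gA gX | (rule generic_div_q[OF _ q0], rule gX))+
  interpret w6p: w6_params q A "c*e/a" "c*d/a" "d*e/a"
    by unfold_locales (unfold wz, (rule q0 q1 gAq w1)+)
  have S6: "S6 = qinf q (A*q) * qinf q (q/c) * qinf q (q/e) * qinf q (q/d)
    / (qinf q (d*q/a) * qinf q (e*q/a) * qinf q (c*q/a) * qinf q (a*q/(c*d*e)))"
  proof -
    have e: "A*q/(c*d/a*(d*e/a)) = q/d" "A*q/(c*e/a*(d*e/a)) = q/e" "A*q/(c*e/a*(c*d/a)) = q/c"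
      "A*q/(c*e/a) = d*q/a" "A*q/(c*d/a) = e*q/a" "A*q/(d*e/a) = c*q/a"
      using nz by (simp_all add: A_def field_simps power2_eq_square)
    show ?thesis using w6p.w6_sum unfolding S6_def[symmetric] e wz by (simp add: mult_ac)
  qed
  have b0: "(\<lambda>n. x*q^n) \<longlonglongrightarrow> 0" for x
    using tendsto_mult[OF tendsto_const LIMSEQ_power_zero[OF q1], of x] by simp
  have p45: "norm (q/f*(q/b)) \<le> norm (A*q)"
  proof -
    have "q/f*(q/b) = (z3/q)*(A*q)" using nz q0 by (simp add: z3_def A_def field_simps power2_eq_square)
    then have "norm (q/f*(q/b)) = norm (z3/q) * norm (A*q)" by (simp only: norm_mult)
    also have "\<dots> \<le> 1 * norm (A*q)" using zz by (intro mult_right_mono) auto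
    finally show ?thesis by simp
  qed
  have X1: "(\<lambda>n. vser q A (c*e/a) (c*d/a) (d*e/a) (q/f*q^n) (q/b/q^n) z2) \<longlonglongrightarrow> S6"
    unfolding S6_def
  proof (rule vser_limit_6)
    show "z2*(q/f)*(q/b)/(A*q) = A*q/(c*e/a*(c*d/a)*(d*e/a))"
      unfolding wz using nz q0 by (simp add: z2_def A_def field_simps power2_eq_square)
    show "generic q (q/b)" using gX generic_qdiv by blast
  qed (use q0 q1 gAq p45 zz in auto)
  have X2: "(\<lambda>n. vser q A (c*e/a) (c*d/a) (d*e/a) (q/f*q^n) (1/b/q^n) (z2*q)) \<longlonglongrightarrow> S6"
    unfolding S6_def
  proof (rule vser_limit_6)
    show "z2*q*(q/f)*(1/b)/(A*q) = A*q/(c*e/a*(c*d/a)*(d*e/a))"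
      unfolding wz using nz q0 by (simp add: z2_def A_def field_simps power2_eq_square)
    show "generic q (1/b)" using gX generic_inverse q0 by blast
    have "norm (q/f*(1/b)) = norm (z3/q) * norm A"
    proof -
      have "q/f*(1/b) = (z3/q)*A" using nz q0 by (simp add: z3_def A_def field_simps power2_eq_square)
      then show ?thesis by (simp only: norm_mult)
    qed
    also have "\<dots> \<le> norm A * norm q"
      using mult_right_mono[OF z3'[folded z3_def], of "norm A / norm q"] q0
      by (simp add: norm_divide mult_ac)
    finally show "norm (q/f*(1/b)) \<le> norm (A*q)" by (simp add: norm_mult)
  qed (use q0 q1 gAq zz in auto)
  have F1: "F z2 z3 = qinf q (z2*z3) / qinf q z3"
    unfolding F_def by (rule qbinomial[OF q0 q1 zz(2)])
  have F2: "F (z2*q) (z3/q) = qinf q (z2*z3) / ((1-z3/q) * qinf q z3)"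
    unfolding F_def qbinomial[OF q0 q1 zz(4)] qinf_rec[OF q1, of "z3/q"] using q0 by simp
  have sq: "(x*q^n)^2 = x^2*q^(2*n)" for x n
    by (simp add: power_mult_distrib power_mult[symmetric] mult.commute)
  have Y1: "(\<lambda>n. solY q a (b*q^n) c d e (f/q^n)) \<longlonglongrightarrow> F z2 z3"
  proof -
    have "(\<lambda>n. vser q (b^2/a*q^(2*n)) (b*q^n) (b*c/a*q^n) (b*d/a*q^n) (b*e/a*q^n) z2 z3) \<longlonglongrightarrow> F z2 z3"
      unfolding F_def
      by (rule vser_limit_binomial[OF q0 q1 Y.ga Y.g1 Y.g2 Y.g3 Y.g4 Y.g5[folded z2_def] zz(2)])
    moreover have "solY q a (b*q^n) c d e (f/q^n)
      = vser q (b^2/a*q^(2*n)) (b*q^n) (b*c/a*q^n) (b*d/a*q^n) (b*e/a*q^n) z2 z3" for n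
      unfolding solY_def sq z2_def z3_def using q0 by (simp add: mult_ac)
    ultimately show ?thesis by simp
  qed
  have Y2: "(\<lambda>n. vser q ((b*q^n)^2*q^2/a) (b*q^n*q) (b*q^n*c*q/a) (b*q^n*d*q/a) (b*q^n*e*q/a) (z2*q) (z3/q))
     \<longlonglongrightarrow> F (z2*q) (z3/q)"
  proof -
    have e: "b^2*q^2/a/(b*q) = b/a*q" "b^2*q^2/a/(b*c*q/a) = b/c*q" "b^2*q^2/a/(b*d*q/a) = b/d*q"
      "b^2*q^2/a/(b*e*q/a) = b/e*q" "b^2*q^2/a/(z2*q) = b/f*q" "b^2*q^2/a = b^2/a*q*q"
      using nz q0 by (simp_all add: z2_def field_simps power2_eq_square)
    have "(\<lambda>n. vser q (b^2*q^2/a*q^(2*n)) (b*q*q^n) (b*c*q/a*q^n) (b*d*q/a*q^n) (b*e*q/a*q^n) (z2*q) (z3/q))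
        \<longlonglongrightarrow> F (z2*q) (z3/q)"
      unfolding F_def
    proof (rule vser_limit_binomial[OF q0 q1])
      show "generic q (b^2*q^2/a)"
        unfolding e(6) by (intro generic_mult_q gA q0)
    qed (unfold e(1-5), intro generic_mult_q gY q0, intro generic_mult_q gY q0, intro generic_mult_q gY q0,
        intro generic_mult_q gY q0, intro generic_mult_q gY q0, rule zz)
    then show ?thesis unfolding sq by (simp add: mult_ac)
  qed
  have f1: "f1 n = q/z2*(-(q/A)*((1-b*q^n*c/a)*(1-b*q^n*d/a)*(1-b*q^n*e/a)*h)/(1-A*(b*q^n)))
        * vser q A (c*e/a) (c*d/a) (d*e/a) (q/f*q^n) (1/b/q^n) (z2*q) * solY q a (b*q^n) c d e (f/q^n)
      + a*(q-z3)
        * (z3/q*((1-(b*q^n)^2*q/a)*(1-(b*q^n)^2*q^2/a))*((1-b*q^n)*((1-b*q^n*c/a)*(1-b*q^n*d/a)*(1-b*q^n*e/a))*(1-z2))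
            / ((1-b*q^n*q/a)*(1-b*q^n*q/c)*(1-b*q^n*q/d)*(1-b*q^n*q/e)*(1-(b*q^n)^2*q/(b*f))))
        * vser q A (c*e/a) (c*d/a) (d*e/a) (q/f*q^n) (q/b/q^n) z2
        * vser q ((b*q^n)^2*q^2/a) (b*q^n*q) (b*q^n*c*q/a) (b*q^n*d*q/a) (b*q^n*e*q/a) (z2*q) (z3/q)" for n
  proof -
    interpret n: generic_params q a "b*q^n" c d e "f/q^n" by (rule shifted)
    define B where "B = b*q^n"
    define G where "G = f/q^n"
    have B0: "B \<noteq> 0" using nz q0 by (simp add: B_def)
    have BG: "B*G = b*f" using q0 by (simp add: B_def G_def)
    have e: "B*G/a = z2" "a^2*q^2/(B*c*d*e*G) = z3" "A*B*G/q = A*b*f/q" "B*G*q/a = z2*q"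
      using BG by (simp_all add: z2_def z3_def mult.assoc)
    \<comment> \<open>Since BG = bf is fixed, Bq/G is of order B^2 and tends to 0 with B.\<close>
    have G1: "B*q/G = B^2*q/(b*f)"
      using B0 nz q0 by (simp add: BG[symmetric] power2_eq_square)
    have G2: "q/f*q^n = q/G" "1/b/q^n = 1/B" "q/b/q^n = q/B"
      using q0 by (simp_all add: G_def B_def)
    have "f1 n = B * (q/z2*(-(q/(B*A))*((1-B*c/a)*(1-B*d/a)*(1-B*e/a)*h)/(1-A*B))
        * vser q A (c*e/a) (c*d/a) (d*e/a) (q/G) (1/B) (z2*q) * solY q a B c d e G
      + a/B*(q-z3)
        * (z3/q*((1-B^2*q/a)*(1-B^2*q^2/a))*((1-B)*((1-B*c/a)*(1-B*d/a)*(1-B*e/a))*(1-z2))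
            / ((1-B*q/a)*(1-B*q/c)*(1-B*q/d)*(1-B*q/e)*(1-B^2*q/(b*f))))
        * vser q A (c*e/a) (c*d/a) (d*e/a) (q/G) (q/B) z2
        * vser q (B^2*q^2/a) (B*q) (B*c*q/a) (B*d*q/a) (B*e*q/a) (z2*q) (z3/q))"
      using n.wron_b_explicit unfolding f1_def B_def[symmetric] G_def[symmetric] solX_def
        A_def[symmetric] unfolding e G1 h_def by simp
    also have "\<dots> = q/z2*(-(q/A)*((1-B*c/a)*(1-B*d/a)*(1-B*e/a)*h)/(1-A*B))
        * vser q A (c*e/a) (c*d/a) (d*e/a) (q/G) (1/B) (z2*q) * solY q a B c d e G
      + a*(q-z3)
        * (z3/q*((1-B^2*q/a)*(1-B^2*q^2/a))*((1-B)*((1-B*c/a)*(1-B*d/a)*(1-B*e/a))*(1-z2))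
            / ((1-B*q/a)*(1-B*q/c)*(1-B*q/d)*(1-B*q/e)*(1-B^2*q/(b*f))))
        * vser q A (c*e/a) (c*d/a) (d*e/a) (q/G) (q/B) z2
        * vser q (B^2*q^2/a) (B*q) (B*c*q/a) (B*d*q/a) (B*e*q/a) (z2*q) (z3/q)"
    proof -
      have "B*(x*(-(q/(B*A))*y/w)*V*Y + a/B*t*k*X*Z) = x*(-(q/A)*y/w)*V*Y + a*t*k*X*Z"
        for x y w V Y t k X Z
        using B0 by (simp add: distrib_left right_diff_distrib)
      then show ?thesis .
    qed
    finally show ?thesis unfolding G2 G_def[symmetric] B_def .
  qed
  have "f1 0 = g1 0"
  proof (rule iterate_limit[where f = f1 and g = g1 and r = r and l = l])
    fix n
    interpret n: generic_params q a "b*q^n" c d e "f/q^n" by (rule shifted)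
    have e: "b*q^Suc n = b*q^n*q" "f/q^Suc n = f/q^n/q" by simp_all
    have gs: "generic_params q a (b*q^n*q) c d e (f/q^n/q)"
      using shifted[of "Suc n"] unfolding e .
    have rr: "b*q^n * (R*W) = 1/q*R * (b*q^n*q*W)" for R W
      using q0 by simp
    show "f1 n = r n * f1 (Suc n)"
      unfolding f1_def r_def Let_def e n.wron_step[OF gs] by (rule rr)
    show "g1 n = r n * g1 (Suc n)"
      unfolding g1_def r_def Let_def e n.wron_closed_step by (rule rr)
  next
    have lim1: "f1 \<longlonglongrightarrow> q/z2*(-(q/A)*((1-0*c/a)*(1-0*d/a)*(1-0*e/a)*h)/(1-A*0)) * S6 * F z2 z3
      + a*(q-z3)
        * (z3/q*((1-0^2*q/a)*(1-0^2*q^2/a))*((1-0)*((1-0*c/a)*(1-0*d/a)*(1-0*e/a))*(1-z2))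
            / ((1-0*q/a)*(1-0*q/c)*(1-0*q/d)*(1-0*q/e)*(1-0^2*q/(b*f))))
        * S6 * F (z2*q) (z3/q)"
      unfolding f1 by (intro tendsto_add tendsto_mult tendsto_divide tendsto_diff tendsto_power tendsto_const
        b0 X1 X2 Y1 Y2) (use nz in auto)
    \<comment> \<open>Both limits carry the same infinite products, and 1 - z2 minus h reduces to z2
      (1 - w)/w. By z2 z3 = w q this leaves aq (1 - w), whose factor 1 - w cancels against the first
      factor of the product at w in the denominator of \<open>S6\<close>.\<close>
    have "q/z2*(-(q/A)*h) * S6 * F z2 z3 + a*(q-z3) * (z3/q*(1-z2)) * S6 * F (z2*q) (z3/q) = l"
    proof -
      define w where "w = a*q/(c*d*e)"
      define I1 where "I1 = qinf q (z2*z3)"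
      have wn: "1 - w \<noteq> 0" using w1 by (auto simp: w_def)
      have z3n: "1 - z3/q \<noteq> 0" using zz by auto
      have z23: "z2*z3 = w*q" using wzz q0 by (simp add: w_def)
      have "norm (w*q) < 1" using mult_strict_mono[of "norm z2" 1 "norm z3" 1] zz unfolding z23[symmetric]
        by (simp add: norm_mult)
      then have I1: "I1 \<noteq> 0" unfolding I1_def z23 by (rule qinf_small_nz[OF q1])
      have qw: "qinf q w = (1-w) * I1" unfolding I1_def z23 by (rule qinf_rec[OF q1])
      have qz: "qinf q z3 \<noteq> 0" using qinf_small_nz[OF q1 zz(2)] .
      have c1: "q/z2*(q/A) = a*z3"
        using nz q0 by (simp add: z2_def z3_def A_def field_simps power2_eq_square)
      have c2: "h = 1 - z2/w"
        using nz q0 by (simp add: h_def z2_def w_def A_def field_simps power2_eq_square)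
      have c3: "a*(q-z3)*(z3/q*(1-z2)) * (I1/((1-z3/q)*qinf q z3)) = a*z3*(1-z2)*(I1/qinf q z3)"
      proof -
        have "q - z3 = q*(1-z3/q)" using q0 by (simp add: right_diff_distrib)
        then show ?thesis using z3n q0 by simp
      qed
      have w0: "w \<noteq> 0" using nz q0 by (simp add: w_def)
      have "q/z2*(-(q/A)*h) * S6 * F z2 z3 + a*(q-z3) * (z3/q*(1-z2)) * S6 * F (z2*q) (z3/q)
        = - (q/z2*(q/A)) * h * S6 * (I1/qinf q z3)
          + S6 * (a*(q-z3)*(z3/q*(1-z2)) * (I1/((1-z3/q)*qinf q z3)))"
        unfolding F1 F2 I1_def by (simp add: mult_ac)
      also have "\<dots> = S6 * (I1/qinf q z3) * (a*z3*(1 - z2 - (1 - z2/w)))"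
        unfolding c1 c2 c3 by (simp add: algebra_simps)
      also have "a*z3*(1 - z2 - (1 - z2/w)) = a*q*(1-w)"
      proof -
        have "a*z3*(1 - z2 - (1 - z2/w)) = a*(z2*z3)*(1/w - 1)"
          by (simp add: algebra_simps)
        then show ?thesis unfolding z23 using w0 by (simp add: field_simps)
      qed
      also have "S6 * (I1/qinf q z3) * (a*q*(1-w)) = l"
        unfolding S6 l_def w_def[symmetric] qw using wn I1 by (simp add: mult_ac)
      finally show ?thesis .
    qed
    then show "f1 \<longlonglongrightarrow> l" using lim1 by (simp add: mult_ac)
    have g1: "g1 n = a*q
     * (qinf q (q/c) * qinf q (q/d) * qinf q (q/e) * qinf q (q/f*q^n) * qinf q (a^2*q/(c*d*e*f)*q^n)
        * qinf q (A*q) * qinf q ((b*q^n)^2*q/a) * qinf q (b*q^n*c/a) * qinf q (b*q^n*d/a) * qinf q (b*q^n*e/a))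
     / (qinf q (c*q/a) * qinf q (d*q/a) * qinf q (e*q/a) * qinf q (b*q^n*c*d*e/a^2)
        * qinf q z3 * qinf q (b*q^n*q/c) * qinf q (b*q^n*q/d) * qinf q (b*q^n*q/e)
        * qinf q ((b*q^n)^2*q/(b*f)) * qinf q (b*q^n*q/a))" for n
    proof -
      have e: "q/(f/q^n) = q/f*q^n" "a^2*q/(c*d*e*(f/q^n)) = a^2*q/(c*d*e*f)*q^n"
        "a^2*q^2/(b*q^n*c*d*e*(f/q^n)) = z3" "b*q^n*q/(f/q^n) = (b*q^n)^2*q/(b*f)" "c*d*e*q/a^2 = A*q"
        using q0 nz by (simp_all add: z3_def A_def power2_eq_square)
      have "b*q^n*(a*q/(b*q^n)*N/M) = a*q*N/M" for N M using q0 nz by simp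
      then show ?thesis unfolding g1_def wron_closed_def e .
    qed
    have "g1 \<longlonglongrightarrow> a*q
     * (qinf q (q/c) * qinf q (q/d) * qinf q (q/e) * qinf q 0 * qinf q 0
        * qinf q (A*q) * qinf q (0^2*q/a) * qinf q (0*c/a) * qinf q (0*d/a) * qinf q (0*e/a))
     / (qinf q (c*q/a) * qinf q (d*q/a) * qinf q (e*q/a) * qinf q (0*c*d*e/a^2)
        * qinf q z3 * qinf q (0*q/c) * qinf q (0*q/d) * qinf q (0*q/e)
        * qinf q (0^2*q/(b*f)) * qinf q (0*q/a))"
      unfolding g1
    proof (intro tendsto_mult tendsto_divide qinf_tendsto[OF q1] tendsto_power tendsto_const b0)
      show "qinf q (c*q/a) * qinf q (d*q/a) * qinf q (e*q/a) * qinf q (0*c*d*e/a^2)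
        * qinf q z3 * qinf q (0*q/c) * qinf q (0*q/d) * qinf q (0*q/e)
        * qinf q (0^2*q/(b*f)) * qinf q (0*q/a) \<noteq> 0"
        using qinf_small_nz[OF q1 zz(2)] generic_qinf[OF generic_mult_q[OF gX(1) q0] q0 q1]
          generic_qinf[OF generic_mult_q[OF gX(2) q0] q0 q1] generic_qinf[OF generic_mult_q[OF gX(3) q0] q0 q1]
        by simp
    qed (use nz in auto)
    then show "g1 \<longlonglongrightarrow> l" by (simp add: l_def)
    have "qinf q (q/c) \<noteq> 0" "qinf q (q/d) \<noteq> 0" "qinf q (q/e) \<noteq> 0" "qinf q (A*q) \<noteq> 0"
      using gc generic_qdiv generic_qinf[OF _ q0 q1] generic_mult_q[OF gAq(1) q0] by auto
    moreover have "qinf q (c*q/a) * qinf q (d*q/a) * qinf q (e*q/a) * qinf q z3 \<noteq> 0"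
        using qinf_small_nz[OF q1 zz(2)] generic_qinf[OF generic_mult_q[OF gX(1) q0] q0 q1]
          generic_qinf[OF generic_mult_q[OF gX(2) q0] q0 q1] generic_qinf[OF generic_mult_q[OF gX(3) q0] q0 q1]
        by simp
    ultimately show "l \<noteq> 0" using nz q0 by (simp add: l_def)
  qed
  then show ?thesis using nz by (simp add: f1_def g1_def)
qed

end

section \<open>Holomorphy in six variables\<close>

fun csmul :: "complex \<Rightarrow> params \<Rightarrow> params" where
  "csmul c (h, h1, h2, h3, h4, h5) = (c*h, c*h1, c*h2, c*h3, c*h4, c*h5)"

text \<open>A real derivative that commutes with complex scaling. In this coordinate-free form
  closure under products, quotients and limits is checked on the derivative as a map; the six
  partial derivatives are recovered only in \<open>holomorphic6_on_iff_cdiff\<close>.\<close>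

definition cdiff :: "(params \<Rightarrow> complex) \<Rightarrow> params \<Rightarrow> bool" where
  "cdiff F x \<longleftrightarrow> (\<exists>L. (F has_derivative L) (at x) \<and> (\<forall>c v. L (csmul c v) = c * L v))"

lemma cdiffI:
  "(F has_derivative L) (at x) \<Longrightarrow> (\<And>c v. L (csmul c v) = c * L v) \<Longrightarrow> cdiff F x"
  unfolding cdiff_def by blast

lemma holomorphic6_on_iff_cdiff: "holomorphic6_on F S \<longleftrightarrow> (\<forall>x\<in>S. cdiff F x)"
proof -
  have "cdiff F x \<longleftrightarrow> (\<exists>g g1 g2 g3 g4 g5.
        (F has_derivative
           (\<lambda>(h, h1, h2, h3, h4, h5). g * h + g1 * h1 + g2 * h2 + g3 * h3 + g4 * h4 + g5 * h5))
        (at x))" (is "_ \<longleftrightarrow> ?R") for x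
  proof
    assume "cdiff F x"
    then obtain L where L: "(F has_derivative L) (at x)" "\<And>c v. L (csmul c v) = c * L v"
      unfolding cdiff_def by blast
    have lin: "L (u + v) = L u + L v" for u v
      using has_derivative_linear[OF L(1)] by (rule linear_add)
    have "L (h, h1, h2, h3, h4, h5) = L (1,0,0,0,0,0) * h + L (0,1,0,0,0,0) * h1 + L (0,0,1,0,0,0) * h2
      + L (0,0,0,1,0,0) * h3 + L (0,0,0,0,1,0) * h4 + L (0,0,0,0,0,1) * h5" for h h1 h2 h3 h4 h5
    proof -
      have "(h, h1, h2, h3, h4, h5) = csmul h (1,0,0,0,0,0) + csmul h1 (0,1,0,0,0,0) + csmul h2 (0,0,1,0,0,0)
        + csmul h3 (0,0,0,1,0,0) + csmul h4 (0,0,0,0,1,0) + csmul h5 (0,0,0,0,0,1)"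
        by simp
      then show ?thesis by (simp only: lin L(2) mult.commute)
    qed
    then obtain g g1 g2 g3 g4 g5 where
      "\<And>h h1 h2 h3 h4 h5. L (h, h1, h2, h3, h4, h5) = g * h + g1 * h1 + g2 * h2 + g3 * h3 + g4 * h4 + g5 * h5"
      by blast
    then have "L = (\<lambda>(h, h1, h2, h3, h4, h5). g * h + g1 * h1 + g2 * h2 + g3 * h3 + g4 * h4 + g5 * h5)"
      by (auto simp: fun_eq_iff)
    then show ?R using L(1) by blast
  next
    assume ?R
    then obtain g g1 g2 g3 g4 g5 where "(F has_derivative
           (\<lambda>(h, h1, h2, h3, h4, h5). g * h + g1 * h1 + g2 * h2 + g3 * h3 + g4 * h4 + g5 * h5)) (at x)"
      by blast
    then show "cdiff F x"
    proof (rule cdiffI)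
      fix c v
      show "(\<lambda>(h, h1, h2, h3, h4, h5). g * h + g1 * h1 + g2 * h2 + g3 * h3 + g4 * h4 + g5 * h5) (csmul c v)
        = c * (\<lambda>(h, h1, h2, h3, h4, h5). g * h + g1 * h1 + g2 * h2 + g3 * h3 + g4 * h4 + g5 * h5) v"
        by (cases v) (simp add: algebra_simps)
    qed
  qed
  then show ?thesis unfolding holomorphic6_on_def by simp
qed

lemma cdiff_const: "cdiff (\<lambda>_. c) x"
  by (rule cdiffI[where L = "\<lambda>_. 0"]) auto

lemma cdiff_add:
  assumes "cdiff F x" "cdiff G x"
  shows "cdiff (\<lambda>x. F x + G x) x"
proof -
  obtain L M where "(F has_derivative L) (at x)" "\<And>c v. L (csmul c v) = c * L v"
    "(G has_derivative M) (at x)" "\<And>c v. M (csmul c v) = c * M v"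
    using assms unfolding cdiff_def by blast
  then show ?thesis
    by (intro cdiffI[where L = "\<lambda>v. L v + M v"] has_derivative_add) (auto simp: distrib_left)
qed

lemma cdiff_mult:
  assumes "cdiff F x" "cdiff G x"
  shows "cdiff (\<lambda>x. F x * G x) x"
proof -
  obtain L M where "(F has_derivative L) (at x)" "\<And>c v. L (csmul c v) = c * L v"
    "(G has_derivative M) (at x)" "\<And>c v. M (csmul c v) = c * M v"
    using assms unfolding cdiff_def by blast
  then show ?thesis
    by (intro cdiffI[where L = "\<lambda>v. F x * M v + L v * G x"] has_derivative_mult) (auto simp: algebra_simps)
qed

lemma cdiff_uminus: "cdiff F x \<Longrightarrow> cdiff (\<lambda>x. - F x) x"
  using cdiff_mult[OF cdiff_const[of "-1"], of F x] by simp

lemma cdiff_diff: "cdiff F x \<Longrightarrow> cdiff G x \<Longrightarrow> cdiff (\<lambda>x. F x - G x) x"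
  using cdiff_add[OF _ cdiff_uminus, of F x G] by simp

lemma cdiff_inverse:
  assumes "cdiff F x" "F x \<noteq> 0"
  shows "cdiff (\<lambda>x. inverse (F x)) x"
proof -
  obtain L where "(F has_derivative L) (at x)" "\<And>c v. L (csmul c v) = c * L v"
    using assms unfolding cdiff_def by blast
  then show ?thesis using assms(2)
    by (intro cdiffI[where L = "\<lambda>v. - (inverse (F x) * L v * inverse (F x))"] Deriv.has_derivative_inverse) auto
qed

lemma cdiff_divide: "cdiff F x \<Longrightarrow> cdiff G x \<Longrightarrow> G x \<noteq> 0 \<Longrightarrow> cdiff (\<lambda>x. F x / G x) x"
  unfolding divide_inverse by (intro cdiff_mult cdiff_inverse)

lemma cdiff_power: "cdiff F x \<Longrightarrow> cdiff (\<lambda>x. F x ^ n) x"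
  by (induction n) (auto intro: cdiff_const cdiff_mult)

lemma cdiff_prod: "(\<And>i. i \<in> I \<Longrightarrow> cdiff (F i) x) \<Longrightarrow> cdiff (\<lambda>x. \<Prod>i\<in>I. F i x) x"
  by (induction I rule: infinite_finite_induct) (auto intro: cdiff_const cdiff_mult)

lemma cdiff_sum: "(\<And>i. i \<in> I \<Longrightarrow> cdiff (F i) x) \<Longrightarrow> cdiff (\<lambda>x. \<Sum>i\<in>I. F i x) x"
  by (induction I rule: infinite_finite_induct) (auto intro: cdiff_const cdiff_add)

lemma cdiff_bounded_linear:
  assumes "bounded_linear L" "\<And>c v. L (csmul c v) = c * L v"
  shows "cdiff L x"
  using bounded_linear_imp_has_derivative[OF assms(1)] assms(2) by (rule cdiffI)

lemma cdiff_coords: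
  "cdiff fst x" "cdiff (\<lambda>x. fst (snd x)) x" "cdiff (\<lambda>x. fst (snd (snd x))) x"
  "cdiff (\<lambda>x. fst (snd (snd (snd x)))) x" "cdiff (\<lambda>x. fst (snd (snd (snd (snd x))))) x"
  "cdiff (\<lambda>x. snd (snd (snd (snd (snd x))))) x"
proof -
  note b = bounded_linear_fst_comp bounded_linear_snd_comp
  note s1 = bounded_linear_snd and s2 = b(2)[OF bounded_linear_snd]
  note s3 = b(2)[OF s2]
  note s4 = b(2)[OF s3]
  show "cdiff fst x"
    by (rule cdiff_bounded_linear[OF bounded_linear_fst]) (rename_tac c u, case_tac u, simp)
  show "cdiff (\<lambda>x. fst (snd x)) x"
    by (rule cdiff_bounded_linear[OF b(1)[OF s1]]) (rename_tac c u, case_tac u, simp)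
  show "cdiff (\<lambda>x. fst (snd (snd x))) x"
    by (rule cdiff_bounded_linear[OF b(1)[OF s2]]) (rename_tac c u, case_tac u, simp)
  show "cdiff (\<lambda>x. fst (snd (snd (snd x)))) x"
    by (rule cdiff_bounded_linear[OF b(1)[OF s3]]) (rename_tac c u, case_tac u, simp)
  show "cdiff (\<lambda>x. fst (snd (snd (snd (snd x))))) x"
    by (rule cdiff_bounded_linear[OF b(1)[OF s4]]) (rename_tac c u, case_tac u, simp)
  show "cdiff (\<lambda>x. snd (snd (snd (snd (snd x))))) x"
    by (rule cdiff_bounded_linear[OF b(2)[OF s4]]) (rename_tac c u, case_tac u, simp)
qed

lemma cdiff_isCont: "cdiff F x \<Longrightarrow> isCont F x"
  unfolding cdiff_def using has_derivative_continuous by blast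

lemma cdiff_transform:
  assumes "cdiff F x" "eventually (\<lambda>y. F y = G y) (nhds x)"
  shows "cdiff G x"
proof -
  obtain L where L: "(F has_derivative L) (at x)" "\<And>c v. L (csmul c v) = c * L v"
    using assms unfolding cdiff_def by blast
  obtain S where S: "open S" "x \<in> S" "\<And>y. y \<in> S \<Longrightarrow> F y = G y"
    using assms(2) unfolding eventually_nhds by blast
  show ?thesis
    by (rule cdiffI[OF has_derivative_transform_within_open[OF L(1) S] L(2)])
qed

lemma norm_csmul: "norm (csmul c v) = norm c * norm v"
proof -
  have P: "norm (c * x, w) = norm c * norm (x, y)" if "norm w = norm c * norm y" for x :: complex and w y :: "'a::real_normed_vector"
    unfolding norm_Pair that
    by (simp add: norm_mult power_mult_distrib distrib_left[symmetric] real_sqrt_mult)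
  show ?thesis
    by (cases v) (simp only: csmul.simps, (rule P)+, simp add: norm_mult)
qed

lemma has_derivative_csmul: "((\<lambda>t. csmul t v) has_derivative (\<lambda>t. csmul t v)) (at t)"
proof -
  obtain h h1 h2 h3 h4 h5 where v: "v = (h, h1, h2, h3, h4, h5)" by (cases v)
  have "((\<lambda>t. (t*h, t*h1, t*h2, t*h3, t*h4, t*h5)) has_derivative (\<lambda>t. (t*h, t*h1, t*h2, t*h3, t*h4, t*h5))) (at t)"
    by (intro has_derivative_Pair bounded_linear_imp_has_derivative bounded_linear_mult_left)
  then show ?thesis by (simp add: v)
qed

lemma deriv_along_line:
  assumes "(F has_derivative L) (at (x + csmul t v))" "\<And>c v. L (csmul c v) = c * L v"
  shows "((\<lambda>t. F (x + csmul t v)) has_field_derivative L v) (at t)"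
proof -
  have "((\<lambda>t. x + csmul t v) has_derivative (\<lambda>t. csmul t v)) (at t)"
    using has_derivative_add[OF has_derivative_const has_derivative_csmul] by simp
  from diff_chain_at[OF this assms(1)] show ?thesis
    unfolding has_field_derivative_def o_def assms(2) by (simp add: mult.commute[of _ "L v"] mult_commute_abs)
qed

lemma csmul_0 [simp]: "csmul 0 v = 0"
  by (cases v) (simp add: zero_prod_def)

text \<open>Cauchy's estimate on the complex line through \<open>x\<close> in the direction \<open>v\<close>.\<close>

lemma derivative_estimate:
  assumes r: "r > 0"
    and dF: "\<And>y. y \<in> ball x r \<Longrightarrow> cdiff F y"
    and L: "(F has_derivative L) (at x)" "\<And>c v. L (csmul c v) = c * L v"
    and B: "\<And>y. y \<in> ball x r \<Longrightarrow> norm (F y) \<le> B"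
  shows "norm (L v) \<le> 2 * B / r * norm v"
proof (cases "v = 0")
  case True
  then show ?thesis using linear_0[OF has_derivative_linear[OF L(1)]] by simp
next
  case False
  \<comment> \<open>Half the critical radius r/|v|, so that the closed disc still maps into the open
    ball.\<close>
  define R where "R = r / (2 * norm v)"
  have R: "R > 0" using r False by (simp add: R_def)
  have inb: "x + csmul t v \<in> ball x r" if "norm t \<le> R" for t
  proof -
    have "norm (csmul t v) \<le> R * norm v" unfolding norm_csmul using that by (intro mult_right_mono) auto
    also have "\<dots> < r" using r False by (simp add: R_def)
    finally show ?thesis by (simp add: dist_norm)
  qed
  define f where "f t = F (x + csmul t v)" for t
  have der: "\<exists>D. (f has_field_derivative D) (at t)" if "norm t \<le> R" for t
    using dF[OF inb[OF that]] deriv_along_line unfolding cdiff_def f_def by blast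
  have "f holomorphic_on cball 0 R"
    unfolding holomorphic_on_def field_differentiable_def
  proof
    fix t :: complex assume "t \<in> cball 0 R"
    then obtain D where "(f has_field_derivative D) (at t)" using der by auto
    then show "\<exists>D. (f has_field_derivative D) (at t within cball 0 R)"
      using has_field_derivative_at_within by blast
  qed
  then have hol: "f holomorphic_on ball 0 R" "continuous_on (cball 0 R) f"
    by (auto intro: holomorphic_on_subset holomorphic_on_imp_continuous_on)
  have "norm ((deriv ^^ 1) f 0) \<le> fact 1 * B / R ^ 1"
  proof (rule Cauchy_inequality[OF hol R])
    fix t :: complex assume "norm (0 - t) = R"
    then show "norm (f t) \<le> B" unfolding f_def using B[OF inb] by simp
  qed
  moreover have "deriv f 0 = L v"
    using deriv_along_line[of F L x 0 v] L unfolding f_def by (intro DERIV_imp_deriv) simp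
  ultimately show ?thesis by (simp add: R_def field_simps)
qed

text \<open>Weierstrass' theorem in six variables. \<open>derivative_estimate\<close> for
  differences makes the derivatives uniformly Cauchy on a smaller ball, and
  \<open>has_derivative_sequence\<close> identifies their limit as the derivative of
  \<open>G\<close>; commuting with \<open>csmul\<close> passes to the limit.\<close>

theorem cdiff_uniform_limit:
  assumes r: "r > 0"
    and dF: "\<And>n y. y \<in> ball x0 r \<Longrightarrow> cdiff (F n) y"
    and ul: "uniform_limit (ball x0 r) F G sequentially"
  shows "cdiff G x0"
proof -
  \<comment> \<open>Around each point of the half ball there is room r/2 for Cauchy's
    estimate.\<close>
  define S where "S = ball x0 (r/2)"
  have sub: "ball y (r/2) \<subseteq> ball x0 r" if "y \<in> S" for y
  proof
    fix y' assume "y' \<in> ball y (r/2)"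
    then have "dist y y' < r/2" "dist x0 y < r/2" using that by (auto simp: S_def)
    then show "y' \<in> ball x0 r" using dist_triangle[of x0 y' y] by simp
  qed
  define L where "L n y = (SOME L. (F n has_derivative L) (at y) \<and> (\<forall>c v. L (csmul c v) = c * L v))" for n y
  have "(F n has_derivative L n y) (at y) \<and> (\<forall>c v. L n y (csmul c v) = c * L n y v)" if "y \<in> ball x0 r" for n y
    unfolding L_def by (rule someI_ex[OF dF[OF that, unfolded cdiff_def]])
  then have L: "\<And>n y. y \<in> ball x0 r \<Longrightarrow> (F n has_derivative L n y) (at y)"
      "\<And>n y c v. y \<in> ball x0 r \<Longrightarrow> L n y (csmul c v) = c * L n y v"
    by blast+
  have Sb: "y \<in> ball x0 r" if "y \<in> S" for y using that r by (auto simp: S_def)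
  have est: "\<exists>N. \<forall>m\<ge>N. \<forall>n\<ge>N. \<forall>y\<in>S. \<forall>v. norm (L m y v - L n y v) \<le> e * norm v" if e: "e > 0" for e
  proof -
    \<comment> \<open>Differences are bounded by 2 d, so the estimate with radius r/2 gives 2 (2
      d)/(r/2) = 8 d/r = e.\<close>
    define d where "d = e * r / 8"
    have d: "d > 0" using e r by (simp add: d_def)
    then obtain N where N: "\<And>n y. n \<ge> N \<Longrightarrow> y \<in> ball x0 r \<Longrightarrow> dist (F n y) (G y) < d"
      using ul unfolding uniform_limit_iff eventually_sequentially by blast
    have "norm (L m y v - L n y v) \<le> e * norm v" if "m \<ge> N" "n \<ge> N" "y \<in> S" for m n y v
    proof -
      have "norm (L m y v - L n y v) \<le> 2 * (2 * d) / (r/2) * norm v"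
      proof (rule derivative_estimate[where F = "\<lambda>y. F m y - F n y" and x = y])
        show "cdiff (\<lambda>y. F m y - F n y) y'" if "y' \<in> ball y (r/2)" for y'
        proof -
          have "y' \<in> ball x0 r" using that sub[OF \<open>y \<in> S\<close>] by blast
          then show ?thesis by (intro cdiff_diff dF)
        qed
        show "((\<lambda>y. F m y - F n y) has_derivative (\<lambda>v. L m y v - L n y v)) (at y)"
          using L(1)[OF Sb[OF \<open>y \<in> S\<close>]] by (intro has_derivative_diff)
        show "L m y (csmul c v) - L n y (csmul c v) = c * (L m y v - L n y v)" for c v
          using L(2)[OF Sb[OF \<open>y \<in> S\<close>]] by (simp add: right_diff_distrib)
        show "norm (F m y' - F n y') \<le> 2 * d" if "y' \<in> ball y (r/2)" for y'
        proof -
          have "y' \<in> ball x0 r" using that sub[OF \<open>y \<in> S\<close>] by blast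
          then have "dist (F m y') (G y') < d" "dist (F n y') (G y') < d"
            using N \<open>m \<ge> N\<close> \<open>n \<ge> N\<close> by blast+
          then show ?thesis
            using dist_triangle2[of "F m y'" "F n y'" "G y'"] by (simp add: dist_norm)
        qed
      qed (use r in simp)
      also have "2 * (2 * d) / (r/2) = e" using r by (simp add: d_def)
      finally show ?thesis .
    qed
    then show ?thesis by blast
  qed
  have conv: "convergent (\<lambda>n. L n y v)" if yS: "y \<in> S" for y v
  proof (rule Cauchy_convergent, rule CauchyI)
    fix e :: real assume e: "e > 0"
    then have "e / (norm v + 1) > 0" by (simp add: add_nonneg_pos)
    then obtain N where N: "\<And>m n. m \<ge> N \<Longrightarrow> n \<ge> N \<Longrightarrow> norm (L m y v - L n y v) \<le> e / (norm v + 1) * norm v"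
      using est[of "e / (norm v + 1)"] yS by blast
    have "norm v + 1 > 0" by (simp add: add_nonneg_pos)
    then have "e / (norm v + 1) * norm v < e"
      using e by (simp add: field_simps)
    then have "norm (L m y v - L n y v) < e" if "m \<ge> N" "n \<ge> N" for m n
      using N[OF that] by linarith
    then show "\<exists>M. \<forall>m\<ge>M. \<forall>n\<ge>M. norm (L m y v - L n y v) < e" by blast
  qed
  define D where "D y v = lim (\<lambda>n. L n y v)" for y v
  have D: "(\<lambda>n. L n y v) \<longlonglongrightarrow> D y v" if "y \<in> S" for y v
    using conv[OF that] unfolding D_def by (simp add: convergent_LIMSEQ_iff)
  have x0: "x0 \<in> S" using r by (simp add: S_def)
  have "\<exists>g. \<forall>x\<in>S. (\<lambda>n. F n x) \<longlonglongrightarrow> g x \<and> (g has_derivative D x) (at x within S)"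
  proof (rule has_derivative_sequence[where f' = L])
    show "convex S" by (simp add: S_def)
    show "(F n has_derivative L n x) (at x within S)" if "x \<in> S" for n x
      using L(1)[OF Sb[OF that]] by (rule has_derivative_at_withinI)
    show "\<forall>\<^sub>F n in sequentially. \<forall>x\<in>S. \<forall>h. norm (L n x h - D x h) \<le> e * norm h" if e: "e > 0" for e
    proof -
      obtain N where N: "\<And>m n y v. m \<ge> N \<Longrightarrow> n \<ge> N \<Longrightarrow> y \<in> S \<Longrightarrow> norm (L m y v - L n y v) \<le> e * norm v"
        using est[OF e] by blast
      have "norm (L n y v - D y v) \<le> e * norm v" if "n \<ge> N" "y \<in> S" for n y v
      proof (rule tendsto_upperbound)
        show "(\<lambda>m. norm (L n y v - L m y v)) \<longlonglongrightarrow> norm (L n y v - D y v)"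
          using D[OF that(2)] by (intro tendsto_intros)
        show "\<forall>\<^sub>F m in sequentially. norm (L n y v - L m y v) \<le> e * norm v"
          using N that unfolding eventually_sequentially by blast
      qed simp
      then show ?thesis unfolding eventually_sequentially by blast
    qed
    show "(\<lambda>n. F n x0) \<longlonglongrightarrow> G x0" using tendsto_uniform_limitI[OF ul] r by simp
  qed (rule x0)
  then obtain g where g: "\<And>x. x \<in> S \<Longrightarrow> (\<lambda>n. F n x) \<longlonglongrightarrow> g x" "(g has_derivative D x0) (at x0 within S)"
    using x0 by blast
  have gG: "g y = G y" if "y \<in> S" for y
    using LIMSEQ_unique[OF g(1)[OF that] tendsto_uniform_limitI[OF ul Sb[OF that]]] .
  have "open S" by (simp add: S_def)
  then have "(g has_derivative D x0) (at x0)" using g(2) at_within_open[OF x0] by simp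
  then have "(G has_derivative D x0) (at x0)"
    by (rule has_derivative_transform_within_open[OF _ \<open>open S\<close> x0 gG])
  moreover have "D x0 (csmul c v) = c * D x0 v" for c v
  proof (rule LIMSEQ_unique[OF D[OF x0]])
    show "(\<lambda>n. L n x0 (csmul c v)) \<longlonglongrightarrow> c * D x0 v"
      unfolding L(2)[OF Sb[OF x0]] by (intro tendsto_intros D x0)
  qed
  ultimately show ?thesis by (rule cdiffI)
qed

section \<open>The analytic continuation\<close>

definition par_a :: "params \<Rightarrow> complex" where "par_a x = fst x"
definition par1 :: "params \<Rightarrow> complex" where "par1 x = fst (snd x)"
definition par2 :: "params \<Rightarrow> complex" where "par2 x = fst (snd (snd x))"
definition par3 :: "params \<Rightarrow> complex" where "par3 x = fst (snd (snd (snd x)))"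
definition par4 :: "params \<Rightarrow> complex" where "par4 x = fst (snd (snd (snd (snd x))))"
definition par5 :: "params \<Rightarrow> complex" where "par5 x = snd (snd (snd (snd (snd x))))"

lemmas par_defs = par_a_def par1_def par2_def par3_def par4_def par5_def

lemma cdiff_par [simp]:
  "cdiff par_a x" "cdiff par1 x" "cdiff par2 x" "cdiff par3 x" "cdiff par4 x" "cdiff par5 x"
  using cdiff_coords unfolding par_defs[abs_def] by blast+

definition arg6 :: "complex \<Rightarrow> params \<Rightarrow> complex" where
  "arg6 q x = W87_arg q (par_a x) [par1 x, par2 x, par3 x, par4 x, par5 x]"

lemma domain_iff: "x \<in> W87_domain q \<longleftrightarrow> par_a x \<noteq> 0 \<and> par_a x \<noteq> 1
    \<and> (\<forall>p\<in>{par1, par2, par3, par4, par5}. p x \<noteq> 0 \<and> qinf q (par_a x*q/p x) \<noteq> 0)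
    \<and> qinf q (arg6 q x) \<noteq> 0"
  by (cases x) (auto simp: W87_domain_def arg6_def par_defs)

lemma cdiff_arg6:
  assumes "x \<in> W87_domain q"
  shows "cdiff (arg6 q) x"
proof -
  have "cdiff (\<lambda>x. par_a x^2 * q^2 / (par1 x * par2 x * par3 x * par4 x * par5 x)) x"
    using assms unfolding domain_iff
    by (intro cdiff_divide cdiff_mult cdiff_power cdiff_const cdiff_par) auto
  then show ?thesis unfolding arg6_def[abs_def] W87_arg_def by (simp add: mult_ac)
qed

lemma isCont_nhds: "isCont F x \<Longrightarrow> (F \<longlongrightarrow> F x) (nhds x)"
  unfolding isCont_def tendsto_at_iff_tendsto_nhds .

lemma eventually_neq:
  fixes F :: "'a::t2_space \<Rightarrow> complex"
  assumes "isCont F x" "F x \<noteq> c"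
  shows "eventually (\<lambda>y. F y \<noteq> c) (nhds x)"
proof -
  show ?thesis using isCont_nhds[OF assms(1)] assms(2) by (rule tendsto_imp_eventually_ne)
qed

lemma domain_nbhd:
  assumes q: "norm q < 1" and x: "x \<in> W87_domain q"
  shows "eventually (\<lambda>y. y \<in> W87_domain q) (nhds x)"
proof -
  have cp: "isCont p x" if "p \<in> {par_a, par1, par2, par3, par4, par5}" for p
    using that by (auto intro: cdiff_isCont)
  have "eventually (\<lambda>y. p y \<noteq> 0 \<and> qinf q (par_a y*q/p y) \<noteq> 0) (nhds x)"
    if p: "p \<in> {par1, par2, par3, par4, par5}" for p
  proof (intro eventually_conj eventually_neq)
    show cpx: "isCont p x" using cp p by blast
    show p0: "p x \<noteq> 0" and "qinf q (par_a x*q/p x) \<noteq> 0" using x p unfolding domain_iff by blast+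
    have "isCont (\<lambda>y. par_a y*q/p y) x"
      using cp[of par_a] cpx p0 by (intro continuous_intros) auto
    then show "isCont (\<lambda>y. qinf q (par_a y*q/p y)) x"
      by (rule isCont_o2[OF _ isCont_qinf[OF q]])
  qed
  then have "eventually (\<lambda>y. \<forall>p\<in>{par1, par2, par3, par4, par5}. p y \<noteq> 0 \<and> qinf q (par_a y*q/p y) \<noteq> 0) (nhds x)"
    by (intro eventually_ball_finite) auto
  moreover have "eventually (\<lambda>y. par_a y \<noteq> 0) (nhds x)" "eventually (\<lambda>y. par_a y \<noteq> 1) (nhds x)"
    using x cp[of par_a] unfolding domain_iff by (auto intro!: eventually_neq)
  moreover have "eventually (\<lambda>y. qinf q (arg6 q y) \<noteq> 0) (nhds x)"
  proof (rule eventually_neq)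
    show "isCont (\<lambda>y. qinf q (arg6 q y)) x"
      by (rule isCont_o2[OF cdiff_isCont[OF cdiff_arg6[OF x]] isCont_qinf[OF q]])
  qed (use x in \<open>simp add: domain_iff\<close>)
  ultimately show ?thesis unfolding domain_iff by eventually_elim auto
qed

section \<open>The term ratio as a quotient of polynomials in q^k\<close>

definition lin_prod :: "(params \<Rightarrow> complex) list \<Rightarrow> params \<Rightarrow> complex \<Rightarrow> complex" where
  "lin_prod cs x u = (\<Prod>c\<leftarrow>cs. 1 - c x * u)"

text \<open>In powers of u = q^k, numerator and denominator of the ratio act on the series by moving
  \<open>m\<close> to \<open>m + j\<close>, because u^j (q^m)^k = (q^(m+j))^k. The constant
  coefficient 1 later isolates the factor 1 - q^m z.\<close>

lemma lin_prod_expand: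
  assumes "\<And>c x. c \<in> set cs \<Longrightarrow> x \<in> S \<Longrightarrow> cdiff c x"
  shows "\<exists>d. (\<forall>j. \<forall>x\<in>S. cdiff (d j) x) \<and> (\<forall>x. d 0 x = 1)
    \<and> (\<forall>x u. lin_prod cs x u = (\<Sum>j\<le>length cs. d j x * u^j))"
proof -
  \<comment> \<open>Vanishing beyond the degree is added for the induction, where
    \<open>d (Suc i)\<close> occurs with \<open>i\<close> up to the degree.\<close>
  have "\<exists>d. (\<forall>j. \<forall>x\<in>S. cdiff (d j) x) \<and> (\<forall>x. d 0 x = 1) \<and> (\<forall>x. \<forall>j>length cs. d j x = 0)
    \<and> (\<forall>x u. lin_prod cs x u = (\<Sum>j\<le>length cs. d j x * u^j))"
    using assms
  proof (induction cs)
    case Nil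
    have "cdiff (\<lambda>x. if j = 0 then 1 else 0) x" for j :: nat and x
      by (rule cdiff_const)
    then show ?case
      by (intro exI[of _ "\<lambda>j x. if j = 0 then 1 else 0"]) (auto simp: lin_prod_def)
  next
    case (Cons c cs)
    have "\<exists>d. (\<forall>j. \<forall>x\<in>S. cdiff (d j) x) \<and> (\<forall>x. d 0 x = 1) \<and> (\<forall>x. \<forall>j>length cs. d j x = 0)
      \<and> (\<forall>x u. lin_prod cs x u = (\<Sum>j\<le>length cs. d j x * u^j))"
      by (rule Cons.IH) (use Cons.prems in auto)
    then obtain d where d: "\<And>j x. x \<in> S \<Longrightarrow> cdiff (d j) x" "\<And>x. d 0 x = 1"
      "\<And>x j. j > length cs \<Longrightarrow> d j x = 0" "\<And>x u. lin_prod cs x u = (\<Sum>j\<le>length cs. d j x * u^j)"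
      by blast
    define d' where "d' j x = (case j of 0 \<Rightarrow> d 0 x | Suc i \<Rightarrow> d (Suc i) x - c x * d i x)" for j x
    have "cdiff (d' j) x" if "x \<in> S" for j x
      using d(1)[OF that] Cons.prems[of c, OF _ that]
      by (cases j) (auto simp: d'_def[abs_def] intro!: cdiff_diff cdiff_mult)
    moreover have "lin_prod (c # cs) x u = (\<Sum>j\<le>length (c # cs). d' j x * u^j)" for x u
    proof -
      let ?n = "length cs"
      have "(\<Sum>j\<le>Suc ?n. d' j x * u^j) = d 0 x + (\<Sum>i\<le>?n. (d (Suc i) x - c x * d i x) * u^Suc i)"
        unfolding sum.atMost_Suc_shift by (simp add: d'_def)
      also have "\<dots> = (d 0 x + (\<Sum>i\<le>?n. d (Suc i) x * u^Suc i)) - c x * u * (\<Sum>i\<le>?n. d i x * u^i)"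
        by (simp add: left_diff_distrib right_diff_distrib sum_subtractf sum_distrib_left mult_ac)
      also have "d 0 x + (\<Sum>i\<le>?n. d (Suc i) x * u^Suc i) = (\<Sum>j\<le>Suc ?n. d j x * u^j)"
        using sum.atMost_Suc_shift[of "\<lambda>j. d j x * u^j" ?n] by simp
      also have "\<dots> = (\<Sum>j\<le>?n. d j x * u^j)" using d(3)[of "Suc ?n" x] by simp
      finally show ?thesis by (simp add: lin_prod_def d(4)[unfolded lin_prod_def] left_diff_distrib)
    qed
    moreover have "d' 0 x = 1" for x by (simp add: d'_def d(2))
    moreover have "d' j x = 0" if "j > length (c # cs)" for x j
      using that d(3) by (cases j) (auto simp: d'_def)
    ultimately show ?case by blast
  qed
  then show ?thesis by blast
qed

lemma cdiff_lin_prod: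
  assumes "\<And>c. c \<in> set cs \<Longrightarrow> cdiff c x"
  shows "cdiff (\<lambda>x. lin_prod cs x u) x"
  using assms unfolding lin_prod_def
  by (induction cs) (auto intro!: cdiff_mult cdiff_diff cdiff_const)

lemma isCont_lin_prod:
  assumes "\<And>c. c \<in> set cs \<Longrightarrow> cdiff c x"
  shows "isCont (\<lambda>y. lin_prod cs (fst y) (snd y)) (x, u)"
  using assms unfolding lin_prod_def
proof (induction cs)
  case (Cons c cs)
  have "isCont c (fst (x, u))" using cdiff_isCont Cons.prems by simp
  then have "isCont (\<lambda>y. c (fst y)) (x, u)"
    by (intro isCont_o2[OF isCont_fst[OF continuous_ident]])
  then show ?case using Cons by (auto intro!: continuous_intros)
qed simp

definition num_coeffs :: "(params \<Rightarrow> complex) list" where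
  "num_coeffs = [par_a, par1, par2, par3, par4, par5]"

definition den_coeffs :: "complex \<Rightarrow> (params \<Rightarrow> complex) list" where
  "den_coeffs q = [\<lambda>_. q, \<lambda>x. par_a x*q/par1 x, \<lambda>x. par_a x*q/par2 x, \<lambda>x. par_a x*q/par3 x,
     \<lambda>x. par_a x*q/par4 x, \<lambda>x. par_a x*q/par5 x]"

lemma cdiff_num_coeffs: "c \<in> set num_coeffs \<Longrightarrow> cdiff c x"
  by (auto simp: num_coeffs_def)

lemma cdiff_den_coeffs: "c \<in> set (den_coeffs q) \<Longrightarrow> x \<in> W87_domain q \<Longrightarrow> cdiff c x"
  unfolding domain_iff den_coeffs_def
  by (auto intro!: cdiff_divide cdiff_mult cdiff_const cdiff_par)

lemma den_nz:
  assumes q: "norm q < 1" and x: "x \<in> W87_domain q"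
  shows "lin_prod (den_coeffs q) x (q^k) \<noteq> 0"
proof -
  have "1 - q*q^k \<noteq> 0" using qpoch_qq_nz[OF q, of "Suc k"] by (simp add: qpoch_Suc)
  moreover have "1 - par_a x*q/p x*q^k \<noteq> 0" if "p \<in> {par1, par2, par3, par4, par5}" for p
    using x that qinf_eq_0_iff[OF q, of "par_a x*q/p x"] unfolding domain_iff by auto
  ultimately show ?thesis by (simp add: lin_prod_def den_coeffs_def)
qed

text \<open>The very-well-poised factor is left out. With it the ratio would have the denominator 1
  - a q^(2k), which may vanish on \<open>W87_domain\<close>; without it the denominator is nonzero
  by \<open>den_nz\<close>.\<close>

definition hratio :: "complex \<Rightarrow> params \<Rightarrow> complex \<Rightarrow> complex" where
  "hratio q x u = arg6 q x * lin_prod num_coeffs x u / lin_prod (den_coeffs q) x u"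

definition hterm :: "complex \<Rightarrow> params \<Rightarrow> nat \<Rightarrow> complex" where
  "hterm q x k = 1/(1 - par_a x) * (\<Prod>j<k. hratio q x (q^j))"

definition hser :: "complex \<Rightarrow> nat \<Rightarrow> params \<Rightarrow> complex" where
  "hser q m x = (\<Sum>k. hterm q x k * (q^m)^k)"

lemma hterm_Suc: "hterm q x (Suc k) = hterm q x k * hratio q x (q^k)"
  by (simp add: hterm_def)

text \<open>Expanding 1 - a q^(2k) restores the omitted factor: the very-well-poised series is a
  combination of \<open>hser\<close> with m = 0 and m = 2.\<close>

lemma vterm_hterm:
  "vterm q a p1 p2 p3 p4 p5 (W87_arg q a [p1,p2,p3,p4,p5]) k
    = hterm q (a,p1,p2,p3,p4,p5) k - a * (hterm q (a,p1,p2,p3,p4,p5) k * (q^2)^k)"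
proof -
  let ?x = "(a,p1,p2,p3,p4,p5)"
  have H: "hterm q ?x k = 1/(1-a)
     * ((qpoch q a k * qpoch q p1 k * qpoch q p2 k * qpoch q p3 k * qpoch q p4 k * qpoch q p5 k)
       / (qpoch q q k * qpoch q (a*q/p1) k * qpoch q (a*q/p2) k * qpoch q (a*q/p3) k
          * qpoch q (a*q/p4) k * qpoch q (a*q/p5) k))
     * W87_arg q a [p1,p2,p3,p4,p5]^k"
  proof (induction k)
    case (Suc k)
    show ?case
      unfolding hterm_Suc Suc qpoch_Suc
      by (simp add: hratio_def lin_prod_def num_coeffs_def den_coeffs_def arg6_def par_defs mult_ac)
  qed (simp add: hterm_def par_defs)
  have "(1-a*w)/(1-a)*R*Z = 1/(1-a)*R*Z - a*(1/(1-a)*R*Z*w)" for R Z w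
    by (simp add: diff_divide_distrib left_diff_distrib)
  then show ?thesis unfolding vterm_def power_mult H .
qed

lemma lin_prod_0 [simp]: "lin_prod cs x 0 = 1"
  by (induction cs) (auto simp: lin_prod_def)

lemma cdiff_hterm:
  assumes q: "norm q < 1" and x: "x \<in> W87_domain q"
  shows "cdiff (\<lambda>y. hterm q y k) x"
  unfolding hterm_def hratio_def
proof (intro cdiff_mult cdiff_divide cdiff_prod cdiff_diff cdiff_const cdiff_lin_prod cdiff_arg6 x)
  show "1 - par_a x \<noteq> 0" using x by (auto simp: domain_iff)
qed (auto intro: cdiff_num_coeffs cdiff_den_coeffs x simp: den_nz[OF q x])

lemma hratio_isCont:
  assumes x: "x \<in> W87_domain q"
  shows "isCont (\<lambda>y. hratio q (fst y) (snd y)) (x, 0)"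
proof -
  have "isCont (\<lambda>y. arg6 q (fst y)) (x, 0::complex)"
  proof (rule isCont_o2[OF isCont_fst[OF continuous_ident]])
    show "isCont (arg6 q) (fst (x, 0::complex))" using cdiff_isCont[OF cdiff_arg6[OF x]] by simp
  qed
  moreover have "isCont (\<lambda>y. lin_prod num_coeffs (fst y) (snd y)) (x, 0)"
    by (rule isCont_lin_prod) (rule cdiff_num_coeffs)
  moreover have "isCont (\<lambda>y. lin_prod (den_coeffs q) (fst y) (snd y)) (x, 0)"
    by (rule isCont_lin_prod) (rule cdiff_den_coeffs[OF _ x])
  ultimately show ?thesis
    unfolding hratio_def by (intro continuous_divide continuous_mult) auto
qed

lemma hser_summable:
  assumes q: "norm q < 1" and x: "x \<in> W87_domain q" and z: "norm (arg6 q x * q^m) < 1"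
  shows "summable (\<lambda>k. hterm q x k * (q^m)^k)"
proof -
  have "(\<lambda>k. (x, q^k)) \<longlonglongrightarrow> (x, 0)"
    by (intro tendsto_Pair tendsto_const LIMSEQ_power_zero q)
  from isCont_tendsto_compose[OF hratio_isCont[OF x] this]
  have "(\<lambda>k. hratio q x (q^k)) \<longlonglongrightarrow> arg6 q x" by (simp add: hratio_def)
  then have lim: "(\<lambda>k. hratio q x (q^k) * q^m) \<longlonglongrightarrow> arg6 q x * q^m"
    by (intro tendsto_mult tendsto_const)
  have "summable (\<lambda>k. norm (hterm q x k * (q^m)^k))"
    by (rule ratio_summable[OF _ lim z]) (simp add: hterm_Suc mult_ac)
  then show ?thesis by (rule summable_norm_cancel)
qed

text \<open>\<open>hratio\<close> is jointly continuous at (x, 0), so a single ratio r < 1 bounds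
  the growth of all late terms in a whole neighbourhood of \<open>x\<close>; the Weierstrass test
  then gives uniform convergence.\<close>

lemma cdiff_hser:
  assumes q: "norm q < 1" and x: "x \<in> W87_domain q" and z: "norm (arg6 q x * q^m) < 1"
  shows "cdiff (hser q m) x"
proof -
  define T where "T k y = hterm q y k * (q^m)^k" for k y
  have TS: "T (Suc k) y = T k y * (hratio q y (q^k) * q^m)" for k y
    by (simp add: T_def hterm_Suc mult_ac)
  obtain r where r: "norm (arg6 q x * q^m) < r" "r < 1" using z dense by blast
  have r0: "0 \<le> r" using r(1) norm_ge_zero[of "arg6 q x * q^m"] by linarith
  have "isCont (\<lambda>y. norm (hratio q (fst y) (snd y) * q^m)) (x, 0)"
    by (intro continuous_intros hratio_isCont x)
  then have "((\<lambda>y. norm (hratio q (fst y) (snd y) * q^m)) \<longlongrightarrow> norm (arg6 q x * q^m)) (nhds (x, 0))"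
    using isCont_nhds by (fastforce simp: hratio_def)
  then have "eventually (\<lambda>y. norm (hratio q (fst y) (snd y) * q^m) < r) (nhds (x, 0))"
    using r(1) by (rule order_tendstoD(2))
  \<comment> \<open>\<open>P\<close> controls the parameters, \<open>Q\<close> the variable u = q^k;
    the latter holds for all k from some N on.\<close>
  then obtain P Q where PQ: "eventually P (nhds x)" "eventually Q (nhds 0)"
    "\<And>y u. P y \<Longrightarrow> Q u \<Longrightarrow> norm (hratio q y u * q^m) < r"
    unfolding nhds_prod eventually_prod_filter by auto
  have "eventually (\<lambda>k. Q (q^k)) sequentially"
    using LIMSEQ_power_zero[OF q] PQ(2) by (simp add: filterlim_iff)
  then obtain N where N: "\<And>k. k \<ge> N \<Longrightarrow> Q (q^k)" unfolding eventually_sequentially by blast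
  define B where "B = norm (T N x) + 1"
  have cT: "cdiff (T k) y" if "y \<in> W87_domain q" for k y
    unfolding T_def[abs_def] using that by (intro cdiff_mult cdiff_hterm q cdiff_const)
  have "isCont (\<lambda>y. norm (T N y)) x" using cdiff_isCont[OF cT[OF x]] by (rule isCont_norm)
  then have "((\<lambda>y. norm (T N y)) \<longlongrightarrow> norm (T N x)) (nhds x)"
    by (rule isCont_nhds)
  then have "eventually (\<lambda>y. norm (T N y) < B) (nhds x)"
    by (rule order_tendstoD(2)) (simp add: B_def)
  then have "eventually (\<lambda>y. norm (T N y) < B \<and> P y \<and> y \<in> W87_domain q) (nhds x)"
    using PQ(1) domain_nbhd[OF q x] by eventually_elim auto
  then obtain d where d: "d > 0" "\<And>y. y \<in> ball x d \<Longrightarrow> norm (T N y) < B \<and> P y \<and> y \<in> W87_domain q"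
    unfolding eventually_nhds_metric by (auto simp: dist_commute)
  have bound: "norm (T (N + k) y) \<le> B * r^k" if y: "y \<in> ball x d" for y k
  proof (induction k)
    case 0
    then show ?case using d(2)[OF y] by simp
  next
    case (Suc k)
    have "norm (T (N + Suc k) y) = norm (T (N + k) y) * norm (hratio q y (q^(N+k)) * q^m)"
      by (simp add: TS norm_mult)
    also have "\<dots> \<le> (B * r^k) * r"
    proof (rule mult_mono[OF Suc])
      show "norm (hratio q y (q^(N+k)) * q^m) \<le> r"
        using PQ(3)[OF _ N] d(2)[OF y] by (simp add: less_imp_le)
      show "0 \<le> B * r^k" using r0 by (simp add: B_def)
    qed simp
    finally show ?case by (simp add: mult_ac)
  qed
  have "uniform_limit (ball x d) (\<lambda>n y. \<Sum>k<n. T k y) (\<lambda>y. suminf (\<lambda>k. T k y)) sequentially"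
  proof (rule Weierstrass_m_test_ev)
    have "norm (T k y) \<le> B * r^(k - N)" if "k \<ge> N" "y \<in> ball x d" for k y
      using bound[OF that(2), of "k - N"] that(1) by simp
    then show "\<forall>\<^sub>F k in sequentially. \<forall>y\<in>ball x d. norm (T k y) \<le> B * r^(k - N)"
      unfolding eventually_sequentially by blast
    have "summable (\<lambda>k. B * r^k)" using r r0 by (intro summable_mult summable_geometric) simp
    then show "summable (\<lambda>k. B * r^(k - N))"
      by (subst summable_iff_shift[symmetric, of _ N]) simp
  qed
  then have "cdiff (\<lambda>y. suminf (\<lambda>k. T k y)) x"
  proof (rule cdiff_uniform_limit[OF d(1), rotated])
    fix n y assume "y \<in> ball x d"
    then show "cdiff (\<lambda>y. \<Sum>k<n. T k y) y" using d(2) by (intro cdiff_sum cT) blast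
  qed
  then show ?thesis unfolding T_def hser_def[abs_def] .
qed

text \<open>Summing the recurrence of the terms against \<open>q^(m k)\<close> expresses the series at argument
  \<open>q^m z\<close> by the series at \<open>q^(m+1) z, \<dots>, q^(m+6) z\<close>. Only the argument moves, so the
  sole new denominator is \<open>1 - q^m z\<close>.\<close>

locale hser_continuation =
  fixes q :: complex and dn dd :: "nat \<Rightarrow> params \<Rightarrow> complex"
  assumes q0: "q \<noteq> 0" and q1: "norm q < 1"
    and dn: "\<And>j x. x \<in> W87_domain q \<Longrightarrow> cdiff (dn j) x" "\<And>x. dn 0 x = 1"
      "\<And>x u. lin_prod num_coeffs x u = (\<Sum>j\<le>6. dn j x * u^j)"
    and dd: "\<And>j x. x \<in> W87_domain q \<Longrightarrow> cdiff (dd j) x" "\<And>x. dd 0 x = 1"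
      "\<And>x u. lin_prod (den_coeffs q) x u = (\<Sum>j\<le>6. dd j x * u^j)"
begin

definition step :: "nat \<Rightarrow> (nat \<Rightarrow> params \<Rightarrow> complex) \<Rightarrow> params \<Rightarrow> complex" where
  "step m g x = (1/(1 - par_a x) + (\<Sum>j\<in>{1..6}. arg6 q x * q^m * (dn j x * g (m + j) x)
      - dd j x * (1/q)^j * (g (m + j) x - 1/(1 - par_a x)))) / (1 - arg6 q x * q^m)"

lemma arg_nz: "x \<in> W87_domain q \<Longrightarrow> 1 - arg6 q x * q^m \<noteq> 0"
  using qinf_eq_0_iff[OF q1, of "arg6 q x"] by (auto simp: domain_iff)

lemma arg_mono:
  assumes "norm (arg6 q x * q^m) < 1" "m \<le> n"
  shows "norm (arg6 q x * q^n) < 1"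
proof -
  have "norm q^n \<le> norm q^m" using assms(2) q1 by (intro power_decreasing) auto
  then have "norm (arg6 q x) * norm q^n \<le> norm (arg6 q x) * norm q^m" by (intro mult_left_mono) auto
  then show ?thesis using assms(1) by (simp add: norm_mult norm_power)
qed

lemma hser_step:
  assumes x: "x \<in> W87_domain q" and z: "norm (arg6 q x * q^m) < 1"
  shows "hser q m x = step m (hser q) x"
proof -
  define h where "h k = hterm q x k" for k
  define z where "z = arg6 q x"
  define F where "F j = hser q (m + j) x" for j
  have F: "(\<lambda>k. h k * (q^(m+j))^k) sums F j" for j
    unfolding F_def hser_def h_def
    by (intro summable_sums hser_summable q1 x arg_mono[OF assms(2)]) simp
  have h0: "h 0 = 1/(1 - par_a x)" by (simp add: h_def hterm_def)
  have rec: "(\<Sum>j\<le>6. dd j x * (1/q)^j * (h (Suc k) * (q^(m+j))^Suc k))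
     = (\<Sum>j\<le>6. z * q^m * (dn j x * (h k * (q^(m+j))^k)))" for k
  proof -
    have r: "h (Suc k) * lin_prod (den_coeffs q) x (q^k) = z * (h k * lin_prod num_coeffs x (q^k))"
      using den_nz[OF q1 x, of k] by (simp add: h_def hterm_Suc hratio_def z_def)
    have e1: "(q^(m+j))^k = (q^m)^k * (q^k)^j" for j
      by (simp add: power_add power_mult_distrib power_mult[symmetric] mult.commute)
    \<comment> \<open>The factor (1/q)^j compensates for the weight at index k + 1, which carries
      one more q^j than the recurrence at u = q^k provides.\<close>
    have e2: "(1/q)^j * (q^(m+j))^Suc k = q^m * ((q^m)^k * (q^k)^j)" for j
    proof -
      have "(1/q)^j * (q^(m+j))^Suc k = ((1/q)^j * q^j) * q^m * (q^(m+j))^k"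
        by (simp add: power_add mult_ac)
      then show ?thesis unfolding e1 using q0 by (simp add: power_mult_distrib[symmetric] mult.assoc)
    qed
    have "(\<Sum>j\<le>6. dd j x * (1/q)^j * (h (Suc k) * (q^(m+j))^Suc k))
      = (\<Sum>j\<le>6. (q^m * (q^m)^k) * (h (Suc k) * (dd j x * (q^k)^j)))"
    proof (rule sum.cong[OF refl])
      fix j
      have "dd j x * (1/q)^j * (h (Suc k) * (q^(m+j))^Suc k) = dd j x * h (Suc k) * ((1/q)^j * (q^(m+j))^Suc k)"
        by (simp only: mult_ac)
      then show "dd j x * (1/q)^j * (h (Suc k) * (q^(m+j))^Suc k) = (q^m * (q^m)^k) * (h (Suc k) * (dd j x * (q^k)^j))"
        unfolding e2 by (simp only: mult_ac)
    qed
    also have "\<dots> = (q^m * (q^m)^k) * (h (Suc k) * lin_prod (den_coeffs q) x (q^k))"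
      unfolding dd(3) by (simp only: sum_distrib_left)
    also have "\<dots> = (q^m * (q^m)^k) * (z * (h k * lin_prod num_coeffs x (q^k)))" unfolding r ..
    also have "\<dots> = (\<Sum>j\<le>6. (q^m * (q^m)^k) * (z * (h k * (dn j x * (q^k)^j))))"
      unfolding dn(3) by (simp only: sum_distrib_left)
    also have "\<dots> = (\<Sum>j\<le>6. z * q^m * (dn j x * (h k * (q^(m+j))^k)))"
      unfolding e1 by (simp only: mult_ac)
    finally show ?thesis .
  qed
  have "(\<lambda>k. h (Suc k) * (q^(m+j))^Suc k) sums (F j - h 0)" for j
    using F[of j] by (subst sums_Suc_iff) simp
  then have "(\<lambda>k. \<Sum>j\<le>6. dd j x * (1/q)^j * (h (Suc k) * (q^(m+j))^Suc k))
      sums (\<Sum>j\<le>6. dd j x * (1/q)^j * (F j - h 0))"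
    by (intro sums_sum sums_mult)
  moreover have "(\<lambda>k. \<Sum>j\<le>6. z * q^m * (dn j x * (h k * (q^(m+j))^k)))
      sums (\<Sum>j\<le>6. z * q^m * (dn j x * F j))"
    by (intro sums_sum sums_mult F)
  ultimately have eq: "(\<Sum>j\<le>6. dd j x * (1/q)^j * (F j - h 0)) = (\<Sum>j\<le>6. z * q^m * (dn j x * F j))"
    unfolding rec by (rule sums_unique2)
  \<comment> \<open>The summand j = 0, with both coefficients 1, is the one containing the unknown
    \<open>F 0\<close>; it contributes the factor 1 - z q^m.\<close>
  have split: "(\<Sum>j\<le>6. g j) = g 0 + (\<Sum>j\<in>{1..6}. g j)" for g :: "nat \<Rightarrow> complex"
  proof -
    have "{..6} = insert 0 {1..6::nat}" by auto
    then show ?thesis by simp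
  qed
  have "(1 - z*q^m) * F 0 = h 0 + (\<Sum>j\<in>{1..6}. z * q^m * (dn j x * F j) - dd j x * (1/q)^j * (F j - h 0))"
  proof -
    define s1 where "s1 = (\<Sum>j\<in>{1..6}. dd j x * (1/q)^j * (F j - h 0))"
    define s2 where "s2 = (\<Sum>j\<in>{1..6}. z * q^m * (dn j x * F j))"
    have "F 0 - h 0 + s1 = z * q^m * F 0 + s2"
      using eq unfolding split s1_def[symmetric] s2_def[symmetric] by (simp add: dd(2) dn(2))
    then have "(1 - z*q^m) * F 0 = h 0 + (s2 - s1)" by (simp add: algebra_simps)
    then show ?thesis unfolding s1_def s2_def sum_subtractf .
  qed
  then have "F 0 = (h 0 + (\<Sum>j\<in>{1..6}. z * q^m * (dn j x * F j) - dd j x * (1/q)^j * (F j - h 0))) / (1 - z*q^m)"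
    using arg_nz[OF x, of m] by (simp add: z_def nonzero_eq_divide_eq mult.commute)
  then show ?thesis unfolding step_def h0 F_def z_def by simp
qed

text \<open>\<open>N\<close> bounds the depth of backward steps taken until the series converges;
  the value is meaningful where |q^(m+N) z| < 1. Elsewhere the recursion may end in a series that
  does not converge.\<close>

primrec fc :: "nat \<Rightarrow> nat \<Rightarrow> params \<Rightarrow> complex" where
  "fc 0 = hser q"
| "fc (Suc N) = (\<lambda>m x. if norm (arg6 q x * q^m) < 1 then hser q m x else step m (fc N) x)"

lemma fc_series: "norm (arg6 q x * q^m) < 1 \<Longrightarrow> fc N m x = hser q m x"
  by (cases N) auto

lemma step_cong: "(\<And>j. j \<in> {1..6} \<Longrightarrow> g (m + j) x = g' (m + j) x) \<Longrightarrow> step m g x = step m g' x"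
  unfolding step_def by (auto intro!: sum.cong arg_cong2[where f = "(/)"] arg_cong2[where f = "(+)"])

lemma fc_stable: "norm (arg6 q x * q^(m + N)) < 1 \<Longrightarrow> fc (N + i) m x = fc N m x"
proof (induction N arbitrary: m)
  case 0
  then show ?case using fc_series[of x m i] by simp
next
  case (Suc N)
  have "fc (N + i) (m + j) x = fc N (m + j) x" if "j \<in> {1..6}" for j
    using that by (intro Suc.IH arg_mono[OF Suc.prems]) auto
  then show ?case using step_cong[of "fc (N + i)" m x "fc N"] by simp
qed

text \<open>Where the series converges it obeys the step as well, so the case distinction disappears
  and a single formula is left to differentiate.\<close>

lemma fc_step:
  assumes "x \<in> W87_domain q"
  shows "fc (Suc N) m x = step m (fc N) x"
proof (cases "norm (arg6 q x * q^m) < 1")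
  case True
  have "step m (hser q) x = step m (fc N) x"
    by (rule step_cong) (use fc_series arg_mono[OF True] in auto)
  then show ?thesis using True hser_step[OF assms True] by simp
qed simp

lemma arg_open:
  assumes "x \<in> W87_domain q" "norm (arg6 q x * q^m) < 1"
  shows "eventually (\<lambda>y. y \<in> W87_domain q \<and> norm (arg6 q y * q^m) < 1) (nhds x)"
proof -
  have "isCont (\<lambda>y. norm (arg6 q y * q^m)) x"
    using cdiff_isCont[OF cdiff_arg6[OF assms(1)]] by (intro continuous_intros)
  then have "((\<lambda>y. norm (arg6 q y * q^m)) \<longlongrightarrow> norm (arg6 q x * q^m)) (nhds x)"
    by (rule isCont_nhds)
  then have "eventually (\<lambda>y. norm (arg6 q y * q^m) < 1) (nhds x)"
    using assms(2) by (rule order_tendstoD(2))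
  then show ?thesis using domain_nbhd[OF q1 assms(1)] by eventually_elim auto
qed

lemma cdiff_fc:
  assumes "x \<in> W87_domain q" "norm (arg6 q x * q^(m + N)) < 1"
  shows "cdiff (fc N m) x"
  using assms
proof (induction N arbitrary: m)
  case 0
  then show ?case using cdiff_hser[OF q1] by simp
next
  case (Suc N)
  have IH: "cdiff (fc N (m + j)) x" if "j \<in> {1..6}" for j
    using that by (intro Suc.IH Suc.prems(1) arg_mono[OF Suc.prems(2)]) auto
  have "1 - par_a x \<noteq> 0" using Suc.prems(1) by (auto simp: domain_iff)
  then have "cdiff (step m (fc N)) x"
    unfolding step_def[abs_def]
    by (intro cdiff_divide cdiff_add cdiff_sum cdiff_diff cdiff_mult cdiff_const cdiff_par
        cdiff_arg6 dn(1) dd(1) IH Suc.prems(1) arg_nz)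
  moreover have "eventually (\<lambda>y. step m (fc N) y = fc (Suc N) m y) (nhds x)"
    using domain_nbhd[OF q1 Suc.prems(1)] by eventually_elim (rule fc_step[symmetric])
  ultimately show ?case by (rule cdiff_transform)
qed

text \<open>This depth may jump with \<open>x\<close>, but by \<open>cont_eq\<close> every
  sufficient depth gives the same value, so near a point one fixed depth can be used.\<close>

definition level :: "params \<Rightarrow> nat" where
  "level x = (LEAST N. norm (arg6 q x * q^N) < 1)"

lemma level: "norm (arg6 q x * q^level x) < 1"
  unfolding level_def
proof (rule LeastI_ex)
  have "(\<lambda>N. norm (arg6 q x * q^N)) \<longlonglongrightarrow> norm (arg6 q x * 0)"
    by (intro tendsto_intros LIMSEQ_power_zero q1)
  then have "eventually (\<lambda>N. norm (arg6 q x * q^N) < 1) sequentially"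
    by (intro order_tendstoD(2)[of _ "norm (arg6 q x * 0)"]) auto
  then show "\<exists>N. norm (arg6 q x * q^N) < 1" by (auto simp: eventually_sequentially)
qed

definition cont :: "nat \<Rightarrow> params \<Rightarrow> complex" where
  "cont m x = fc (level x) m x"

lemma cont_eq: "norm (arg6 q x * q^N) < 1 \<Longrightarrow> cont m x = fc N m x"
proof -
  assume N: "norm (arg6 q x * q^N) < 1"
  then have "level x \<le> N" unfolding level_def by (rule Least_le)
  then obtain i where i: "N = level x + i" using le_Suc_ex by blast
  have "norm (arg6 q x * q^(m + level x)) < 1" by (rule arg_mono[OF level]) simp
  then show ?thesis unfolding cont_def i by (rule fc_stable[symmetric])
qed

lemma cdiff_cont:
  assumes x: "x \<in> W87_domain q"
  shows "cdiff (cont m) x"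
proof -
  let ?N = "level x"
  have "norm (arg6 q x * q^(m + ?N)) < 1" by (rule arg_mono[OF level]) simp
  then have "cdiff (fc ?N m) x" using x by (intro cdiff_fc)
  moreover have "eventually (\<lambda>y. fc ?N m y = cont m y) (nhds x)"
    using arg_open[OF x level] by eventually_elim (use cont_eq in auto)
  ultimately show ?thesis by (rule cdiff_transform)
qed

definition W87_cont :: "params \<Rightarrow> complex" where
  "W87_cont x = cont 0 x - par_a x * cont 2 x"

lemma W87_continuation_cont: "W87_continuation q W87_cont"
  unfolding W87_continuation_def
proof (intro conjI allI impI)
  show "holomorphic6_on W87_cont (W87_domain q)"
    unfolding holomorphic6_on_iff_cdiff W87_cont_def[abs_def]
    by (intro ballI cdiff_diff cdiff_mult cdiff_par cdiff_cont)
  fix a p1 p2 p3 p4 p5 :: complex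
  let ?x = "(a, p1, p2, p3, p4, p5)"
  assume A: "?x \<in> W87_domain q \<and> norm (W87_arg q a [p1, p2, p3, p4, p5]) < 1"
  have pa: "par_a ?x = a" by (simp add: par_a_def)
  have z: "norm (arg6 q ?x * q^0) < 1" using A by (simp add: arg6_def par_defs)
  have z2: "norm (arg6 q ?x * q^2) < 1" by (rule arg_mono[OF z]) simp
  have "cont 0 ?x = hser q 0 ?x" "cont 2 ?x = hser q 2 ?x"
    using cont_eq[OF z] by simp_all
  moreover have "(\<lambda>k. hterm q ?x k * (q^0)^k - a * (hterm q ?x k * (q^2)^k)) sums (hser q 0 ?x - a * hser q 2 ?x)"
    unfolding hser_def
    using A z z2 by (intro sums_diff sums_mult summable_sums hser_summable q1) auto
  ultimately show "W87_cont ?x = W87_series q a [p1, p2, p3, p4, p5]"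
    unfolding W87_cont_def pa W87_series_vser vser_def vterm_hterm
    by (simp add: sums_iff)
qed

end

section \<open>Existence and uniqueness of the continuation\<close>

theorem W87_continuation_exists:
  assumes "q \<noteq> 0" "norm q < 1"
  shows "\<exists>F. W87_continuation q F"
proof -
  have "\<exists>d. (\<forall>j. \<forall>x\<in>W87_domain q. cdiff (d j) x) \<and> (\<forall>x. d 0 x = 1)
    \<and> (\<forall>x u. lin_prod num_coeffs x u = (\<Sum>j\<le>length num_coeffs. d j x * u^j))"
    by (rule lin_prod_expand) (rule cdiff_num_coeffs)
  then obtain dn where dn: "\<And>j x. x \<in> W87_domain q \<Longrightarrow> cdiff (dn j) x" "\<And>x. dn 0 x = 1"
      "\<And>x u. lin_prod num_coeffs x u = (\<Sum>j\<le>length num_coeffs. dn j x * u^j)" by blast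
  have "\<exists>d. (\<forall>j. \<forall>x\<in>W87_domain q. cdiff (d j) x) \<and> (\<forall>x. d 0 x = 1)
    \<and> (\<forall>x u. lin_prod (den_coeffs q) x u = (\<Sum>j\<le>length (den_coeffs q). d j x * u^j))"
    by (rule lin_prod_expand) (rule cdiff_den_coeffs)
  then obtain dd where dd: "\<And>j x. x \<in> W87_domain q \<Longrightarrow> cdiff (dd j) x" "\<And>x. dd 0 x = 1"
      "\<And>x u. lin_prod (den_coeffs q) x u = (\<Sum>j\<le>length (den_coeffs q). dd j x * u^j)" by blast
  have l: "length num_coeffs = 6" "length (den_coeffs q) = 6"
    by (simp_all add: num_coeffs_def den_coeffs_def)
  interpret hser_continuation q dn dd
    by unfold_locales (rule assms dn(1,2) dd(1,2) dn(3)[unfolded l] dd(3)[unfolded l] | assumption)+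
  show ?thesis using W87_continuation_cont by blast
qed

text \<open>The complement of a countable set is connected, so nothing about the shape of
  \<open>S\<close> has to be known. Nonempty open sets are uncountable, so the points of agreement
  accumulate inside \<open>S\<close> even after \<open>C\<close> is removed.\<close>

lemma curve_identity:
  fixes f g :: "complex \<Rightarrow> complex"
  assumes O: "open S" "countable (- S)" and hol: "f holomorphic_on S" "g holomorphic_on S"
    and U: "open U" "U \<noteq> {}" and C: "countable C"
    and eq: "\<And>t. t \<in> U \<Longrightarrow> t \<in> S \<Longrightarrow> t \<notin> C \<Longrightarrow> f t = g t" and w: "w \<in> S"
  shows "f w = g w"
proof -
  have unc: "\<exists>t\<in>V. t \<notin> B" if V: "open V" "V \<noteq> {}" and B: "countable B" for V B :: "complex set"
  proof (rule ccontr)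
    assume "\<not> (\<exists>t\<in>V. t \<notin> B)"
    then have "countable V" using B countable_subset[of V B] by blast
    moreover obtain y d where "d > 0" "ball y d \<subseteq> V" using V open_contains_ball by blast
    ultimately show False using countable_subset uncountable_ball by blast
  qed
  obtain y where y: "y \<in> U" "y \<in> S" using unc[OF U O(2)] by blast
  have conn: "connected S"
    using connected_open_diff_countable[of "UNIV :: complex set" "- S"] O(2) connected_UNIV by (simp add: Compl_eq_Diff_UNIV[symmetric])
  have "f w - g w = 0"
  proof (rule analytic_continuation[where f = "\<lambda>t. f t - g t" and S = S and U = "U \<inter> S - C" and \<xi> = y])
    show "y islimpt (U \<inter> S - C)"
      unfolding islimpt_def
    proof (intro allI impI)
      fix T assume "y \<in> T" "open T"
      then have "open (T \<inter> (U \<inter> S))" "T \<inter> (U \<inter> S) \<noteq> {}" using y O(1) U(1) by auto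
      then obtain t where "t \<in> T \<inter> (U \<inter> S)" "t \<notin> insert y C" using unc[OF _ _ countable_insert[OF C]] by blast
      then show "\<exists>t\<in>U \<inter> S - C. t \<in> T \<and> t \<noteq> y" by blast
    qed
    show "f t - g t = 0" if "t \<in> U \<inter> S - C" for t using eq[of t] that by simp
  qed (use O hol w y conn in \<open>auto intro: holomorphic_on_diff\<close>)
  then show ?thesis by simp
qed

lemma open_W87_domain:
  assumes "norm q < 1"
  shows "open (W87_domain q)"
proof (subst open_subopen, intro ballI)
  fix x assume "x \<in> W87_domain q"
  with assms have "eventually (\<lambda>y. y \<in> W87_domain q) (nhds x)" by (rule domain_nbhd)
  then show "\<exists>T. open T \<and> x \<in> T \<and> T \<subseteq> W87_domain q" unfolding eventually_nhds by blast
qed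

lemma holomorphic_continuation_curve:
  assumes F: "W87_continuation q F" and S: "open S"
    and hol: "g holomorphic_on S" "g1 holomorphic_on S" "g2 holomorphic_on S" "g3 holomorphic_on S"
      "g4 holomorphic_on S" "g5 holomorphic_on S"
    and dom: "\<And>t. t \<in> S \<Longrightarrow> (g t, g1 t, g2 t, g3 t, g4 t, g5 t) \<in> W87_domain q"
  shows "(\<lambda>t. F (g t, g1 t, g2 t, g3 t, g4 t, g5 t)) holomorphic_on S"
  unfolding holomorphic_on_open[OF S]
proof
  fix t assume t: "t \<in> S"
  have d: "\<exists>D. (h has_field_derivative D) (at t)" if "h holomorphic_on S" for h
    using that t unfolding holomorphic_on_open[OF S] by blast
  obtain D D1 D2 D3 D4 D5 where D: "(g has_field_derivative D) (at t)"
    "(g1 has_field_derivative D1) (at t)" "(g2 has_field_derivative D2) (at t)"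
    "(g3 has_field_derivative D3) (at t)" "(g4 has_field_derivative D4) (at t)"
    "(g5 has_field_derivative D5) (at t)"
    using d[OF hol(1)] d[OF hol(2)] d[OF hol(3)] d[OF hol(4)] d[OF hol(5)] d[OF hol(6)] by blast
  let ?c = "\<lambda>t. (g t, g1 t, g2 t, g3 t, g4 t, g5 t)"
  have "cdiff F (?c t)"
    using F dom[OF t] unfolding W87_continuation_def holomorphic6_on_iff_cdiff by blast
  then obtain L where L: "(F has_derivative L) (at (?c t))" "\<And>c v. L (csmul c v) = c * L v"
    unfolding cdiff_def by blast
  have "(?c has_derivative (\<lambda>h. (D*h, D1*h, D2*h, D3*h, D4*h, D5*h))) (at t)"
    using D unfolding has_field_derivative_def by (intro has_derivative_Pair)
  moreover have "(\<lambda>h. (D*h, D1*h, D2*h, D3*h, D4*h, D5*h)) = (\<lambda>h. csmul h (D, D1, D2, D3, D4, D5))"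
    by (simp add: mult.commute)
  ultimately have "(?c has_derivative (\<lambda>h. csmul h (D, D1, D2, D3, D4, D5))) (at t)" by simp
  from diff_chain_at[OF this L(1)]
  have "((\<lambda>t. F (?c t)) has_field_derivative L (D, D1, D2, D3, D4, D5)) (at t)"
    unfolding has_field_derivative_def o_def L(2) by (simp add: mult.commute[of _ "L (D, D1, D2, D3, D4, D5)"] mult_commute_abs)
  then show "\<exists>f'. ((\<lambda>t. F (?c t)) has_field_derivative f') (at t)" by blast
qed

text \<open>Scaling \<open>p5\<close> by t divides the argument by t, so every point lies on a
  complex line that reaches the region of convergence and has only countably many singular t. This
  replaces a proof that \<open>W87_domain\<close> is connected.\<close>

theorem W87_continuation_unique:
  assumes q0: "q \<noteq> 0" and q1: "norm q < 1" and F: "W87_continuation q F" and G: "W87_continuation q G"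
    and x: "x \<in> W87_domain q"
  shows "F x = G x"
proof -
  obtain a p1 p2 p3 p4 p5 where xe: "x = (a, p1, p2, p3, p4, p5)" by (cases x)
  define z where "z = W87_arg q a [p1, p2, p3, p4, p5]"
  define S where "S = {t. t \<noteq> 0 \<and> (a, p1, p2, p3, p4, p5*t) \<in> W87_domain q}"
  have nz: "a \<noteq> 0" "a \<noteq> 1" "p1 \<noteq> 0" "p2 \<noteq> 0" "p3 \<noteq> 0" "p4 \<noteq> 0" "p5 \<noteq> 0"
    "qinf q (a*q/p1) \<noteq> 0" "qinf q (a*q/p2) \<noteq> 0" "qinf q (a*q/p3) \<noteq> 0" "qinf q (a*q/p4) \<noteq> 0"
    using x unfolding xe W87_domain_def by auto
  have zt: "W87_arg q a [p1, p2, p3, p4, p5*t] = z/t" if "t \<noteq> 0" for t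
    using that by (simp add: z_def W87_arg_def)
  have dom: "(a, p1, p2, p3, p4, p5*t) \<in> W87_domain q \<longleftrightarrow> qinf q (a*q/p5/t) \<noteq> 0 \<and> qinf q (z/t) \<noteq> 0"
    if "t \<noteq> 0" for t
    using that nz unfolding W87_domain_def by (simp add: zt)
  have cnt: "countable {t. t \<noteq> 0 \<and> qinf q (y/t) = 0}" for y
  proof (rule countable_subset)
    show "{t. t \<noteq> 0 \<and> qinf q (y/t) = 0} \<subseteq> range (\<lambda>j. y * q^j)"
      using qinf_eq_0_iff[OF q1] by (auto simp: field_simps)
  qed simp
  have "- S \<subseteq> {0} \<union> ({t. t \<noteq> 0 \<and> qinf q (a*q/p5/t) = 0} \<union> {t. t \<noteq> 0 \<and> qinf q (z/t) = 0})"
    using dom by (auto simp: S_def)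
  then have cS: "countable (- S)"
    by (rule countable_subset) (intro countable_Un cnt countable_insert countable_empty)
  have "S = (- {0}) \<inter> (\<lambda>t. (a, p1, p2, p3, p4, p5*t)) -` W87_domain q" by (auto simp: S_def)
  moreover have "open \<dots>"
    by (intro continuous_open_preimage continuous_intros open_W87_domain q1)
  ultimately have oS: "open S" by simp
  have hol: "(\<lambda>t. H (a, p1, p2, p3, p4, p5*t)) holomorphic_on S" if "W87_continuation q H" for H
    by (rule holomorphic_continuation_curve[OF that oS]) (auto intro!: holomorphic_intros simp: S_def)
  have "F (a, p1, p2, p3, p4, p5*1) = G (a, p1, p2, p3, p4, p5*1)"
  proof (rule curve_identity[where S = S and U = "- cball 0 (norm z)" and C = "{}"
        and f = "\<lambda>t. F (a, p1, p2, p3, p4, p5*t)" and g = "\<lambda>t. G (a, p1, p2, p3, p4, p5*t)", OF oS cS hol[OF F] hol[OF G]])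
    show "- cball 0 (norm z) \<noteq> ({} :: complex set)"
    proof -
      have "of_real (norm z + 1) \<in> - cball (0::complex) (norm z)" by (simp add: dist_norm del: of_real_add)
      then show ?thesis by blast
    qed
    fix t assume t: "t \<in> - cball 0 (norm z)" "t \<in> S"
    then have "norm (W87_arg q a [p1, p2, p3, p4, p5*t]) < 1"
      by (auto simp: S_def zt norm_divide field_simps)
    then show "F (a, p1, p2, p3, p4, p5*t) = G (a, p1, p2, p3, p4, p5*t)"
      using F G t(2) unfolding W87_continuation_def S_def by simp
  qed (use x xe in \<open>auto simp: S_def\<close>)
  then show ?thesis by (simp add: xe)
qed

theorem W87_eq_continuation:
  assumes q: "q \<noteq> 0" "norm q < 1" and F: "W87_continuation q F"
    and x: "(a, p1, p2, p3, p4, p5) \<in> W87_domain q"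
  shows "W87 q a p1 p2 p3 p4 p5 = F (a, p1, p2, p3, p4, p5)"
proof (cases "norm (W87_arg q a [p1, p2, p3, p4, p5]) < 1")
  case True
  then show ?thesis using F x unfolding W87_def W87_continuation_def by simp
next
  case False
  have "(THE w. \<exists>F. W87_continuation q F \<and> w = F (a, p1, p2, p3, p4, p5)) = F (a, p1, p2, p3, p4, p5)"
    by (rule the_equality) (use F W87_continuation_unique[OF q _ F x] in blast)+
  then show ?thesis using False by (simp add: W87_def)
qed

section \<open>The identity\<close>

text \<open>The Laurent monomials whose genericity is required by \<open>generic_params\<close>, by
  the nonzero limit in \<open>wron_b_closed\<close>, or by the four memberships in
  \<open>W87_domain\<close>.\<close>

definition monomials :: "complex \<Rightarrow> complex \<Rightarrow> complex \<Rightarrow> complex \<Rightarrow> complex \<Rightarrow> complex \<Rightarrow> complex \<Rightarrow> complex set" where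
  "monomials q a b c d e f = {c*d*e/a^2, b^2/a, c/a, d/a, e/a, c*d*e*f/a^2, b*c*d*e/a^2, f, b,
     b/a, b/c, b/d, b/e, b/f, b*c/a, b*d/a, b*e/a, b*f/a, a^2*q^2/(b*c*d*e*f), c, d, e}"

text \<open>For each integer k the equation m t^n = q^k has finitely many roots, so the bad t form a
  countable union of finite sets.\<close>

lemma countable_not_generic:
  assumes "m \<noteq> 0" "n > 0"
  shows "countable {t. \<not> generic q (m * t^n)}"
proof -
  have sub: "{t. \<not> generic q (m * t^n)} \<subseteq> {t. t^n = 0} \<union> (\<Union>k::int. {t. t^n = q powi k / m})"
    using assms by (auto simp: generic_def field_simps)
  have R: "countable {t::complex. t^n = c}" for c
    using finite_nth_roots[OF assms(2)] by (rule countable_finite)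
  have "countable ({t::complex. t^n = 0} \<union> (\<Union>k::int. {t. t^n = q powi k / m}))"
    by (intro countable_Un countable_UN countableI_type R)
  then show ?thesis by (rule countable_subset[OF sub])
qed

lemma countable_not_generic_monomials:
  assumes "q \<noteq> 0" "a \<noteq> 0" "b \<noteq> 0" "c \<noteq> 0" "d \<noteq> 0" "e \<noteq> 0" "f \<noteq> 0"
  shows "countable {t. \<not> (t \<noteq> 0 \<and> (\<forall>x\<in>monomials q (a*t) (b*t^3) (c/t) (d/t) (e/t) (f*t). generic q x))}"
proof -
  \<comment> \<open>Coefficients and exponents of the monomials along the curve. A monomial with a
    negative power of t is listed by its reciprocal, which is generic along with it, so all
    exponents are positive.\<close>
  define E where "E = {(a^2/(c*d*e), 5::nat), (b^2/a, 5), (a/c, 2), (a/d, 2), (a/e, 2),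
    (a^2/(c*d*e*f), 4), (a^2/(b*c*d*e), 2), (f, 1), (b, 3), (b/a, 2), (b/c, 4), (b/d, 4), (b/e, 4), (b/f, 2),
    (b*c/a, 1), (b*d/a, 1), (b*e/a, 1), (b*f/a, 3), (a^2*q^2/(b*c*d*e*f), 1), (1/c, 1), (1/d, 1), (1/e, 1)}"
  have "\<forall>x\<in>monomials q (a*t) (b*t^3) (c/t) (d/t) (e/t) (f*t). generic q x"
    if t: "t \<noteq> 0" and E: "\<And>m n. (m, n) \<in> E \<Longrightarrow> generic q (m * t^n)" for t
  proof -
    have pos: "generic q x" if "(m, n) \<in> E" "x = m * t^n" for m n x
      using E[OF that(1)] that(2) by simp
    have neg: "generic q x" if "(m, n) \<in> E" "x = 1 / (m * t^n)" for m n x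
      using generic_inverse[OF E[OF that(1)] assms(1)] that(2) by simp
    have g0: "generic q ((c/t)*(d/t)*(e/t)/(a*t)^2)"
      by (rule neg[of "a^2/(c*d*e)" 5], simp add: E_def)
        (use t assms in \<open>simp add: field_simps eval_nat_numeral\<close>)
    have g1: "generic q ((b*t^3)^2/(a*t))"
      by (rule pos[of "b^2/a" 5], simp add: E_def)
        (use t assms in \<open>simp add: field_simps eval_nat_numeral\<close>)
    have g2: "generic q ((c/t)/(a*t))"
      by (rule neg[of "a/c" 2], simp add: E_def)
        (use t assms in \<open>simp add: field_simps eval_nat_numeral\<close>)
    have g3: "generic q ((d/t)/(a*t))"
      by (rule neg[of "a/d" 2], simp add: E_def)
        (use t assms in \<open>simp add: field_simps eval_nat_numeral\<close>)
    have g4: "generic q ((e/t)/(a*t))"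
      by (rule neg[of "a/e" 2], simp add: E_def)
        (use t assms in \<open>simp add: field_simps eval_nat_numeral\<close>)
    have g5: "generic q ((c/t)*(d/t)*(e/t)*(f*t)/(a*t)^2)"
      by (rule neg[of "a^2/(c*d*e*f)" 4], simp add: E_def)
        (use t assms in \<open>simp add: field_simps eval_nat_numeral\<close>)
    have g6: "generic q (b*t^3*(c/t)*(d/t)*(e/t)/(a*t)^2)"
      by (rule neg[of "a^2/(b*c*d*e)" 2], simp add: E_def)
        (use t assms in \<open>simp add: field_simps eval_nat_numeral\<close>)
    have g7: "generic q (f*t)"
      by (rule pos[of "f" 1], simp add: E_def)
        (use t assms in \<open>simp add: field_simps eval_nat_numeral\<close>)
    have g8: "generic q (b*t^3)"
      by (rule pos[of "b" 3], simp add: E_def)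
        (use t assms in \<open>simp add: field_simps eval_nat_numeral\<close>)
    have g9: "generic q (b*t^3/(a*t))"
      by (rule pos[of "b/a" 2], simp add: E_def)
        (use t assms in \<open>simp add: field_simps eval_nat_numeral\<close>)
    have g10: "generic q (b*t^3/(c/t))"
      by (rule pos[of "b/c" 4], simp add: E_def)
        (use t assms in \<open>simp add: field_simps eval_nat_numeral\<close>)
    have g11: "generic q (b*t^3/(d/t))"
      by (rule pos[of "b/d" 4], simp add: E_def)
        (use t assms in \<open>simp add: field_simps eval_nat_numeral\<close>)
    have g12: "generic q (b*t^3/(e/t))"
      by (rule pos[of "b/e" 4], simp add: E_def)
        (use t assms in \<open>simp add: field_simps eval_nat_numeral\<close>)
    have g13: "generic q (b*t^3/(f*t))"
      by (rule pos[of "b/f" 2], simp add: E_def)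
        (use t assms in \<open>simp add: field_simps eval_nat_numeral\<close>)
    have g14: "generic q (b*t^3*(c/t)/(a*t))"
      by (rule pos[of "b*c/a" 1], simp add: E_def)
        (use t assms in \<open>simp add: field_simps eval_nat_numeral\<close>)
    have g15: "generic q (b*t^3*(d/t)/(a*t))"
      by (rule pos[of "b*d/a" 1], simp add: E_def)
        (use t assms in \<open>simp add: field_simps eval_nat_numeral\<close>)
    have g16: "generic q (b*t^3*(e/t)/(a*t))"
      by (rule pos[of "b*e/a" 1], simp add: E_def)
        (use t assms in \<open>simp add: field_simps eval_nat_numeral\<close>)
    have g17: "generic q (b*t^3*(f*t)/(a*t))"
      by (rule pos[of "b*f/a" 3], simp add: E_def)
        (use t assms in \<open>simp add: field_simps eval_nat_numeral\<close>)
    have g18: "generic q ((a*t)^2*q^2/(b*t^3*(c/t)*(d/t)*(e/t)*(f*t)))"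
      by (rule pos[of "a^2*q^2/(b*c*d*e*f)" 1], simp add: E_def)
        (use t assms in \<open>simp add: field_simps eval_nat_numeral\<close>)
    have g19: "generic q (c/t)"
      by (rule neg[of "1/c" 1], simp add: E_def)
        (use t assms in \<open>simp add: field_simps eval_nat_numeral\<close>)
    have g20: "generic q (d/t)"
      by (rule neg[of "1/d" 1], simp add: E_def)
        (use t assms in \<open>simp add: field_simps eval_nat_numeral\<close>)
    have g21: "generic q (e/t)"
      by (rule neg[of "1/e" 1], simp add: E_def)
        (use t assms in \<open>simp add: field_simps eval_nat_numeral\<close>)
    show ?thesis
      unfolding monomials_def ball_simps
      by (intro conjI TrueI g0 g1 g2 g3 g4 g5 g6 g7 g8 g9 g10 g11 g12 g13 g14 g15 g16 g17 g18 g19 g20 g21)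
  qed
  note gen = this
  have sub: "{t. \<not> (t \<noteq> 0 \<and> (\<forall>x\<in>monomials q (a*t) (b*t^3) (c/t) (d/t) (e/t) (f*t). generic q x))}
     \<subseteq> {0} \<union> (\<Union>p\<in>E. {t. \<not> generic q (fst p * t^snd p)})"
  proof (rule subsetI, rule ccontr)
    fix t assume t: "t \<in> {t. \<not> (t \<noteq> 0 \<and> (\<forall>x\<in>monomials q (a*t) (b*t^3) (c/t) (d/t) (e/t) (f*t). generic q x))}"
      "t \<notin> {0} \<union> (\<Union>p\<in>E. {t. \<not> generic q (fst p * t^snd p)})"
    have t0: "t \<noteq> 0" and "\<And>p. p \<in> E \<Longrightarrow> generic q (fst p * t^snd p)" using t(2) by blast+
    then have "generic q (m * t^n)" if "(m, n) \<in> E" for m n using that by fastforce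
    from gen[OF t0 this] show False using t(1) t0 by blast
  qed
  have "\<forall>p\<in>E. fst p \<noteq> 0 \<and> snd p > 0"
    unfolding E_def ball_simps using assms by simp
  then have "countable (\<Union>p\<in>E. {t. \<not> generic q (fst p * t^snd p)})"
    by (intro countable_UN countable_not_generic) (auto simp: E_def)
  then show ?thesis
    by (intro countable_subset[OF sub] countable_Un countable_insert countable_empty)
qed

text \<open>This is 1 - q times the bracket of the theorem, with the factors 1/(1 - q) cancelled.
  The four series are arguments, so that convergent sums and values of a continuation can both be
  inserted.\<close>

definition bracket :: "complex \<Rightarrow> complex \<Rightarrow> complex \<Rightarrow> complex \<Rightarrow> complex \<Rightarrow> complex \<Rightarrow> complex
    \<Rightarrow> complex \<Rightarrow> complex \<Rightarrow> complex \<Rightarrow> complex \<Rightarrow> complex" where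
  "bracket q a b c d e f W2 W2p W3 W3p = (let s = a^3*q^3/(b*c*d*e*f) in
     ((q + c * s/(a*q) + d * s/(a*q) + e * s/(a*q) + a^2*q/(c*d*e) + a*q/f + a*q/b - a*q^2/(b*f))
       - (a*q/c + a*q/d + a*q/e + a*q/f + b * s/(a*q) + q + s/(b*q) - b*q)) * W2 * W3
     - (b*f * s/(a*q^2) * (1 - b*f/(a*q)) * (1 - c*d*e*q/a^2) * (1 - c*d*e*q^2/a^2)
                   * (1 - c*d/a) * (1 - c*e/a) * (1 - d*e/a) * (1 - q/f) * (1 - q/b))
                  / ((1 - c*q/a) * (1 - d*q/a) * (1 - e*q/a)
                     * (1 - c*d*e*f/a^2) * (1 - b*c*d*e/a^2)) * W2p * W3
     + (s/(b*q) * (1 - s/(a*q^2)) * (1 - b^2*q/a) * (1 - b^2*q^2/a)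
                   * (1 - b*c/a) * (1 - b*d/a) * (1 - b*e/a) * (1 - b*f/a) * (1 - b))
                  / ((1 - b*q/c) * (1 - b*q/d) * (1 - b*q/e) * (1 - b*q/f)
                     * (1 - b*q/a)) * W2 * W3p)"

context generic_params
begin

text \<open>Up to the factor q/z2, the first sum in \<open>bracket\<close> is the symmetric
  coefficient of \<open>contiguous_down\<close> for W2, and the second, although written for W3, is
  the remaining coefficient \<open>m5\<close>. The relation therefore replaces all terms with W3
  unraised by a single one with the lowered W2.\<close>

lemma bracket_wron_b: "bracket q a b c d e f X.phi X.phi_plus Y.phi Y.phi_plus = wron_b q a b c d e f"
proof -
  define s where "s = a^3*q^3/(b*c*d*e*f)"
  define A where "A = c*d*e/a^2"
  define z2 where "z2 = b*f/a"
  define z3 where "z3 = a^2*q^2/(b*c*d*e*f)"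
  define SX where "SX = q*(1/(c*e/a)+1/(c*d/a)+1/(d*e/a)+1/(q/f)+1/(q/b)) + z2 + z2/A - q"
  define m5 where "m5 = z2*(c*e/a+c*d/a+d*e/a+q/f)/A + q/(q/b) + z2 + (q/b)/A - q*z2/(q/b)"
  define KX where "KX = plus_coeff q A (c*e/a) (c*d/a) (d*e/a) (q/f) (q/b) z2"
  define KY where "KY = plus_coeff q (b^2/a) b (b*c/a) (b*d/a) (b*e/a) (b*f/a) z3"
  define dX where "dX = down_coeff q A (c*e/a) (c*d/a) (d*e/a) (q/f) (q/b)"
  have e1: "q + c * s/(a*q) + d * s/(a*q) + e * s/(a*q) + a^2*q/(c*d*e) + a*q/f + a*q/b - a*q^2/(b*f) = q/z2 * SX"
    unfolding SX_def s_def z2_def A_def using nz q0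
    by (simp add: field_simps power2_eq_square power3_eq_cube)
  have e2: "a*q/c + a*q/d + a*q/e + a*q/f + b * s/(a*q) + q + s/(b*q) - b*q = q/z2 * m5"
    unfolding m5_def s_def z2_def A_def using nz q0
    by (simp add: field_simps power2_eq_square power3_eq_cube)
  have e3: "(b*f * s/(a*q^2) * (1 - b*f/(a*q)) * (1 - c*d*e*q/a^2) * (1 - c*d*e*q^2/a^2)
                   * (1 - c*d/a) * (1 - c*e/a) * (1 - d*e/a) * (1 - q/f) * (1 - q/b))
                  / ((1 - c*q/a) * (1 - d*q/a) * (1 - e*q/a)
                     * (1 - c*d*e*f/a^2) * (1 - b*c*d*e/a^2)) = q/z2 * ((q-z2)/A * KX)"
  proof -
    have h: "A*q/(c*e/a) = d*q/a" "A*q/(c*d/a) = e*q/a" "A*q/(d*e/a) = c*q/a" "A*q/(q/f) = c*d*e*f/a^2"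
      "A*q/(q/b) = b*c*d*e/a^2" "A*q = c*d*e*q/a^2" "A*q^2 = c*d*e*q^2/a^2"
      using nz q0 by (simp_all add: A_def field_simps power2_eq_square)
    have K: "KX = z2/q*(1 - c*d*e*q/a^2)*(1 - c*d*e*q^2/a^2)*((1-c*e/a)*(1-c*d/a)*(1-d*e/a)*(1-q/f)*(1-q/b))
       / ((1-d*q/a)*(1-e*q/a)*(1-c*q/a)*(1-c*d*e*f/a^2)*(1-b*c*d*e/a^2))"
      unfolding KX_def plus_coeff_def h(1-5) unfolding h(6,7) ..
    have k: "q/z2*((q-z2)/A*(z2/q*N/M)) = (q-z2)/A*N/M" for N M
      using nz q0 by (simp add: z2_def)
    have c0: "b*f * s/(a*q^2) * (1 - b*f/(a*q)) = (q-z2)/A"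
      unfolding s_def z2_def A_def using nz q0 by (simp add: field_simps power2_eq_square power3_eq_cube)
    show ?thesis unfolding K c0 using k[of "(1 - c*d*e*q/a^2)*(1 - c*d*e*q^2/a^2)*((1-c*e/a)*(1-c*d/a)*(1-d*e/a)*(1-q/f)*(1-q/b))"]
      by (simp only: mult_ac)
  qed
  have e4: "(s/(b*q) * (1 - s/(a*q^2)) * (1 - b^2*q/a) * (1 - b^2*q^2/a)
                   * (1 - b*c/a) * (1 - b*d/a) * (1 - b*e/a) * (1 - b*f/a) * (1 - b))
                  / ((1 - b*q/c) * (1 - b*q/d) * (1 - b*q/e) * (1 - b*q/f)
                     * (1 - b*q/a)) = a/b*(q-z3) * KY"
  proof -
    define B where "B = b^2/a"
    have h: "B*q/b = b*q/a" "B*q/(b*c/a) = b*q/c" "B*q/(b*d/a) = b*q/d" "B*q/(b*e/a) = b*q/e"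
      "B*q/(b*f/a) = b*q/f" "B*q = b^2*q/a" "B*q^2 = b^2*q^2/a"
      using nz q0 by (simp_all add: B_def field_simps power2_eq_square)
    have K: "KY = z3/q*(1 - b^2*q/a)*(1 - b^2*q^2/a)*((1-b)*(1-b*c/a)*(1-b*d/a)*(1-b*e/a)*(1-b*f/a))
       / ((1-b*q/a)*(1-b*q/c)*(1-b*q/d)*(1-b*q/e)*(1-b*q/f))"
      unfolding KY_def B_def[symmetric] plus_coeff_def h(1-5) unfolding h(6,7) ..
    have c0: "s/(b*q) * (1 - s/(a*q^2)) = a/b*(q-z3)*(z3/q)"
      unfolding s_def z3_def using nz q0 by (simp add: field_simps power2_eq_square power3_eq_cube)
    show ?thesis unfolding K c0
      by (simp only: mult_ac times_divide_eq_right times_divide_eq_left divide_divide_eq_left)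
  qed
  have dn: "SX * X.phi - (q-z2)/A * KX * X.phi_plus = m5 * X.phi + dX * X.phi_down"
    using X.contiguous_down unfolding A_def[symmetric] z2_def[symmetric] SX_def KX_def m5_def dX_def .
  have "bracket q a b c d e f X.phi X.phi_plus Y.phi Y.phi_plus
    = (q/z2*SX - q/z2*m5) * X.phi * Y.phi - q/z2*((q-z2)/A*KX) * X.phi_plus * Y.phi
      + a/b*(q-z3)*KY * X.phi * Y.phi_plus"
    unfolding bracket_def Let_def s_def[symmetric] e1 e2 e3 e4 ..
  also have "\<dots> = q/z2*(SX*X.phi - (q-z2)/A*KX*X.phi_plus - m5*X.phi)*Y.phi + a/b*(q-z3)*KY*X.phi*Y.phi_plus"
  proof -
    have "(u*S - u*m)*x*y - u*(g*K)*p*y + R = u*(S*x - g*K*p - m*x)*y + R" for u S m x y g K p R :: complex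
      by (simp add: algebra_simps)
    then show ?thesis .
  qed
  also have "\<dots> = q/z2*(dX*X.phi_down)*Y.phi + a/b*(q-z3)*KY*X.phi*Y.phi_plus" unfolding dn by simp
  also have "\<dots> = wron_b q a b c d e f"
    unfolding wron_b_def solX_def solY_def A_def[symmetric] z2_def[symmetric] z3_def[symmetric]
      KY_def dX_def by (simp add: z2_def mult_ac)
  finally show ?thesis .
qed

end

section \<open>The identity for generic parameters and its extension\<close>

lemma generic_params_monomials:
  assumes "q \<noteq> 0" "norm q < 1" "\<forall>x\<in>monomials q a b c d e f. generic q x"
    and "norm (b*f/a) < norm q" "norm (a^2*q^2/(b*c*d*e*f)) < norm q" and "a \<noteq> 0"
  shows "generic_params q a b c d e f"
  by unfold_locales (use assms in \<open>auto simp: monomials_def generic_nz dest: generic_nz\<close>)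

lemma domain_monomials:
  assumes q: "q \<noteq> 0" "norm q < 1" and g: "\<forall>x\<in>monomials q a b c d e f. generic q x" and a: "a \<noteq> 0"
  shows "(c*d*e/a^2, c*e/a, c*d/a, d*e/a, q/f, q/b) \<in> W87_domain q"
    "(c*d*e*q^2/a^2, c*e*q/a, c*d*q/a, d*e*q/a, q^2/f, q^2/b) \<in> W87_domain q"
    "(b^2/a, b, b*c/a, b*d/a, b*e/a, b*f/a) \<in> W87_domain q"
    "(b^2*q^2/a, b*q, b*c*q/a, b*d*q/a, b*e*q/a, b*f*q/a) \<in> W87_domain q"
proof -
  have G: "generic q (c*d*e/a^2)" "generic q (b^2/a)" "generic q (c/a)" "generic q (d/a)" "generic q (e/a)"
     "generic q (c*d*e*f/a^2)" "generic q (b*c*d*e/a^2)" "generic q f" "generic q b"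
     "generic q (b/a)" "generic q (b/c)" "generic q (b/d)" "generic q (b/e)" "generic q (b/f)"
     "generic q (b*f/a)" "generic q (a^2*q^2/(b*c*d*e*f))" "generic q c" "generic q d" "generic q e"
    using g by (auto simp: monomials_def)
  have nz: "b \<noteq> 0" "c \<noteq> 0" "d \<noteq> 0" "e \<noteq> 0" "f \<noteq> 0" using G by (auto dest: generic_nz)
  have m: "generic q (x*q)" "generic q (x*q^2)" "generic q (x/q)" if "generic q x" for x
    using generic_shift[OF that q(1), of 1] generic_shift[OF that q(1), of 2] generic_shift[OF that q(1), of "-1"]
    by (simp_all add: power_int_minus divide_inverse)
  have n1: "generic q x \<Longrightarrow> x \<noteq> 1" for x using generic_1[OF _ q(1), of x] by auto
  have i: "qinf q x \<noteq> 0" if "generic q x" for x using generic_qinf[OF that q] .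
  have e1: "c*d*e/a^2*q/(c*e/a) = d/a*q" "c*d*e/a^2*q/(c*d/a) = e/a*q" "c*d*e/a^2*q/(d*e/a) = c/a*q"
    "c*d*e/a^2*q/(q/f) = c*d*e*f/a^2" "c*d*e/a^2*q/(q/b) = b*c*d*e/a^2"
    "W87_arg q (c*d*e/a^2) [c*e/a, c*d/a, d*e/a, q/f, q/b] = b*f/a"
    using nz a q by (simp_all add: W87_arg_def field_simps power2_eq_square)
  show "(c*d*e/a^2, c*e/a, c*d/a, d*e/a, q/f, q/b) \<in> W87_domain q"
    unfolding W87_domain_def mem_Collect_eq case_prod_conv ball_simps e1
    using nz a q i[OF m(1)[OF G(3)]] i[OF m(1)[OF G(4)]] i[OF m(1)[OF G(5)]] i[OF G(6)] i[OF G(7)]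
      i[OF G(15)] n1[OF G(1)] by (intro conjI TrueI) auto
  have e2: "c*d*e*q^2/a^2*q/(c*e*q/a) = d/a*q^2" "c*d*e*q^2/a^2*q/(c*d*q/a) = e/a*q^2"
    "c*d*e*q^2/a^2*q/(d*e*q/a) = c/a*q^2"
    "c*d*e*q^2/a^2*q/(q^2/f) = c*d*e*f/a^2*q" "c*d*e*q^2/a^2*q/(q^2/b) = b*c*d*e/a^2*q"
    "W87_arg q (c*d*e*q^2/a^2) [c*e*q/a, c*d*q/a, d*e*q/a, q^2/f, q^2/b] = b*f/a/q"
    "c*d*e*q^2/a^2 = c*d*e/a^2*q^2"
    using nz a q by (simp_all add: W87_arg_def field_simps power2_eq_square)
  show "(c*d*e*q^2/a^2, c*e*q/a, c*d*q/a, d*e*q/a, q^2/f, q^2/b) \<in> W87_domain q"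
    unfolding W87_domain_def mem_Collect_eq case_prod_conv ball_simps e2(1-6) unfolding e2(7)
    using nz a q i[OF m(2)[OF G(3)]] i[OF m(2)[OF G(4)]] i[OF m(2)[OF G(5)]] i[OF m(1)[OF G(6)]] i[OF m(1)[OF G(7)]]
      i[OF m(3)[OF G(15)]] n1[OF m(2)[OF G(1)]] by (intro conjI TrueI) auto
  have e3: "b^2/a*q/b = b/a*q" "b^2/a*q/(b*c/a) = b/c*q" "b^2/a*q/(b*d/a) = b/d*q" "b^2/a*q/(b*e/a) = b/e*q"
    "b^2/a*q/(b*f/a) = b/f*q"
    "W87_arg q (b^2/a) [b, b*c/a, b*d/a, b*e/a, b*f/a] = a^2*q^2/(b*c*d*e*f)"
    using nz a q by (simp_all add: W87_arg_def field_simps power2_eq_square)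
  show "(b^2/a, b, b*c/a, b*d/a, b*e/a, b*f/a) \<in> W87_domain q"
    unfolding W87_domain_def mem_Collect_eq case_prod_conv ball_simps e3
    using nz a q i[OF m(1)[OF G(10)]] i[OF m(1)[OF G(11)]] i[OF m(1)[OF G(12)]] i[OF m(1)[OF G(13)]] i[OF m(1)[OF G(14)]]
      i[OF G(16)] n1[OF G(2)] by (intro conjI TrueI) auto
  have e4: "b^2*q^2/a*q/(b*q) = b/a*q^2" "b^2*q^2/a*q/(b*c*q/a) = b/c*q^2" "b^2*q^2/a*q/(b*d*q/a) = b/d*q^2"
    "b^2*q^2/a*q/(b*e*q/a) = b/e*q^2" "b^2*q^2/a*q/(b*f*q/a) = b/f*q^2"
    "W87_arg q (b^2*q^2/a) [b*q, b*c*q/a, b*d*q/a, b*e*q/a, b*f*q/a] = a^2*q^2/(b*c*d*e*f)/q"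
    "b^2*q^2/a = b^2/a*q^2"
    using nz a q by (simp_all add: W87_arg_def field_simps power2_eq_square)
  show "(b^2*q^2/a, b*q, b*c*q/a, b*d*q/a, b*e*q/a, b*f*q/a) \<in> W87_domain q"
    unfolding W87_domain_def mem_Collect_eq case_prod_conv ball_simps e4(1-6) unfolding e4(7)
    using nz a q i[OF m(2)[OF G(10)]] i[OF m(2)[OF G(11)]] i[OF m(2)[OF G(12)]] i[OF m(2)[OF G(13)]] i[OF m(2)[OF G(14)]]
      i[OF m(3)[OF G(16)]] n1[OF m(2)[OF G(2)]] by (intro conjI TrueI) auto
qed

text \<open>The bounds make the raised series converge, whose arguments are divided by q; the second
  power of |q| comes from \<open>z3'\<close> in \<open>wron_b_closed\<close>.\<close>

theorem bracket_closed_generic: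
  assumes q: "q \<noteq> 0" "norm q < 1" and a: "a \<noteq> 0"
    and g: "\<forall>x\<in>monomials q a b c d e f. generic q x"
    and z2: "norm (b*f/a) < norm q" and z3a: "norm (a^2*q^2/(b*c*d*e*f)) < norm q * norm q"
  shows "bracket q a b c d e f (W87 q (c*d*e/a^2) (c*e/a) (c*d/a) (d*e/a) (q/f) (q/b))
     (W87 q (c*d*e*q^2/a^2) (c*e*q/a) (c*d*q/a) (d*e*q/a) (q^2/f) (q^2/b))
     (W87 q (b^2/a) b (b*c/a) (b*d/a) (b*e/a) (b*f/a))
     (W87 q (b^2*q^2/a) (b*q) (b*c*q/a) (b*d*q/a) (b*e*q/a) (b*f*q/a)) = wron_closed q a b c d e f"
proof -
  have "norm q * norm q \<le> norm q" using q by (simp add: mult_left_le)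
  then have z3': "norm (a^2*q^2/(b*c*d*e*f)) < norm q" using z3a by linarith
  interpret generic_params q a b c d e f
    by (rule generic_params_monomials[OF q g z2 z3' a])
  have "generic q c" "generic q d" "generic q e" using g by (auto simp: monomials_def)
  note cl = wron_b_closed[OF this less_imp_le[OF z3a]]
  have ser: "W87 q A p1 p2 p3 p4 p5 = vser q A p1 p2 p3 p4 p5 (W87_arg q A [p1,p2,p3,p4,p5])"
    if "norm (W87_arg q A [p1,p2,p3,p4,p5]) < 1" for A p1 p2 p3 p4 p5
    using that unfolding W87_def by (simp add: W87_series_vser)
  have e: "W87_arg q (c*d*e/a^2) [c*e/a, c*d/a, d*e/a, q/f, q/b] = b*f/a"
    "W87_arg q (c*d*e*q^2/a^2) [c*e*q/a, c*d*q/a, d*e*q/a, q^2/f, q^2/b] = b*f/a/q"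
    "W87_arg q (b^2/a) [b, b*c/a, b*d/a, b*e/a, b*f/a] = a^2*q^2/(b*c*d*e*f)"
    "W87_arg q (b^2*q^2/a) [b*q, b*c*q/a, b*d*q/a, b*e*q/a, b*f*q/a] = a^2*q^2/(b*c*d*e*f)/q"
    using nz q by (simp_all add: W87_arg_def field_simps power2_eq_square)
  have n: "norm (b*f/a) < 1" "norm (b*f/a/q) < 1" "norm (a^2*q^2/(b*c*d*e*f)) < 1"
      "norm (a^2*q^2/(b*c*d*e*f)/q) < 1"
    using X.z1 Y.z1 z2 z3' q unfolding norm_divide[of _ q] by auto
  have "W87 q (c*d*e/a^2) (c*e/a) (c*d/a) (d*e/a) (q/f) (q/b) = X.phi"
    using ser[of "c*d*e/a^2" "c*e/a" "c*d/a" "d*e/a" "q/f" "q/b"] n unfolding e by simp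
  moreover have "W87 q (c*d*e*q^2/a^2) (c*e*q/a) (c*d*q/a) (d*e*q/a) (q^2/f) (q^2/b) = X.phi_plus"
    using ser[of "c*d*e*q^2/a^2" "c*e*q/a" "c*d*q/a" "d*e*q/a" "q^2/f" "q^2/b"] n unfolding e
    by (simp add: power2_eq_square)
  moreover have "W87 q (b^2/a) b (b*c/a) (b*d/a) (b*e/a) (b*f/a) = Y.phi"
    using ser[of "b^2/a" b "b*c/a" "b*d/a" "b*e/a" "b*f/a"] n unfolding e by simp
  moreover have "W87 q (b^2*q^2/a) (b*q) (b*c*q/a) (b*d*q/a) (b*e*q/a) (b*f*q/a) = Y.phi_plus"
    using ser[of "b^2*q^2/a" "b*q" "b*c*q/a" "b*d*q/a" "b*e*q/a" "b*f*q/a"] n unfolding e by simp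
  ultimately show ?thesis
    using bracket_wron_b cl by (simp only:)
qed

text \<open>For nonzero parameters, regularity of W2 and W3 already excludes the zeros of all
  denominators in \<open>bracket\<close> and \<open>wron_closed\<close>.\<close>

lemma domain_qinf:
  assumes q: "q \<noteq> 0" "norm q < 1" and nz: "a \<noteq> 0" "b \<noteq> 0" "c \<noteq> 0" "d \<noteq> 0" "e \<noteq> 0" "f \<noteq> 0"
    and X: "(c*d*e/a^2, c*e/a, c*d/a, d*e/a, q/f, q/b) \<in> W87_domain q"
    and Y: "(b^2/a, b, b*c/a, b*d/a, b*e/a, b*f/a) \<in> W87_domain q"
  shows "qinf q (c*q/a) \<noteq> 0" "qinf q (d*q/a) \<noteq> 0" "qinf q (e*q/a) \<noteq> 0" "qinf q (c*d*e*f/a^2) \<noteq> 0"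
    "qinf q (b*c*d*e/a^2) \<noteq> 0" "qinf q (b*q/a) \<noteq> 0" "qinf q (b*q/c) \<noteq> 0" "qinf q (b*q/d) \<noteq> 0"
    "qinf q (b*q/e) \<noteq> 0" "qinf q (b*q/f) \<noteq> 0" "qinf q (a^2*q^2/(b*c*d*e*f)) \<noteq> 0"
proof -
  have e1: "c*d*e/a^2*q/(c*e/a) = d*q/a" "c*d*e/a^2*q/(c*d/a) = e*q/a" "c*d*e/a^2*q/(d*e/a) = c*q/a"
    "c*d*e/a^2*q/(q/f) = c*d*e*f/a^2" "c*d*e/a^2*q/(q/b) = b*c*d*e/a^2"
    using nz q by (simp_all add: field_simps power2_eq_square)
  have e3: "b^2/a*q/b = b*q/a" "b^2/a*q/(b*c/a) = b*q/c" "b^2/a*q/(b*d/a) = b*q/d" "b^2/a*q/(b*e/a) = b*q/e"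
    "b^2/a*q/(b*f/a) = b*q/f"
    "W87_arg q (b^2/a) [b, b*c/a, b*d/a, b*e/a, b*f/a] = a^2*q^2/(b*c*d*e*f)"
    using nz q by (simp_all add: W87_arg_def field_simps power2_eq_square)
  show "qinf q (c*q/a) \<noteq> 0" "qinf q (d*q/a) \<noteq> 0" "qinf q (e*q/a) \<noteq> 0" "qinf q (c*d*e*f/a^2) \<noteq> 0"
    "qinf q (b*c*d*e/a^2) \<noteq> 0"
    using X unfolding W87_domain_def mem_Collect_eq case_prod_conv ball_simps e1 by blast+
  show "qinf q (b*q/a) \<noteq> 0" "qinf q (b*q/c) \<noteq> 0" "qinf q (b*q/d) \<noteq> 0"
    "qinf q (b*q/e) \<noteq> 0" "qinf q (b*q/f) \<noteq> 0" "qinf q (a^2*q^2/(b*c*d*e*f)) \<noteq> 0"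
    using Y unfolding W87_domain_def mem_Collect_eq case_prod_conv ball_simps e3 by blast+
qed

lemma qinf_nz_factor: "norm q < 1 \<Longrightarrow> qinf q x \<noteq> 0 \<Longrightarrow> 1 - x \<noteq> 0"
  using qinf_rec[of q x] by auto

lemma holomorphic_bracket:
  assumes q: "q \<noteq> 0"
    and h: "A holomorphic_on S" "B holomorphic_on S" "C holomorphic_on S" "D holomorphic_on S" "E holomorphic_on S"
      "G holomorphic_on S" "w1 holomorphic_on S" "w2 holomorphic_on S" "w3 holomorphic_on S" "w4 holomorphic_on S"
    and nz: "\<And>t. t \<in> S \<Longrightarrow> A t \<noteq> 0" "\<And>t. t \<in> S \<Longrightarrow> B t \<noteq> 0" "\<And>t. t \<in> S \<Longrightarrow> C t \<noteq> 0"
      "\<And>t. t \<in> S \<Longrightarrow> D t \<noteq> 0" "\<And>t. t \<in> S \<Longrightarrow> E t \<noteq> 0" "\<And>t. t \<in> S \<Longrightarrow> G t \<noteq> 0"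
    and nz2: "\<And>t. t \<in> S \<Longrightarrow> 1 - C t*q/A t \<noteq> 0" "\<And>t. t \<in> S \<Longrightarrow> 1 - D t*q/A t \<noteq> 0" "\<And>t. t \<in> S \<Longrightarrow> 1 - E t*q/A t \<noteq> 0"
      "\<And>t. t \<in> S \<Longrightarrow> 1 - C t*D t*E t*G t/A t^2 \<noteq> 0" "\<And>t. t \<in> S \<Longrightarrow> 1 - B t*C t*D t*E t/A t^2 \<noteq> 0"
    and nz3: "\<And>t. t \<in> S \<Longrightarrow> 1 - B t*q/A t \<noteq> 0" "\<And>t. t \<in> S \<Longrightarrow> 1 - B t*q/C t \<noteq> 0" "\<And>t. t \<in> S \<Longrightarrow> 1 - B t*q/D t \<noteq> 0"
      "\<And>t. t \<in> S \<Longrightarrow> 1 - B t*q/E t \<noteq> 0" "\<And>t. t \<in> S \<Longrightarrow> 1 - B t*q/G t \<noteq> 0"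
  shows "(\<lambda>t. bracket q (A t) (B t) (C t) (D t) (E t) (G t) (w1 t) (w2 t) (w3 t) (w4 t)) holomorphic_on S"
proof -
  note hs = holomorphic_on_add holomorphic_on_diff holomorphic_on_mult holomorphic_on_divide
    holomorphic_on_power holomorphic_on_const h no_zero_divisors power_not_zero q
  define s where "s t = A t^3*q^3/(B t*C t*D t*E t*G t)" for t
  have s: "s holomorphic_on S" unfolding s_def[abs_def] by (intro hs; erule nz)
  have 1: "(\<lambda>t. (q + C t * s t/(A t*q) + D t * s t/(A t*q) + E t * s t/(A t*q) + A t^2*q/(C t*D t*E t) + A t*q/G t + A t*q/B t - A t*q^2/(B t*G t))
       - (A t*q/C t + A t*q/D t + A t*q/E t + A t*q/G t + B t * s t/(A t*q) + q + s t/(B t*q) - B t*q)) holomorphic_on S"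
    by (intro hs s; erule nz)
  have 2: "(\<lambda>t. (B t*G t * s t/(A t*q^2) * (1 - B t*G t/(A t*q)) * (1 - C t*D t*E t*q/A t^2) * (1 - C t*D t*E t*q^2/A t^2)
                   * (1 - C t*D t/A t) * (1 - C t*E t/A t) * (1 - D t*E t/A t) * (1 - q/G t) * (1 - q/B t))
                  / ((1 - C t*q/A t) * (1 - D t*q/A t) * (1 - E t*q/A t)
                     * (1 - C t*D t*E t*G t/A t^2) * (1 - B t*C t*D t*E t/A t^2))) holomorphic_on S"
    by (intro hs s; (erule nz | erule nz2))
  have 3: "(\<lambda>t. (s t/(B t*q) * (1 - s t/(A t*q^2)) * (1 - B t^2*q/A t) * (1 - B t^2*q^2/A t)
                   * (1 - B t*C t/A t) * (1 - B t*D t/A t) * (1 - B t*E t/A t) * (1 - B t*G t/A t) * (1 - B t))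
                  / ((1 - B t*q/C t) * (1 - B t*q/D t) * (1 - B t*q/E t) * (1 - B t*q/G t)
                     * (1 - B t*q/A t))) holomorphic_on S"
    by (intro hs s; (erule nz | erule nz3))
  show ?thesis
    unfolding bracket_def Let_def s_def[symmetric]
    by (rule holomorphic_on_add[OF holomorphic_on_diff[OF
        holomorphic_on_mult[OF holomorphic_on_mult[OF 1 h(7)] h(9)] holomorphic_on_mult[OF holomorphic_on_mult[OF 2 h(8)] h(9)]]
        holomorphic_on_mult[OF holomorphic_on_mult[OF 3 h(7)] h(10)]])
qed

lemma holomorphic_qinf:
  assumes "norm q < 1" "h holomorphic_on S"
  shows "(\<lambda>t. qinf q (h t)) holomorphic_on S"
  using holomorphic_on_compose[OF assms(2) holomorphic_on_subset[OF holomorphic_qinf_UNIV[OF assms(1)] subset_UNIV]]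
  by (simp add: o_def)

theorem bracket_closed:
  assumes q: "q \<noteq> 0" "norm q < 1" and nz: "a \<noteq> 0" "b \<noteq> 0" "c \<noteq> 0" "d \<noteq> 0" "e \<noteq> 0" "f \<noteq> 0"
    and dom: "(c*d*e/a^2, c*e/a, c*d/a, d*e/a, q/f, q/b) \<in> W87_domain q"
    "(c*d*e*q^2/a^2, c*e*q/a, c*d*q/a, d*e*q/a, q^2/f, q^2/b) \<in> W87_domain q"
    "(b^2/a, b, b*c/a, b*d/a, b*e/a, b*f/a) \<in> W87_domain q"
    "(b^2*q^2/a, b*q, b*c*q/a, b*d*q/a, b*e*q/a, b*f*q/a) \<in> W87_domain q"
  shows "bracket q a b c d e f (W87 q (c*d*e/a^2) (c*e/a) (c*d/a) (d*e/a) (q/f) (q/b))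
     (W87 q (c*d*e*q^2/a^2) (c*e*q/a) (c*d*q/a) (d*e*q/a) (q^2/f) (q^2/b))
     (W87 q (b^2/a) b (b*c/a) (b*d/a) (b*e/a) (b*f/a))
     (W87 q (b^2*q^2/a) (b*q) (b*c*q/a) (b*d*q/a) (b*e*q/a) (b*f*q/a)) = wron_closed q a b c d e f"
proof -
  obtain F where F: "W87_continuation q F" using W87_continuation_exists[OF q] by blast
  \<comment> \<open>Along this curve \<open>bf/a\<close> and \<open>s/(aq)\<close> are multiplied by \<open>t\<^sup>3\<close> and \<open>t\<close>, and every monomial that
    has to be generic is a constant times a nonzero power of \<open>t\<close>.\<close>
  define A B C D E G where "A t = a*t" and "B t = b*t^3" and "C t = c/t" and "D t = d/t" and "E t = e/t"
    and "G t = f*t" for t :: complex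
  note base_defs = A_def B_def C_def D_def E_def G_def
  define c1 where "c1 t = (C t*D t*E t/A t^2, C t*E t/A t, C t*D t/A t, D t*E t/A t, q/G t, q/B t)" for t
  define c2 where "c2 t = (C t*D t*E t*q^2/A t^2, C t*E t*q/A t, C t*D t*q/A t, D t*E t*q/A t, q^2/G t, q^2/B t)" for t
  define c3 where "c3 t = (B t^2/A t, B t, B t*C t/A t, B t*D t/A t, B t*E t/A t, B t*G t/A t)" for t
  define c4 where "c4 t = (B t^2*q^2/A t, B t*q, B t*C t*q/A t, B t*D t*q/A t, B t*E t*q/A t, B t*G t*q/A t)" for t
  define S where "S = {t. t \<noteq> 0 \<and> c1 t \<in> W87_domain q \<and> c2 t \<in> W87_domain q \<and> c3 t \<in> W87_domain q \<and> c4 t \<in> W87_domain q}"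
  define N where "N = {t. \<not> (t \<noteq> 0 \<and> (\<forall>x\<in>monomials q (A t) (B t) (C t) (D t) (E t) (G t). generic q x))}"
  \<comment> \<open>The two inequalities are the bounds of \<open>bracket_closed_generic\<close> on
    the curve; they hold for all small t.\<close>
  define U where "U = {t. norm (b*f/a*t^3) < norm q} \<inter> {t. norm (a^2*q^2/(b*c*d*e*f)*t) < norm q * norm q}"
  have nzt: "A t \<noteq> 0" "B t \<noteq> 0" "C t \<noteq> 0" "D t \<noteq> 0" "E t \<noteq> 0" "G t \<noteq> 0" if "t \<noteq> 0" for t
    using that nz by (auto simp: base_defs)
  have cN: "countable N"
    unfolding N_def base_defs using countable_not_generic_monomials[OF q(1) nz] .
  \<comment> \<open>Generic points are nonsingular by \<open>domain_monomials\<close>, so only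
    countably many t are singular.\<close>
  have "- S \<subseteq> N"
  proof
    fix t assume "t \<in> - S"
    then show "t \<in> N"
      using domain_monomials[OF q _ nzt(1), of t "B t" "C t" "D t" "E t" "G t"]
      unfolding S_def N_def c1_def c2_def c3_def c4_def by blast
  qed
  then have cS: "countable (- S)" using cN countable_subset by blast
  have hA: "A holomorphic_on X" "B holomorphic_on X" "G holomorphic_on X" for X
    unfolding base_defs by (intro holomorphic_intros)+
  have hC: "C holomorphic_on X" "D holomorphic_on X" "E holomorphic_on X" if "X \<subseteq> - {0}" for X
    unfolding base_defs using that by (auto intro!: holomorphic_intros)
  have cont: "continuous_on (- {0}) A" "continuous_on (- {0}) B" "continuous_on (- {0}) C" "continuous_on (- {0}) D"
    "continuous_on (- {0}) E" "continuous_on (- {0}) G"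
    using hA hC holomorphic_on_imp_continuous_on by blast+
  have oS: "open S"
  proof -
    have "continuous_on (- {0}) c1" "continuous_on (- {0}) c2" "continuous_on (- {0}) c3" "continuous_on (- {0}) c4"
      unfolding c1_def c2_def c3_def c4_def by (intro continuous_intros cont; use nzt in auto)+
    then have "open ((- {0}) \<inter> c1 -` W87_domain q)" "open ((- {0}) \<inter> c2 -` W87_domain q)"
      "open ((- {0}) \<inter> c3 -` W87_domain q)" "open ((- {0}) \<inter> c4 -` W87_domain q)"
      by (auto intro!: continuous_open_preimage open_W87_domain q)
    moreover have "S = ((- {0}) \<inter> c1 -` W87_domain q) \<inter> ((- {0}) \<inter> c2 -` W87_domain q)
       \<inter> (((- {0}) \<inter> c3 -` W87_domain q) \<inter> ((- {0}) \<inter> c4 -` W87_domain q))"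
      by (auto simp: S_def)
    ultimately show ?thesis by (simp only: open_Int)
  qed
  have S0: "S \<subseteq> - {0}" by (auto simp: S_def)
  have nzS: "A t \<noteq> 0" "B t \<noteq> 0" "C t \<noteq> 0" "D t \<noteq> 0" "E t \<noteq> 0" "G t \<noteq> 0" if "t \<in> S" for t
    using nzt that by (auto simp: S_def)
  note h = hA[of S] hC[OF S0]
  have hF1: "(\<lambda>t. F (c1 t)) holomorphic_on S"
    unfolding c1_def
  proof (rule holomorphic_continuation_curve[OF F oS], goal_cases)
    case (7 t)
    then show ?case by (simp add: S_def c1_def)
  qed ((intro holomorphic_on_divide holomorphic_on_mult holomorphic_on_power holomorphic_on_const h
      power_not_zero; erule nzS)+)
  have hF2: "(\<lambda>t. F (c2 t)) holomorphic_on S"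
    unfolding c2_def
  proof (rule holomorphic_continuation_curve[OF F oS], goal_cases)
    case (7 t)
    then show ?case by (simp add: S_def c2_def)
  qed ((intro holomorphic_on_divide holomorphic_on_mult holomorphic_on_power holomorphic_on_const h
      power_not_zero; erule nzS)+)
  have hF3: "(\<lambda>t. F (c3 t)) holomorphic_on S"
    unfolding c3_def
  proof (rule holomorphic_continuation_curve[OF F oS], goal_cases)
    case (7 t)
    then show ?case by (simp add: S_def c3_def)
  qed ((intro holomorphic_on_divide holomorphic_on_mult holomorphic_on_power holomorphic_on_const h
      power_not_zero; erule nzS)+)
  have hF4: "(\<lambda>t. F (c4 t)) holomorphic_on S"
    unfolding c4_def
  proof (rule holomorphic_continuation_curve[OF F oS], goal_cases)
    case (7 t)
    then show ?case by (simp add: S_def c4_def)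
  qed ((intro holomorphic_on_divide holomorphic_on_mult holomorphic_on_power holomorphic_on_const h
      power_not_zero; erule nzS)+)
  define K where "K t = bracket q (A t) (B t) (C t) (D t) (E t) (G t) (F (c1 t)) (F (c2 t)) (F (c3 t)) (F (c4 t))" for t
  define Q where "Q t = wron_closed q (A t) (B t) (C t) (D t) (E t) (G t)" for t
  have dS: "(C t*D t*E t/A t^2, C t*E t/A t, C t*D t/A t, D t*E t/A t, q/G t, q/B t) \<in> W87_domain q"
    "(B t^2/A t, B t, B t*C t/A t, B t*D t/A t, B t*E t/A t, B t*G t/A t) \<in> W87_domain q" if "t \<in> S" for t
    using that by (simp_all add: S_def c1_def c3_def)
  have qz: "qinf q (C t*q/A t) \<noteq> 0" "qinf q (D t*q/A t) \<noteq> 0" "qinf q (E t*q/A t) \<noteq> 0" "qinf q (C t*D t*E t*G t/A t^2) \<noteq> 0"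
    "qinf q (B t*C t*D t*E t/A t^2) \<noteq> 0" "qinf q (B t*q/A t) \<noteq> 0" "qinf q (B t*q/C t) \<noteq> 0" "qinf q (B t*q/D t) \<noteq> 0"
    "qinf q (B t*q/E t) \<noteq> 0" "qinf q (B t*q/G t) \<noteq> 0" "qinf q (A t^2*q^2/(B t*C t*D t*E t*G t)) \<noteq> 0" if "t \<in> S" for t
    by (rule domain_qinf[OF q nzS[OF that] dS[OF that]])+
  note nf = qinf_nz_factor[OF q(2) qz(1)] qinf_nz_factor[OF q(2) qz(2)] qinf_nz_factor[OF q(2) qz(3)]
    qinf_nz_factor[OF q(2) qz(4)] qinf_nz_factor[OF q(2) qz(5)] qinf_nz_factor[OF q(2) qz(6)]
    qinf_nz_factor[OF q(2) qz(7)] qinf_nz_factor[OF q(2) qz(8)] qinf_nz_factor[OF q(2) qz(9)]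
    qinf_nz_factor[OF q(2) qz(10)]
  have hK: "K holomorphic_on S"
    unfolding K_def[abs_def]
    by (rule holomorphic_bracket[OF q(1) h(1,2,4,5,6,3) hF1 hF2 hF3 hF4]; (erule nzS | erule nf))
  have hQ: "Q holomorphic_on S"
    unfolding Q_def[abs_def] wron_closed_def
    by (intro holomorphic_on_mult holomorphic_on_divide holomorphic_on_power holomorphic_qinf[OF q(2)]
         holomorphic_on_const h no_zero_divisors power_not_zero; (erule nzS | erule qz | rule q(1)))
  \<comment> \<open>The given parameters are the point t = 1 of the curve.\<close>
  have "K 1 = Q 1"
  proof (rule curve_identity[OF oS cS hK hQ _ _ cN])
    show "open U" unfolding U_def by (intro open_Int open_Collect_less continuous_intros)
    \<comment> \<open>The point 0 lies outside \<open>S\<close>; it only witnesses that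
      \<open>U\<close> is nonempty, and \<open>curve_identity\<close> finds the points of
      \<open>S\<close> in \<open>U\<close> itself.\<close>
    have "0 \<in> U" using q by (simp add: U_def)
    then show "U \<noteq> {}" by blast
    show "1 \<in> S" unfolding S_def c1_def c2_def c3_def c4_def base_defs mem_Collect_eq power_one mult_1_right div_by_1
      using dom by (intro conjI one_neq_zero)
    fix t assume t: "t \<in> U" "t \<in> S" "t \<notin> N"
    then have t0: "t \<noteq> 0" and g: "\<forall>x\<in>monomials q (A t) (B t) (C t) (D t) (E t) (G t). generic q x"
      by (auto simp: N_def)
    have z2: "B t*G t/A t = b*f/a*t^3"
      unfolding base_defs using t0 nz by (simp add: field_simps eval_nat_numeral)
    have z3: "A t^2*q^2/(B t*C t*D t*E t*G t) = a^2*q^2/(b*c*d*e*f)*t"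
      unfolding base_defs using t0 nz by (simp add: field_simps eval_nat_numeral)
    have dt: "c1 t \<in> W87_domain q" "c2 t \<in> W87_domain q" "c3 t \<in> W87_domain q" "c4 t \<in> W87_domain q"
      using t by (auto simp: S_def)
    show "K t = Q t"
      unfolding K_def Q_def c1_def c2_def c3_def c4_def
        W87_eq_continuation[OF q F dt(1)[unfolded c1_def], symmetric]
        W87_eq_continuation[OF q F dt(2)[unfolded c2_def], symmetric]
        W87_eq_continuation[OF q F dt(3)[unfolded c3_def], symmetric]
        W87_eq_continuation[OF q F dt(4)[unfolded c4_def], symmetric]
      by (rule bracket_closed_generic[OF q nzS(1)[OF t(2)] g]) (use t in \<open>unfold z2 z3, auto simp: U_def\<close>)
  qed
  then show ?thesis
    unfolding K_def Q_def c1_def c2_def c3_def c4_def base_defs power_one mult_1_right div_by_1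
      W87_eq_continuation[OF q F dom(1)] W87_eq_continuation[OF q F dom(2)]
      W87_eq_continuation[OF q F dom(3)] W87_eq_continuation[OF q F dom(4)] .
qed

theorem mainTheorem9:
  fixes q a b c d e f s W2 W2p S2 T2 L2 W3 W3p S3 T3 L3 :: complex
  assumes q: "0 < norm q" "norm q < 1"
    and nonzero: "a \<noteq> 0" "b \<noteq> 0" "c \<noteq> 0" "d \<noteq> 0" "e \<noteq> 0" "f \<noteq> 0"
    and s: "s = a^3 * q^3 / (b * c * d * e * f)"
    and W2: "W2 = W87 q (c*d*e/a^2) (c*e/a) (c*d/a) (d*e/a) (q/f) (q/b)"
    and W2p: "W2p = W87 q (c*d*e*q^2/a^2) (c*e*q/a) (c*d*q/a) (d*e*q/a) (q^2/f) (q^2/b)"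
    and S2: "S2 = 1 / (1 - q) * (q + c * s/(a*q) + d * s/(a*q) + e * s/(a*q) + a^2*q/(c*d*e)
                  + a*q/f + a*q/b - a*q^2/(b*f))"
    and T2: "T2 = (b*f * s/(a*q^2) * (1 - b*f/(a*q)) * (1 - c*d*e*q/a^2) * (1 - c*d*e*q^2/a^2)
                   * (1 - c*d/a) * (1 - c*e/a) * (1 - d*e/a) * (1 - q/f) * (1 - q/b))
                  / ((1 - q) * (1 - c*q/a) * (1 - d*q/a) * (1 - e*q/a)
                     * (1 - c*d*e*f/a^2) * (1 - b*c*d*e/a^2))"
    and L2: "L2 = qinfs q [q^2/a, c*d*e*f/a^2, b*c*d*e/a^2, b*f/a]
                  / qinfs q [c*d*e*q/a^2, f*q/a, b*q/a, a*q^2/s]"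
    and W3: "W3 = W87 q (b^2/a) b (b*c/a) (b*d/a) (b*e/a) (b*f/a)"
    and W3p: "W3p = W87 q (b^2*q^2/a) (b*q) (b*c*q/a) (b*d*q/a) (b*e*q/a) (b*f*q/a)"
    and S3: "S3 = 1 / (1 - q) * (a*q/c + a*q/d + a*q/e + a*q/f + b * s/(a*q) + q + s/(b*q) - b*q)"
    and T3: "T3 = (s/(b*q) * (1 - s/(a*q^2)) * (1 - b^2*q/a) * (1 - b^2*q^2/a)
                   * (1 - b*c/a) * (1 - b*d/a) * (1 - b*e/a) * (1 - b*f/a) * (1 - b))
                  / ((1 - q) * (1 - b*q/c) * (1 - b*q/d) * (1 - b*q/e) * (1 - b*q/f)
                     * (1 - b*q/a))"
    and L3: "L3 = qinfs q [s/(a*q), b*q/c, b*q/d, b*q/e, b*q/f, b*q/a, b*q/s, s/b]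
                  / qinfs q [b^2*q/a, b*c/a, b*d/a, b*e/a, b*f/a, b, b/a, a*q/b]"
    and nonsing_W:
      "(c*d*e/a^2, c*e/a, c*d/a, d*e/a, q/f, q/b) \<in> W87_domain q"
      "(c*d*e*q^2/a^2, c*e*q/a, c*d*q/a, d*e*q/a, q^2/f, q^2/b) \<in> W87_domain q"
      "(b^2/a, b, b*c/a, b*d/a, b*e/a, b*f/a) \<in> W87_domain q"
      "(b^2*q^2/a, b*q, b*c*q/a, b*d*q/a, b*e*q/a, b*f*q/a) \<in> W87_domain q"
    and nonsing_T2: "(1 - c*q/a) * (1 - d*q/a) * (1 - e*q/a)
                     * (1 - c*d*e*f/a^2) * (1 - b*c*d*e/a^2) \<noteq> 0"
    and nonsing_T3: "(1 - b*q/c) * (1 - b*q/d) * (1 - b*q/e) * (1 - b*q/f) * (1 - b*q/a) \<noteq> 0"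
    and nonsing_L2: "qinfs q [c*d*e*q/a^2, f*q/a, b*q/a, a*q^2/s] \<noteq> 0"
    and nonsing_L3: "qinfs q [b^2*q/a, b*c/a, b*d/a, b*e/a, b*f/a, b, b/a, a*q/b] \<noteq> 0"
    and nonsing_rhs:
      "qinfs q [b, b/a, b*q/a, c*q/a, d*q/a, e*q/a, f*q/a, a*q/b, a*q^2/s] \<noteq> 0"
  shows "L2 * L3 * (1 - q) * ((S2 - S3) * W2 * W3 - T2 * W2p * W3 + T3 * W2 * W3p)
       = - (a*q^2/s)
         * (qinfs q [q^2/a, q/c, q/d, q/e, q/f, c*d*e*f/a^2, a^2*q/(c*d*e*f), s/(b*q), b*q^2/s]
            / qinfs q [b, b/a, b*q/a, c*q/a, d*q/a, e*q/a, f*q/a, a*q/b, a*q^2/s])"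
proof -
  have q0: "q \<noteq> 0" using q(1) by auto
  have q1: "1 - q \<noteq> 0" using q(2) by auto
  have s0: "s \<noteq> 0" using nonzero q0 by (simp add: s)
  have "(1 - q) * ((S2 - S3) * W2 * W3 - T2 * W2p * W3 + T3 * W2 * W3p) = bracket q a b c d e f W2 W2p W3 W3p"
  proof -
    have *: "(r::complex)*((1/r*x - 1/r*y)*w1*w3 - m/(r*d1*d2*d3*d4*d5)*w2*w3 + n/(r*e1*e2*e3*e4*e5)*w1*w4)
       = (x - y)*w1*w3 - m/(d1*d2*d3*d4*d5)*w2*w3 + n/(e1*e2*e3*e4*e5)*w1*w4"
      if "r \<noteq> 0" for r x y m n d1 d2 d3 d4 d5 e1 e2 e3 e4 e5 w1 w2 w3 w4
    proof -
      have d: "m/(r*d1*d2*d3*d4*d5) = 1/r*(m/(d1*d2*d3*d4*d5))" "n/(r*e1*e2*e3*e4*e5) = 1/r*(n/(e1*e2*e3*e4*e5))"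
        by (simp_all add: mult_ac)
      have k: "r*((1/r*x - 1/r*y)*w1*w3 - 1/r*g*w2*w3 + 1/r*h*w1*w4) = (r*(1/r))*((x - y)*w1*w3 - g*w2*w3 + h*w1*w4)" for g h
        by (simp add: algebra_simps)
      show ?thesis unfolding d k using that by simp
    qed
    show ?thesis
      unfolding S2 S3 T2 T3 bracket_def Let_def s[symmetric] by (rule *[OF q1])
  qed
  also have "\<dots> = wron_closed q a b c d e f"
    unfolding W2 W2p W3 W3p by (rule bracket_closed[OF q0 q(2) nonzero nonsing_W])
  finally have br: "L2 * L3 * (1 - q) * ((S2 - S3) * W2 * W3 - T2 * W2p * W3 + T3 * W2 * W3p)
      = L2 * L3 * wron_closed q a b c d e f"
    by (simp only: mult.assoc)
  have saq: "a^2*q^2/(b*c*d*e*f) = s/(a*q)"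
    using nonzero q0 by (simp add: s field_simps power2_eq_square power3_eq_cube)
  \<comment> \<open>The quasi-periodicity under x -> x/q of the theta function formed by the
    products at x and q/x, with x = s/b: each product exchanges one linear factor, and the two
    factors differ by a monomial.\<close>
  have theta: "a*q/b * (qinf q (b*q/s) * qinf q (s/b)) = - (a*q^2/s) * (qinf q (s/(b*q)) * qinf q (b*q^2/s))"
  proof -
    have k: "k*((x*u)*y) = l*((z*y)*u)" if "k*x = l*z" for k l x y z u :: complex
      using arg_cong[OF that, of "\<lambda>w. w*(u*y)"] by (simp only: mult_ac)
    have r: "qinf q (s/(b*q)) = (1 - s/(b*q)) * qinf q (s/b)" "qinf q (b*q/s) = (1 - b*q/s) * qinf q (b*q^2/s)"
      using qinf_rec[OF q(2), of "s/(b*q)"] qinf_rec[OF q(2), of "b*q/s"] q0 by (simp_all add: power2_eq_square mult.assoc)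
    have "a*q/b * (1 - b*q/s) = - (a*q^2/s) * (1 - s/(b*q))"
      using nonzero q0 s0 by (simp add: field_simps power2_eq_square)
    then show ?thesis unfolding r by (rule k)
  qed
  define N where "N = qinf q (q^2/a) * qinf q (c*d*e*f/a^2)
    * (qinf q (q/c) * qinf q (q/d) * qinf q (q/e) * qinf q (q/f) * qinf q (a^2*q/(c*d*e*f)))"
  define M where "M = qinf q b * qinf q (b/a) * qinf q (b*q/a) * qinf q (c*q/a) * qinf q (d*q/a) * qinf q (e*q/a)
    * qinf q (f*q/a) * qinf q (a*q/b) * qinf q (a*q^2/s)"
  \<comment> \<open>The products that cancel between L2, L3 and the closed form; they are nonzero by
    \<open>domain_qinf\<close> and the nonsingularity of L2 and L3.\<close>
  define P where "P = qinf q (b*c*d*e/a^2) * qinf q (b*f/a) * qinf q (s/(a*q)) * qinf q (b*q/c) * qinf q (b*q/d)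
    * qinf q (b*q/e) * qinf q (b*q/f) * qinf q (b*q/a) * qinf q (c*d*e*q/a^2) * qinf q (b^2*q/a)
    * qinf q (b*c/a) * qinf q (b*d/a) * qinf q (b*e/a)"
  have "P \<noteq> 0"
    using domain_qinf[OF q0 q(2) nonzero nonsing_W(1) nonsing_W(3), unfolded saq] nonsing_L2 nonsing_L3
    by (simp add: P_def qinfs_def)
  have "L2 * L3 * wron_closed q a b c d e f
      = (P * (N * (a*q/b * (qinf q (b*q/s) * qinf q (s/b))))) / (P * M)"
    unfolding L2 L3 wron_closed_def saq qinfs_def list.map prod_list.Cons prod_list.Nil P_def N_def M_def
    by (simp only: times_divide_times_eq times_divide_eq_left times_divide_eq_right mult_1_left mult_1_right divide_divide_eq_left mult_ac)
  also have "\<dots> = - (a*q^2/s) * (N * (qinf q (s/(b*q)) * qinf q (b*q^2/s)) / M)"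
    unfolding theta using \<open>P \<noteq> 0\<close> by (simp add: mult_ac)
  also have "\<dots> = - (a*q^2/s)
         * (qinfs q [q^2/a, q/c, q/d, q/e, q/f, c*d*e*f/a^2, a^2*q/(c*d*e*f), s/(b*q), b*q^2/s]
            / qinfs q [b, b/a, b*q/a, c*q/a, d*q/a, e*q/a, f*q/a, a*q/b, a*q^2/s])"
    unfolding qinfs_def list.map prod_list.Cons prod_list.Nil N_def M_def by (simp only: mult_1_left mult_1_right mult_ac)
  finally show ?thesis using br by simp
qed

end
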